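(* As $c\to+\infty$, the functions $V^c$ converge to $V$ uniformly on compact subsets of $\widetilde{\mathcal{D}}$. Moreover, if $(t,p,z)\in\alpha$ then $V(t,p,z)=0$. Finally, if $(t,p,z)\in\beta$ then $$V(t,p,z)=\bar u\,\mathbb{E}\Big[\int_t^T e^{-r(s-t)}(P^{t,p}(s)-K)\,ds\Big].$$
   Context: Setting (swing contract with strict constraints). Let $T>0$, $r\ge0$, $K>0$, $\bar u>0$, $m,M\ge0$ with $m<M$. Let $(\Omega,\mathcal{F}_T,\{\mathcal{F}_s\}_{s\in[0,T]},\mathbb{P})$ be a filtered probability space with a real $\{\mathcal{F}_s\}_s$-adapted Brownian motion $W$ (Brownian with respect to the filtration). Let $f,\sigma\in C([0,T]\times\mathbb{R};\mathbb{R})$ be Lipschitz continuous in the second variable uniformly in the first. For $(t,p)\in[0,T]\times\mathbb{R}$ let $P^{t,p}$ be the unique strong solution of $dP^{t,p}(s)=f(s,P^{t,p}(s))ds+\sigma(s,P^{t,p}(s))dW(s)$, $s\in[t,T]$, $P^{t,p}(t)=p$. Let $\mathcal{A}_t$ be the set of $[0,\bar u]$-valued progressively measurable processes $u=\{u(s)\}_{s\in[t,T]}$; for $z\in\mathbb{R}$ put $Z^{t,z;u}(s)=z+\int_t^s u(\tau)d\tau$ and $\mathcal{A}_{tz}^{\mathrm{adm}}=\{u\in\mathcal{A}_t:Z^{t,z;u}(T)\in[m,M]\ \mathbb{P}\text{-a.s.}\}$. Let $\mathcal{D}=\{(t,p,z)\in[0,T]\times\mathbb{R}^2: m-\bar u(T-t)\le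 z\le M\}$, $\widetilde{\mathcal{D}}=\{(t,p,z)\in[0,T]\times\mathbb{R}^2: m-\bar u(T-t)<z<M\}$, $\alpha=\{(t,p,z)\in\mathcal{D}:z=M\}$, $\beta=\{(t,p,z)\in\mathcal{D}:z+\bar u(T-t)=m\}$. For $(t,p,z)\in\mathcal{D}$ let $$V(t,p,z)=\sup_{u\in\mathcal{A}_{tz}^{\mathrm{adm}}}\mathbb{E}\Big[\int_t^T e^{-r(s-t)}(P^{t,p}(s)-K)u(s)\,ds\Big].$$ For $c>0$ let $\Phi^c(z)=-c\big[\big(z-(M-\tfrac1{\sqrt c})\big)^+ +\big((m+\tfrac1{\sqrt c})-z\big)^+\big]$ and, for $(t,p,z)\in[0,T]\times\mathbb{R}^2$, $$V^c(t,p,z)=\sup_{u\in\mathcal{A}_t}\mathbb{E}\Big[\int_t^T e^{-r(s-t)}(P^{t,p}(s)-K)u(s)\,ds+e^{-r(T-t)}\Phi^c(Z^{t,z;u}(T))\Big].$$ *)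

theory Defs
  imports "HOL-Probability.Probability"
begin

section \<open>Filtered probability spaces and Brownian motion on a finite horizon\<close>

text \<open>Processes have type \<open>real \<Rightarrow> 'a \<Rightarrow> real\<close> (time first); their values at times outside the
  interval under consideration are irrelevant. No usual conditions are imposed on the filtration.\<close>

definition filtered_prob_space :: "real \<Rightarrow> 'a measure \<Rightarrow> (real \<Rightarrow> 'a measure) \<Rightarrow> bool" where
  "filtered_prob_space T \<mu> F \<longleftrightarrow>
     prob_space \<mu> \<and>
     (\<forall>s\<in>{0..T}. subalgebra \<mu> (F s)) \<and>
     (\<forall>s\<in>{0..T}. \<forall>s'\<in>{s..T}. sets (F s) \<subseteq> sets (F s')) \<and>
     sets (F T) = sets \<mu>"

definition brownian_motion_wrt ::
  "real \<Rightarrow> 'a measure \<Rightarrow> (real \<Rightarrow> 'a measure) \<Rightarrow> (real \<Rightarrow> 'a \<Rightarrow> real) \<Rightarrow> bool" where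
  "brownian_motion_wrt T \<mu> F W \<longleftrightarrow>
     (\<forall>s\<in>{0..T}. W s \<in> borel_measurable (F s)) \<and>
     (AE \<omega> in \<mu>. W 0 \<omega> = 0) \<and>
     (AE \<omega> in \<mu>. continuous_on {0..T} (\<lambda>s. W s \<omega>)) \<and>
     (\<forall>s\<in>{0..T}. \<forall>s'\<in>{s<..T}.
        prob_space.indep_set \<mu> (sets (F s))
          (sets (vimage_algebra (space \<mu>) (\<lambda>\<omega>. W s' \<omega> - W s \<omega>) borel)) \<and>
        distributed \<mu> lborel (\<lambda>\<omega>. W s' \<omega> - W s \<omega>) (normal_density 0 (sqrt (s' - s))))"

definition progressively_measurable ::
  "(real \<Rightarrow> 'a measure) \<Rightarrow> real \<Rightarrow> real \<Rightarrow> (real \<Rightarrow> 'a \<Rightarrow> real) \<Rightarrow> bool" where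
  "progressively_measurable F a b X \<longleftrightarrow>
     (\<forall>s\<in>{a..b}. (\<lambda>(\<tau>, \<omega>). X \<tau> \<omega>) \<in> borel_measurable (restrict_space borel {a..s} \<Otimes>\<^sub>M F s))"


section \<open>The Ito integral\<close>

definition converges_in_probability ::
  "'a measure \<Rightarrow> (nat \<Rightarrow> 'a \<Rightarrow> real) \<Rightarrow> ('a \<Rightarrow> real) \<Rightarrow> bool" where
  "converges_in_probability \<mu> Y Z \<longleftrightarrow>
     (\<forall>\<epsilon>>0. (\<lambda>k. measure \<mu> {\<omega> \<in> space \<mu>. \<epsilon> \<le> \<bar>Y k \<omega> - Z \<omega>\<bar>}) \<longlonglongrightarrow> 0)"

text \<open>A simple integrand on \<open>[a,b]\<close> is \<open>\<Sum>i<n. \<xi> i * indicator {\<theta> i <.. \<theta> (i+1)}\<close> with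
  \<open>\<xi> i\<close> bounded and measurable with respect to \<open>F (\<theta> i)\<close>.\<close>

definition simple_integrand_data ::
  "'a measure \<Rightarrow> (real \<Rightarrow> 'a measure) \<Rightarrow> real \<Rightarrow> real \<Rightarrow> nat \<Rightarrow> (nat \<Rightarrow> real) \<Rightarrow> (nat \<Rightarrow> 'a \<Rightarrow> real) \<Rightarrow> bool"
  where
  "simple_integrand_data \<mu> F a b n \<theta> \<xi> \<longleftrightarrow>
     a \<le> \<theta> 0 \<and> \<theta> n \<le> b \<and> (\<forall>i<n. \<theta> i \<le> \<theta> (Suc i)) \<and>
     (\<forall>i<n. \<xi> i \<in> borel_measurable (F (\<theta> i)) \<and> (\<exists>B. \<forall>\<omega>\<in>space \<mu>. \<bar>\<xi> i \<omega>\<bar> \<le> B))"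

definition simple_process ::
  "nat \<Rightarrow> (nat \<Rightarrow> real) \<Rightarrow> (nat \<Rightarrow> 'a \<Rightarrow> real) \<Rightarrow> real \<Rightarrow> 'a \<Rightarrow> real" where
  "simple_process n \<theta> \<xi> s \<omega> = (\<Sum>i<n. \<xi> i \<omega> * indicator {\<theta> i<..\<theta> (Suc i)} s)"

definition simple_ito_integral ::
  "(real \<Rightarrow> 'a \<Rightarrow> real) \<Rightarrow> nat \<Rightarrow> (nat \<Rightarrow> real) \<Rightarrow> (nat \<Rightarrow> 'a \<Rightarrow> real) \<Rightarrow> 'a \<Rightarrow> real" where
  "simple_ito_integral W n \<theta> \<xi> \<omega> = (\<Sum>i<n. \<xi> i \<omega> * (W (\<theta> (Suc i)) \<omega> - W (\<theta> i) \<omega>))"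

text \<open>\<open>has_ito_integral \<mu> F W a b X I\<close>: the random variable \<open>I\<close> is (a version of)
  \<open>\<integral>\<^sub>a\<^sup>b X dW\<close>, for progressively measurable \<open>X\<close> with \<open>\<integral>\<^sub>a\<^sup>b X\<^sup>2 ds < \<infinity>\<close> almost surely. It is the
  limit in probability of the integrals of simple integrands approximating \<open>X\<close> in the sense that
  \<open>\<integral>\<^sub>a\<^sup>b (X\<^sub>k - X)\<^sup>2 ds\<close> tends to \<open>0\<close> in probability; such approximations always exist, and the
  limit does not depend on the one chosen, up to null sets.\<close>

definition has_ito_integral ::
  "'a measure \<Rightarrow> (real \<Rightarrow> 'a measure) \<Rightarrow> (real \<Rightarrow> 'a \<Rightarrow> real) \<Rightarrow> real \<Rightarrow> real \<Rightarrow>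
   (real \<Rightarrow> 'a \<Rightarrow> real) \<Rightarrow> ('a \<Rightarrow> real) \<Rightarrow> bool" where
  "has_ito_integral \<mu> F W a b X I \<longleftrightarrow>
     progressively_measurable F a b X \<and>
     (AE \<omega> in \<mu>. set_integrable lborel {a..b} (\<lambda>s. (X s \<omega>)\<^sup>2)) \<and>
     I \<in> borel_measurable \<mu> \<and>
     (\<exists>n \<theta> \<xi>.
        (\<forall>k. simple_integrand_data \<mu> F a b (n k) (\<theta> k) (\<xi> k)) \<and>
        converges_in_probability \<mu>
          (\<lambda>k \<omega>. LINT s:{a..b}|lborel. (simple_process (n k) (\<theta> k) (\<xi> k) s \<omega> - X s \<omega>)\<^sup>2) (\<lambda>\<omega>. 0) \<and>
        converges_in_probability \<mu> (\<lambda>k. simple_ito_integral W (n k) (\<theta> k) (\<xi> k)) I)"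

text \<open>\<open>P\<close> solves \<open>dP(s) = f(s,P(s)) ds + \<sigma>(s,P(s)) dW(s)\<close> on \<open>[t,T]\<close> with \<open>P(t) = p\<close>, driven by the
  given \<open>W\<close> on the given space. Sample paths are only required to be continuous almost
  surely; progressive measurability, automatic for adapted processes all of whose paths are
  continuous, is therefore required explicitly.\<close>

definition strong_solution ::
  "real \<Rightarrow> 'a measure \<Rightarrow> (real \<Rightarrow> 'a measure) \<Rightarrow> (real \<Rightarrow> 'a \<Rightarrow> real) \<Rightarrow>
   (real \<Rightarrow> real \<Rightarrow> real) \<Rightarrow> (real \<Rightarrow> real \<Rightarrow> real) \<Rightarrow> real \<Rightarrow> real \<Rightarrow> (real \<Rightarrow> 'a \<Rightarrow> real) \<Rightarrow> bool" where
  "strong_solution T \<mu> F W f \<sigma> t p P \<longleftrightarrow>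
     progressively_measurable F t T P \<and>
     (AE \<omega> in \<mu>. continuous_on {t..T} (\<lambda>s. P s \<omega>)) \<and>
     (AE \<omega> in \<mu>. P t \<omega> = p) \<and>
     (\<exists>I. \<forall>s\<in>{t..T}.
        has_ito_integral \<mu> F W t s (\<lambda>\<tau> \<omega>. \<sigma> \<tau> (P \<tau> \<omega>)) (I s) \<and>
        (AE \<omega> in \<mu>. P s \<omega> = p + (LINT \<tau>:{t..s}|lborel. f \<tau> (P \<tau> \<omega>)) + I s \<omega>))"


section \<open>The swing contract\<close>

text \<open>\<open>\<mu>\<close> is the probability measure, \<open>ub\<close> is the maximal exercise rate, and
  \<open>m\<close>, \<open>M\<close> are the bounds on the cumulated quantity.\<close>

definition controls ::
  "real \<Rightarrow> 'a measure \<Rightarrow> (real \<Rightarrow> 'a measure) \<Rightarrow> real \<Rightarrow> real \<Rightarrow> (real \<Rightarrow> 'a \<Rightarrow> real) set" where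
  "controls T \<mu> F ub t =
     {u. progressively_measurable F t T u \<and> (\<forall>s\<in>{t..T}. \<forall>\<omega>\<in>space \<mu>. u s \<omega> \<in> {0..ub})}"

definition cumulated :: "real \<Rightarrow> real \<Rightarrow> (real \<Rightarrow> 'a \<Rightarrow> real) \<Rightarrow> real \<Rightarrow> 'a \<Rightarrow> real" where
  "cumulated t z u s \<omega> = z + (LINT \<tau>:{t..s}|lborel. u \<tau> \<omega>)"

definition adm_controls ::
  "real \<Rightarrow> 'a measure \<Rightarrow> (real \<Rightarrow> 'a measure) \<Rightarrow> real \<Rightarrow> real \<Rightarrow> real \<Rightarrow> real \<Rightarrow> real \<Rightarrow>
   (real \<Rightarrow> 'a \<Rightarrow> real) set" where
  "adm_controls T \<mu> F ub m M t z =
     {u \<in> controls T \<mu> F ub t. AE \<omega> in \<mu>. cumulated t z u T \<omega> \<in> {m..M}}"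

definition swing_domain :: "real \<Rightarrow> real \<Rightarrow> real \<Rightarrow> real \<Rightarrow> (real \<times> real \<times> real) set" where
  "swing_domain T ub m M = {(t, p, z). t \<in> {0..T} \<and> m - ub * (T - t) \<le> z \<and> z \<le> M}"

definition swing_domain_strict :: "real \<Rightarrow> real \<Rightarrow> real \<Rightarrow> real \<Rightarrow> (real \<times> real \<times> real) set" where
  "swing_domain_strict T ub m M = {(t, p, z). t \<in> {0..T} \<and> m - ub * (T - t) < z \<and> z < M}"

definition boundary_alpha :: "real \<Rightarrow> real \<Rightarrow> real \<Rightarrow> real \<Rightarrow> (real \<times> real \<times> real) set" where
  "boundary_alpha T ub m M = {(t, p, z) \<in> swing_domain T ub m M. z = M}"

definition boundary_beta :: "real \<Rightarrow> real \<Rightarrow> real \<Rightarrow> real \<Rightarrow> (real \<times> real \<times> real) set" where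
  "boundary_beta T ub m M = {(t, p, z) \<in> swing_domain T ub m M. z + ub * (T - t) = m}"

definition running_payoff ::
  "(real \<Rightarrow> real \<Rightarrow> real \<Rightarrow> 'a \<Rightarrow> real) \<Rightarrow> real \<Rightarrow> real \<Rightarrow> real \<Rightarrow> real \<Rightarrow> real \<Rightarrow>
   (real \<Rightarrow> 'a \<Rightarrow> real) \<Rightarrow> 'a \<Rightarrow> real" where
  "running_payoff P T r K t p u \<omega> =
     (LINT s:{t..T}|lborel. exp (- r * (s - t)) * (P t p s \<omega> - K) * u s \<omega>)"

text \<open>Controls are bounded and \<open>P\<^sup>t\<^sup>,\<^sup>p\<close> has finite moments, so the expectations below are finite and
  bounded uniformly in the control: the suprema are genuine suprema of bounded sets of reals, which
  are nonempty for \<open>(t,p,z)\<close> in the respective domains of the two value functions.\<close>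

definition swing_value ::
  "'a measure \<Rightarrow> (real \<Rightarrow> 'a measure) \<Rightarrow> (real \<Rightarrow> real \<Rightarrow> real \<Rightarrow> 'a \<Rightarrow> real) \<Rightarrow>
   real \<Rightarrow> real \<Rightarrow> real \<Rightarrow> real \<Rightarrow> real \<Rightarrow> real \<Rightarrow> real \<Rightarrow> real \<Rightarrow> real \<Rightarrow> real" where
  "swing_value \<mu> F P T r K ub m M t p z =
     (SUP u \<in> adm_controls T \<mu> F ub m M t z.
        prob_space.expectation \<mu> (running_payoff P T r K t p u))"

definition penalty :: "real \<Rightarrow> real \<Rightarrow> real \<Rightarrow> real \<Rightarrow> real" where
  "penalty m M c z =
     - c * (max 0 (z - (M - 1 / sqrt c)) + max 0 ((m + 1 / sqrt c) - z))"

definition penalized_value ::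
  "'a measure \<Rightarrow> (real \<Rightarrow> 'a measure) \<Rightarrow> (real \<Rightarrow> real \<Rightarrow> real \<Rightarrow> 'a \<Rightarrow> real) \<Rightarrow>
   real \<Rightarrow> real \<Rightarrow> real \<Rightarrow> real \<Rightarrow> real \<Rightarrow> real \<Rightarrow> real \<Rightarrow> real \<Rightarrow> real \<Rightarrow> real \<Rightarrow> real" where
  "penalized_value \<mu> F P T r K ub m M c t p z =
     (SUP u \<in> controls T \<mu> F ub t.
        prob_space.expectation \<mu> (\<lambda>\<omega>. running_payoff P T r K t p u \<omega>
          + exp (- r * (T - t)) * penalty m M c (cumulated t z u T \<omega>)))"

end

theory Submission
  imports Defs
begin

text \<open>
  Two controls \<open>u\<close>, \<open>w\<close> are compared by the expected distance \<open>d = E \<integral> \<bar>u - w\<bar> ds\<close>. Young's inequality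
  \<open>x y \<le> x\<^sup>2 / (2 l) + l y\<^sup>2 / 2\<close>, together with \<open>\<bar>u - w\<bar>\<^sup>2 \<le> ub \<bar>u - w\<bar>\<close>, bounds the difference of their
  expected payoffs by \<open>C / (2 l) + l ub d / 2\<close> for every \<open>l > 0\<close>, where \<open>C\<close> bounds \<open>E \<integral> (P - K)\<^sup>2 ds\<close>
  (\<open>payoff_comparison\<close>). The other ingredient is a projection onto the admissible controls: stop
  exercising once the cumulated quantity has reached the upper bound, and exercise at full rate once
  only the full rate still attains the lower bound. This moves a control by exactly the distance of
  its terminal quantity from the allowed interval (\<open>clamped_control_path\<close>).

  Projecting onto \<open>[m, M]\<close>, the penalty pays for the move: with \<open>l\<close> proportional to \<open>c\<close> the terms in
  \<open>d\<close> cancel and \<open>V\<^sup>c \<le> V + O(1 / c)\<close> remains (\<open>penalized_value_upper\<close>). For the converse, an admissible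
  control is projected onto \<open>[m + \<epsilon>, M - \<epsilon>]\<close> with \<open>\<epsilon> = 1 / sqrt c\<close>, where the penalty vanishes; the
  move is at most \<open>\<epsilon>\<close>, so \<open>l = 1 / sqrt \<epsilon>\<close> gives \<open>V \<le> V\<^sup>c + O(sqrt \<epsilon>)\<close> (\<open>penalized_value_lower\<close>). On
  a compact subset of the open domain there is a uniform margin that permits this projection as
  soon as \<open>c\<close> is large. On the two boundary pieces the constraint forces the control to be
  almost everywhere \<open>0\<close>, respectively \<open>ub\<close>, so the value is the payoff of that constant control.

  Uniformity in \<open>(t, p)\<close> rests on a bound for \<open>E \<integral> (1 + P\<^sup>2) ds\<close> that depends on \<open>p\<close> only through
  \<open>p\<^sup>2\<close> (\<open>strong_solution_second_moment\<close>). A Gronwall argument needs this quantity to be finite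
  beforehand. Instead of stopping times, the clock \<open>y s = \<integral>\<^sub>t\<^sup>s (1 + P\<^sup>2)\<close> is capped at a level \<open>N\<close>, and the
  Ito isometry is used in the truncated form
  \<open>E (I\<^sup>2; \<integral> X\<^sup>2 < N) \<le> E (min (\<integral> X\<^sup>2) N)\<close> (\<open>truncated_ito_inequality\<close>), whose sides are both
  finite. Gronwall's lemma then bounds \<open>E (min (y s) N)\<close> uniformly in \<open>N\<close>.
\<close>

section \<open>Moments of simple stochastic integrals\<close>

locale filtered_space = prob_space \<mu> for \<mu> :: "'a measure" +
  fixes T :: real and F :: "real \<Rightarrow> 'a measure"
  assumes filtration: "filtered_prob_space T \<mu> F"
begin

lemma subalgebra_F: "s \<in> {0..T} \<Longrightarrow> subalgebra \<mu> (F s)"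
  using filtration by (auto simp: filtered_prob_space_def)

lemma space_F: "s \<in> {0..T} \<Longrightarrow> space (F s) = space \<mu>"
  using subalgebra_F by (auto simp: subalgebra_def)

lemma measurable_F_imp: "s \<in> {0..T} \<Longrightarrow> g \<in> measurable (F s) N \<Longrightarrow> g \<in> measurable \<mu> N"
  using subalgebra_F measurable_from_subalg by blast

lemma measurable_F_mono:
  assumes "0 \<le> s" "s \<le> s'" "s' \<le> T" "g \<in> measurable (F s) N"
  shows "g \<in> measurable (F s') N"
proof -
  have "subalgebra (F s') (F s)"
    using filtration assms by (auto simp: filtered_prob_space_def subalgebra_def)
  then show ?thesis using assms(4) measurable_from_subalg by blast
qed

end

locale brownian_space = filtered_space +
  fixes W :: "real \<Rightarrow> 'a \<Rightarrow> real"
  assumes brownian: "brownian_motion_wrt T \<mu> F W"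
begin

lemma W_measurable: "s \<in> {0..T} \<Longrightarrow> W s \<in> borel_measurable (F s)"
  using brownian by (auto simp: brownian_motion_wrt_def)

lemma W_increment_measurable:
  assumes "0 \<le> s" "s \<le> s'" "s' \<le> T"
  shows "(\<lambda>\<omega>. W s' \<omega> - W s \<omega>) \<in> borel_measurable (F s')"
  using W_measurable[of s'] measurable_F_mono[OF assms W_measurable[of s]] assms by auto

lemma indep_increment:
  assumes st: "0 \<le> s" "s < s'" "s' \<le> T" and Y: "Y \<in> borel_measurable (F s)"
    and g: "g \<in> borel_measurable borel"
  shows "indep_var borel Y borel (\<lambda>\<omega>. g (W s' \<omega> - W s \<omega>) :: real)"
proof -
  let ?D = "\<lambda>\<omega>. W s' \<omega> - W s \<omega>"
  have ind: "indep_set (sets (F s)) (sets (vimage_algebra (space \<mu>) ?D borel))"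
    using brownian st by (auto simp: brownian_motion_wrt_def)
  have D: "?D \<in> borel_measurable \<mu>"
    using measurable_F_imp[OF _ W_increment_measurable[of s s']] st by auto
  have Ym: "Y \<in> borel_measurable \<mu>" using measurable_F_imp[OF _ Y] st by auto
  have "indep_var borel Y borel ?D"
    unfolding indep_var_eq
  proof (intro conjI Ym D)
    have sp: "space (F s) = space \<mu>" using space_F[of s] st by auto
    have b: "{Y -` A \<inter> space \<mu> |A. A \<in> sets borel} \<subseteq> sets (F s)"
      using measurable_sets[OF Y] unfolding sp by auto
    have c: "{?D -` A \<inter> space \<mu> |A. A \<in> sets borel} \<subseteq> sets (vimage_algebra (space \<mu>) ?D borel)"
      by (clarify, rule in_vimage_algebra)
    show "indep_set (sigma_sets (space \<mu>) {Y -` A \<inter> space \<mu> |A. A \<in> sets borel})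
     (sigma_sets (space \<mu>) {?D -` A \<inter> space \<mu> |A. A \<in> sets borel})"
    proof -
      have 1: "sigma_sets (space \<mu>) {Y -` A \<inter> space \<mu> |A. A \<in> sets borel} \<subseteq> sets (F s)"
        using sets.sigma_sets_subset[OF b] unfolding sp .
      have 2: "sigma_sets (space \<mu>) {?D -` A \<inter> space \<mu> |A. A \<in> sets borel} \<subseteq> sets (vimage_algebra (space \<mu>) ?D borel)"
        using sets.sigma_sets_subset[OF c] unfolding space_vimage_algebra .
      show ?thesis
        unfolding indep_sets2_eq
      proof (intro conjI ballI)
        fix A B assume "A \<in> sigma_sets (space \<mu>) {Y -` A \<inter> space \<mu> |A. A \<in> sets borel}"
          "B \<in> sigma_sets (space \<mu>) {?D -` A \<inter> space \<mu> |A. A \<in> sets borel}"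
        then show "prob (A \<inter> B) = prob A * prob B"
          by (intro indep_setD[OF ind] subsetD[OF 1] subsetD[OF 2])
      next
        show "sigma_sets (space \<mu>) {Y -` A \<inter> space \<mu> |A. A \<in> sets borel} \<subseteq> events"
          using 1 indep_setD_ev1[OF ind] by (rule subset_trans)
        show "sigma_sets (space \<mu>) {?D -` A \<inter> space \<mu> |A. A \<in> sets borel} \<subseteq> events"
          using 2 indep_setD_ev2[OF ind] by (rule subset_trans)
      qed
    qed
  qed
  from indep_var_compose[OF this, of "\<lambda>x. x" borel g borel] g show ?thesis
    by (auto simp: comp_def)
qed

lemma increment_moments:
  assumes st: "0 \<le> s" "s < s'" "s' \<le> T"
  shows "integrable \<mu> (\<lambda>\<omega>. W s' \<omega> - W s \<omega>)" "(\<integral>\<omega>. W s' \<omega> - W s \<omega> \<partial>\<mu>) = 0"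
    "integrable \<mu> (\<lambda>\<omega>. (W s' \<omega> - W s \<omega>)\<^sup>2)" "(\<integral>\<omega>. (W s' \<omega> - W s \<omega>)\<^sup>2 \<partial>\<mu>) = s' - s"
proof -
  have d: "distributed \<mu> lborel (\<lambda>\<omega>. W s' \<omega> - W s \<omega>) (normal_density 0 (sqrt (s' - s)))"
    using brownian st by (auto simp: brownian_motion_wrt_def)
  have p: "0 < sqrt (s' - s)" using st by simp
  show "integrable \<mu> (\<lambda>\<omega>. W s' \<omega> - W s \<omega>)"
    using distributed_integrable[OF d, of "\<lambda>x. x"] integrable_normal_moment[OF p, of 0 1] by simp
  show e: "(\<integral>\<omega>. W s' \<omega> - W s \<omega> \<partial>\<mu>) = 0"
    using normal_distributed_expectation[OF p d] .
  show "integrable \<mu> (\<lambda>\<omega>. (W s' \<omega> - W s \<omega>)\<^sup>2)"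
    using distributed_integrable[OF d, of "\<lambda>x. x\<^sup>2"] integrable_normal_moment[OF p, of 0 2] by simp
  show "(\<integral>\<omega>. (W s' \<omega> - W s \<omega>)\<^sup>2 \<partial>\<mu>) = s' - s"
    using normal_distributed_variance[OF p d] e st by simp
qed

lemma weighted_increment:
  assumes st: "0 \<le> s" "s \<le> s'" "s' \<le> T" and Y: "Y \<in> borel_measurable (F s)" "integrable \<mu> Y"
  shows "integrable \<mu> (\<lambda>\<omega>. Y \<omega> * (W s' \<omega> - W s \<omega>))"
    "(\<integral>\<omega>. Y \<omega> * (W s' \<omega> - W s \<omega>) \<partial>\<mu>) = 0"
    "integrable \<mu> (\<lambda>\<omega>. Y \<omega> * (W s' \<omega> - W s \<omega>)\<^sup>2)"
    "(\<integral>\<omega>. Y \<omega> * (W s' \<omega> - W s \<omega>)\<^sup>2 \<partial>\<mu>) = (\<integral>\<omega>. Y \<omega> \<partial>\<mu>) * (s' - s)"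
proof -
  consider "s = s'" | "s < s'" using st by linarith
  then have "integrable \<mu> (\<lambda>\<omega>. Y \<omega> * (W s' \<omega> - W s \<omega>)) \<and>
    (\<integral>\<omega>. Y \<omega> * (W s' \<omega> - W s \<omega>) \<partial>\<mu>) = 0 \<and>
    integrable \<mu> (\<lambda>\<omega>. Y \<omega> * (W s' \<omega> - W s \<omega>)\<^sup>2) \<and>
    (\<integral>\<omega>. Y \<omega> * (W s' \<omega> - W s \<omega>)\<^sup>2 \<partial>\<mu>) = (\<integral>\<omega>. Y \<omega> \<partial>\<mu>) * (s' - s)"
  proof cases
    case 2
    note m = increment_moments[OF st(1) 2 st(3)]
    note i1 = indep_increment[OF st(1) 2 st(3) Y(1), of "\<lambda>x. x"]
    note i2 = indep_increment[OF st(1) 2 st(3) Y(1), of "\<lambda>x. x\<^sup>2"]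
    show ?thesis
      using indep_var_integrable[OF i1 Y(2)] indep_var_lebesgue_integral[OF i1 Y(2)]
        indep_var_integrable[OF i2 Y(2)] indep_var_lebesgue_integral[OF i2 Y(2)] m by simp
  qed simp
  then show "integrable \<mu> (\<lambda>\<omega>. Y \<omega> * (W s' \<omega> - W s \<omega>))"
    "(\<integral>\<omega>. Y \<omega> * (W s' \<omega> - W s \<omega>) \<partial>\<mu>) = 0"
    "integrable \<mu> (\<lambda>\<omega>. Y \<omega> * (W s' \<omega> - W s \<omega>)\<^sup>2)"
    "(\<integral>\<omega>. Y \<omega> * (W s' \<omega> - W s \<omega>)\<^sup>2 \<partial>\<mu>) = (\<integral>\<omega>. Y \<omega> \<partial>\<mu>) * (s' - s)" by auto
qed

lemma simple_data_mono:
  assumes "simple_integrand_data \<mu> F a b n \<theta> \<xi>" "i \<le> j" "j \<le> n"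
  shows "\<theta> i \<le> \<theta> j"
  using assms(2,3)
proof (induction j)
  case (Suc j)
  then show ?case using assms(1) unfolding simple_integrand_data_def
    by (metis Suc_le_eq le_Suc_eq order.trans less_imp_le_nat order_refl)
qed simp

lemma simple_data_range:
  assumes "simple_integrand_data \<mu> F a b n \<theta> \<xi>" "i \<le> n"
  shows "a \<le> \<theta> i" "\<theta> i \<le> b"
  using simple_data_mono[OF assms(1), of 0 i] simple_data_mono[OF assms(1), of i n] assms
  unfolding simple_integrand_data_def by auto

lemma simple_data_step:
  assumes "simple_integrand_data \<mu> F a b (Suc n) \<theta> \<xi>"
  shows "simple_integrand_data \<mu> F a b n \<theta> \<xi>"
  using assms simple_data_range(2)[OF assms, of n] unfolding simple_integrand_data_def by auto

lemma simple_ito_integral_measurable_F: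
  assumes D: "simple_integrand_data \<mu> F a b n \<theta> \<xi>" and ab: "0 \<le> a" "b \<le> T"
  shows "simple_ito_integral W n \<theta> \<xi> \<in> borel_measurable (F (\<theta> n))"
  unfolding simple_ito_integral_def
proof (intro borel_measurable_sum borel_measurable_times)
  fix i assume i: "i \<in> {..<n}"
  have r: "0 \<le> \<theta> i" "\<theta> i \<le> \<theta> (Suc i)" "\<theta> (Suc i) \<le> \<theta> n" "\<theta> n \<le> T"
    using simple_data_mono[OF D, of i "Suc i"] simple_data_mono[OF D, of "Suc i" n]
      simple_data_range[OF D, of i] simple_data_range[OF D, of n] i ab by auto
  show "\<xi> i \<in> borel_measurable (F (\<theta> n))"
    using measurable_F_mono[of "\<theta> i" "\<theta> n" "\<xi> i"] D i r unfolding simple_integrand_data_def by auto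
  show "(\<lambda>\<omega>. W (\<theta> (Suc i)) \<omega> - W (\<theta> i) \<omega>) \<in> borel_measurable (F (\<theta> n))"
    using measurable_F_mono[OF _ _ _ W_increment_measurable[of "\<theta> i" "\<theta> (Suc i)"], of "\<theta> n"] r by auto
qed

text \<open>Peel off the last increment: the mixed term \<open>E (S \<xi> \<Delta>W)\<close> vanishes because \<open>S \<xi>\<close> is known at
  the left end of the increment and \<open>\<Delta>W\<close> is independent of that information and centred.\<close>

lemma simple_ito_isometry:
  assumes D: "simple_integrand_data \<mu> F a b n \<theta> \<xi>" and ab: "0 \<le> a" "b \<le> T"
  shows "integrable \<mu> (\<lambda>\<omega>. (simple_ito_integral W n \<theta> \<xi> \<omega>)\<^sup>2) \<and>
    integrable \<mu> (\<lambda>\<omega>. \<Sum>i<n. (\<xi> i \<omega>)\<^sup>2 * (\<theta> (Suc i) - \<theta> i)) \<and>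
    (\<integral>\<omega>. (simple_ito_integral W n \<theta> \<xi> \<omega>)\<^sup>2 \<partial>\<mu>) = (\<integral>\<omega>. (\<Sum>i<n. (\<xi> i \<omega>)\<^sup>2 * (\<theta> (Suc i) - \<theta> i)) \<partial>\<mu>)"
  using D
proof (induction n)
  case (Suc n)
  let ?S = "simple_ito_integral W n \<theta> \<xi>"
  let ?d = "\<lambda>\<omega>. W (\<theta> (Suc n)) \<omega> - W (\<theta> n) \<omega>"
  note D' = simple_data_step[OF Suc.prems]
  note IH = Suc.IH[OF D']
  have r: "0 \<le> \<theta> n" "\<theta> n \<le> \<theta> (Suc n)" "\<theta> (Suc n) \<le> T" "\<theta> n \<in> {0..T}"
    using simple_data_mono[OF Suc.prems, of n "Suc n"] simple_data_range[OF Suc.prems, of n]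
      simple_data_range[OF Suc.prems, of "Suc n"] ab by auto
  have Sm: "?S \<in> borel_measurable (F (\<theta> n))" using simple_ito_integral_measurable_F[OF D' ab] .
  have Sm': "?S \<in> borel_measurable \<mu>" using measurable_F_imp[OF r(4) Sm] .
  have xm: "\<xi> n \<in> borel_measurable (F (\<theta> n))" and "\<exists>B. \<forall>\<omega>\<in>space \<mu>. \<bar>\<xi> n \<omega>\<bar> \<le> B"
    using Suc.prems unfolding simple_integrand_data_def by auto
  then obtain B where B: "\<And>\<omega>. \<omega> \<in> space \<mu> \<Longrightarrow> \<bar>\<xi> n \<omega>\<bar> \<le> B" by auto
  have xm': "\<xi> n \<in> borel_measurable \<mu>" using measurable_F_imp[OF r(4) xm] .
  have Si: "integrable \<mu> ?S"
    using square_integrable_imp_integrable[OF Sm'] IH by blast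
  have i1: "integrable \<mu> (\<lambda>\<omega>. ?S \<omega> * \<xi> n \<omega>)"
  proof (rule Bochner_Integration.integrable_bound[OF integrable_mult_left[OF Si, of B]])
    show "AE \<omega> in \<mu>. norm (?S \<omega> * \<xi> n \<omega>) \<le> norm (?S \<omega> * B)"
    proof (rule AE_I2)
      fix \<omega> assume "\<omega> \<in> space \<mu>"
      then have "\<bar>\<xi> n \<omega>\<bar> \<le> \<bar>B\<bar>" using B by force
      then show "norm (?S \<omega> * \<xi> n \<omega>) \<le> norm (?S \<omega> * B)"
        by (simp add: abs_mult mult_left_mono)
    qed
  qed (use Sm' xm' in auto)
  have i2: "integrable \<mu> (\<lambda>\<omega>. (\<xi> n \<omega>)\<^sup>2)"
  proof (rule integrable_const_bound[of _ "B\<^sup>2"])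
    show "AE \<omega> in \<mu>. norm ((\<xi> n \<omega>)\<^sup>2) \<le> B\<^sup>2"
    proof (rule AE_I2)
      fix \<omega> assume "\<omega> \<in> space \<mu>"
      then have "\<bar>\<xi> n \<omega>\<bar> \<le> \<bar>B\<bar>" using B by force
      then show "norm ((\<xi> n \<omega>)\<^sup>2) \<le> B\<^sup>2"
        by (simp add: abs_le_square_iff)
    qed
  qed (use xm' in auto)
  note w1 = weighted_increment(1,2)[OF r(1-3) borel_measurable_times[OF Sm xm] i1]
  note w2 = weighted_increment(3,4)[OF r(1-3) borel_measurable_power[OF xm] i2]
  have eq: "(simple_ito_integral W (Suc n) \<theta> \<xi> \<omega>)\<^sup>2 =
    (?S \<omega>)\<^sup>2 + 2 * (?S \<omega> * \<xi> n \<omega> * ?d \<omega>) + (\<xi> n \<omega>)\<^sup>2 * (?d \<omega>)\<^sup>2" for \<omega>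
    by (simp add: simple_ito_integral_def power2_eq_square algebra_simps)
  show ?case
    unfolding eq sum.lessThan_Suc using IH w1 w2 i2 by simp
qed (simp add: simple_ito_integral_def)

text \<open>The intervals of constancy are disjoint, so squaring produces no mixed terms.\<close>

lemma simple_process_power2:
  assumes D: "simple_integrand_data \<mu> F a b n \<theta> \<xi>"
  shows "(simple_process n \<theta> \<xi> s \<omega>)\<^sup>2 = (\<Sum>i<n. (\<xi> i \<omega>)\<^sup>2 * indicator {\<theta> i<..\<theta> (Suc i)} s)"
  using D
proof (induction n)
  case (Suc n)
  have "simple_process n \<theta> \<xi> s \<omega> = 0" if "s > \<theta> n"
    unfolding simple_process_def
  proof (rule sum.neutral, rule ballI)
    fix i assume "i \<in> {..<n}"
    then have "\<theta> (Suc i) \<le> \<theta> n" using simple_data_mono[OF Suc.prems, of "Suc i" n] by auto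
    then show "\<xi> i \<omega> * indicator {\<theta> i<..\<theta> (Suc i)} s = 0" using that by auto
  qed
  then have z: "simple_process n \<theta> \<xi> s \<omega> * indicator {\<theta> n<..\<theta> (Suc n)} s = 0"
    by (auto simp: indicator_def)
  have "(simple_process (Suc n) \<theta> \<xi> s \<omega>)\<^sup>2 = (simple_process n \<theta> \<xi> s \<omega>)\<^sup>2
     + 2 * \<xi> n \<omega> * (simple_process n \<theta> \<xi> s \<omega> * indicator {\<theta> n<..\<theta> (Suc n)} s)
     + (\<xi> n \<omega>)\<^sup>2 * indicator {\<theta> n<..\<theta> (Suc n)} s"
    by (simp add: simple_process_def power2_eq_square algebra_simps indicator_def)
  also have "\<dots> = (simple_process n \<theta> \<xi> s \<omega>)\<^sup>2 + (\<xi> n \<omega>)\<^sup>2 * indicator {\<theta> n<..\<theta> (Suc n)} s"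
    unfolding z by simp
  finally show ?case using Suc.IH[OF simple_data_step[OF Suc.prems]] by simp
qed (simp add: simple_process_def)

lemma simple_process_square_integral:
  assumes D: "simple_integrand_data \<mu> F a b n \<theta> \<xi>"
  shows "set_integrable lborel {a..b} (\<lambda>s. (simple_process n \<theta> \<xi> s \<omega>)\<^sup>2)"
    "(LINT s:{a..b}|lborel. (simple_process n \<theta> \<xi> s \<omega>)\<^sup>2) = (\<Sum>i<n. (\<xi> i \<omega>)\<^sup>2 * (\<theta> (Suc i) - \<theta> i))"
proof -
  have "indicator {a..b} s * (simple_process n \<theta> \<xi> s \<omega>)\<^sup>2 =
     (\<Sum>i<n. (\<xi> i \<omega>)\<^sup>2 * indicator {\<theta> i<..\<theta> (Suc i)} s)" for s
    unfolding simple_process_power2[OF D] sum_distrib_left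
  proof (rule sum.cong[OF refl])
    fix i assume "i \<in> {..<n}"
    then have "a \<le> \<theta> i" "\<theta> (Suc i) \<le> b"
      using simple_data_range[OF D] by auto
    then show "indicator {a..b} s * ((\<xi> i \<omega>)\<^sup>2 * indicator {\<theta> i<..\<theta> (Suc i)} s) = (\<xi> i \<omega>)\<^sup>2 * indicator {\<theta> i<..\<theta> (Suc i)} s"
      by (auto simp: indicator_def)
  qed
  note eq = this
  have le: "\<theta> i \<le> \<theta> (Suc i)" if "i \<in> {..<n}" for i
    using simple_data_mono[OF D, of i "Suc i"] that by auto
  have ii: "integrable lborel (\<lambda>s. (\<xi> i \<omega>)\<^sup>2 * indicator {\<theta> i<..\<theta> (Suc i)} s)" if "i \<in> {..<n}" for i
    using le[OF that] by (intro integrable_mult_right integrable_real_indicator) auto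
  show "set_integrable lborel {a..b} (\<lambda>s. (simple_process n \<theta> \<xi> s \<omega>)\<^sup>2)"
    unfolding set_integrable_def real_scaleR_def eq by (intro Bochner_Integration.integrable_sum ii) auto
  have "(LINT s:{a..b}|lborel. (simple_process n \<theta> \<xi> s \<omega>)\<^sup>2) =
     (\<Sum>i<n. (\<integral>s. (\<xi> i \<omega>)\<^sup>2 * indicator {\<theta> i<..\<theta> (Suc i)} s \<partial>lborel))"
    unfolding set_lebesgue_integral_def real_scaleR_def eq
    by (rule Bochner_Integration.integral_sum) (use ii in auto)
  also have "\<dots> = (\<Sum>i<n. (\<xi> i \<omega>)\<^sup>2 * (\<theta> (Suc i) - \<theta> i))"
    by (intro sum.cong refl) (use le in auto)
  finally show "(LINT s:{a..b}|lborel. (simple_process n \<theta> \<xi> s \<omega>)\<^sup>2) = (\<Sum>i<n. (\<xi> i \<omega>)\<^sup>2 * (\<theta> (Suc i) - \<theta> i))" .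
qed

end

text \<open>Dropping each term with which the running total would exceed \<open>N\<close> keeps the sum below \<open>N\<close>: up
  to the last term kept, the full running total is still at most \<open>N\<close>.\<close>

lemma sum_stopped_le:
  fixes a :: "nat \<Rightarrow> real"
  assumes "\<And>i. i < n \<Longrightarrow> 0 \<le> a i" "0 \<le> N"
  shows "(\<Sum>i<n. if (\<Sum>j\<le>i. a j) \<le> N then a i else 0) \<le> min (\<Sum>i<n. a i) N"
proof -
  have "(\<Sum>i<n. if (\<Sum>j\<le>i. a j) \<le> N then a i else 0) \<le> (\<Sum>i<n. a i)"
    using assms by (intro sum_mono) auto
  moreover have "(\<Sum>i<n. if (\<Sum>j\<le>i. a j) \<le> N then a i else 0) \<le> N"
    using assms(1)
  proof (induction n)
    case (Suc n)
    have "(\<Sum>i<n. if (\<Sum>j\<le>i. a j) \<le> N then a i else 0) \<le> (\<Sum>i<n. a i)"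
      using Suc.prems by (intro sum_mono) auto
    then show ?case using Suc.IH Suc.prems by (auto simp: lessThan_Suc_atMost[symmetric])
  qed (use assms in auto)
  ultimately show ?thesis by simp
qed

context brownian_space begin

text \<open>The coefficient \<open>\<xi> i\<close> is switched off as soon as the quadratic clock, the last interval included,
  exceeds \<open>N\<close>. Since the clock at the end of interval \<open>i\<close> involves only \<open>\<xi> 0, \<dots>, \<xi> i\<close>, the switch is
  known at the left end \<open>\<theta> i\<close>, and the result is again a simple integrand, to which the isometry
  applies. On paths whose total clock is at most \<open>N\<close> nothing is switched off.\<close>

lemma truncated_simple_integrand:
  assumes D: "simple_integrand_data \<mu> F a b n \<theta> \<xi>" and ab: "0 \<le> a" "b \<le> T" and N: "0 \<le> N"
  obtains J where "J \<in> borel_measurable \<mu>"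
    "(\<integral>\<^sup>+\<omega>. ennreal ((J \<omega>)\<^sup>2) \<partial>\<mu>) \<le> (\<integral>\<^sup>+\<omega>. ennreal (min (LINT s:{a..b}|lborel. (simple_process n \<theta> \<xi> s \<omega>)\<^sup>2) N) \<partial>\<mu>)"
    "\<And>\<omega>. (LINT s:{a..b}|lborel. (simple_process n \<theta> \<xi> s \<omega>)\<^sup>2) \<le> N \<Longrightarrow> J \<omega> = simple_ito_integral W n \<theta> \<xi> \<omega>"
proof -
  define q where "q = (\<lambda>i \<omega>. (\<xi> i \<omega>)\<^sup>2 * (\<theta> (Suc i) - \<theta> i))"
  define \<eta> where "\<eta> = (\<lambda>i \<omega>. if (\<Sum>j\<le>i. q j \<omega>) \<le> N then \<xi> i \<omega> else 0)"
  have xm: "\<xi> j \<in> borel_measurable (F (\<theta> i))" if "j \<le> i" "i < n" for i j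
    using that D measurable_F_mono[of "\<theta> j" "\<theta> i" "\<xi> j"] simple_data_mono[OF D, of j i]
      simple_data_range[OF D, of j] simple_data_range[OF D, of i] ab
    unfolding simple_integrand_data_def by auto
  have qm: "(\<lambda>\<omega>. \<Sum>j\<le>i. q j \<omega>) \<in> borel_measurable (F (\<theta> i))" if "i < n" for i
    unfolding q_def using xm that by (intro borel_measurable_sum borel_measurable_times borel_measurable_power) auto
  have "\<eta> i \<in> borel_measurable (F (\<theta> i))" if "i < n" for i
  proof -
    note [measurable] = qm[OF that] xm[OF order_refl that]
    show ?thesis unfolding \<eta>_def by measurable
  qed
  moreover have "\<exists>B. \<forall>\<omega>\<in>space \<mu>. \<bar>\<eta> i \<omega>\<bar> \<le> B" if "i < n" for i
  proof -
    from D that obtain B where B: "\<forall>\<omega>\<in>space \<mu>. \<bar>\<xi> i \<omega>\<bar> \<le> B" unfolding simple_integrand_data_def by auto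
    have "\<bar>\<eta> i \<omega>\<bar> \<le> \<bar>B\<bar>" if "\<omega> \<in> space \<mu>" for \<omega>
      using B that by (fastforce simp: \<eta>_def)
    then show ?thesis by blast
  qed
  ultimately have E: "simple_integrand_data \<mu> F a b n \<theta> \<eta>"
    using D unfolding simple_integrand_data_def by auto
  have q0: "0 \<le> q i \<omega>" if "i < n" for i \<omega>
    using simple_data_mono[OF D, of i "Suc i"] that unfolding q_def by auto
  have \<eta>q: "(\<eta> i \<omega>)\<^sup>2 * (\<theta> (Suc i) - \<theta> i) = (if (\<Sum>j\<le>i. q j \<omega>) \<le> N then q i \<omega> else 0)" for i \<omega>
    by (simp add: \<eta>_def q_def)
  note iso = simple_ito_isometry[OF E ab]
  let ?J = "simple_ito_integral W n \<theta> \<eta>"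
  have "?J \<in> borel_measurable \<mu>"
    using measurable_F_imp[OF _ simple_ito_integral_measurable_F[OF E ab]] simple_data_range[OF E, of n] ab by auto
  moreover have "(\<integral>\<^sup>+\<omega>. ennreal ((?J \<omega>)\<^sup>2) \<partial>\<mu>) \<le> (\<integral>\<^sup>+\<omega>. ennreal (min (LINT s:{a..b}|lborel. (simple_process n \<theta> \<xi> s \<omega>)\<^sup>2) N) \<partial>\<mu>)"
  proof -
    have "(\<integral>\<^sup>+\<omega>. ennreal ((?J \<omega>)\<^sup>2) \<partial>\<mu>) = ennreal (\<integral>\<omega>. (?J \<omega>)\<^sup>2 \<partial>\<mu>)"
      by (rule nn_integral_eq_integral) (use iso in auto)
    also have "\<dots> = ennreal (\<integral>\<omega>. (\<Sum>i<n. (\<eta> i \<omega>)\<^sup>2 * (\<theta> (Suc i) - \<theta> i)) \<partial>\<mu>)"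
      using iso by simp
    also have "\<dots> = (\<integral>\<^sup>+\<omega>. ennreal (\<Sum>i<n. (\<eta> i \<omega>)\<^sup>2 * (\<theta> (Suc i) - \<theta> i)) \<partial>\<mu>)"
      by (rule nn_integral_eq_integral[symmetric])
        (use iso simple_data_mono[OF E, of _ "Suc _"] in \<open>auto intro!: sum_nonneg mult_nonneg_nonneg\<close>)
    also have "\<dots> \<le> (\<integral>\<^sup>+\<omega>. ennreal (min (LINT s:{a..b}|lborel. (simple_process n \<theta> \<xi> s \<omega>)\<^sup>2) N) \<partial>\<mu>)"
      unfolding simple_process_square_integral(2)[OF D] \<eta>q
      unfolding q_def[symmetric, THEN fun_cong, THEN fun_cong]
      using sum_stopped_le[OF q0 N] by (intro nn_integral_mono ennreal_leI) auto
    finally show ?thesis .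
  qed
  moreover have "?J \<omega> = simple_ito_integral W n \<theta> \<xi> \<omega>"
    if "(LINT s:{a..b}|lborel. (simple_process n \<theta> \<xi> s \<omega>)\<^sup>2) \<le> N" for \<omega>
    unfolding simple_ito_integral_def
  proof (rule sum.cong[OF refl])
    fix i assume i: "i \<in> {..<n}"
    have "(\<Sum>j\<le>i. q j \<omega>) \<le> (\<Sum>j<n. q j \<omega>)"
      using i q0 by (intro sum_mono2) auto
    also have "\<dots> \<le> N" using that unfolding simple_process_square_integral(2)[OF D] q_def .
    finally show "\<eta> i \<omega> * (W (\<theta> (Suc i)) \<omega> - W (\<theta> i) \<omega>) = \<xi> i \<omega> * (W (\<theta> (Suc i)) \<omega> - W (\<theta> i) \<omega>)"
      by (simp add: \<eta>_def)
  qed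
  ultimately show thesis using that by blast
qed

end


section \<open>A truncated Ito inequality\<close>

text \<open>Progressive measurability speaks about a restricted time interval. Extending by \<open>0\<close> turns it
  into measurability on all of \<open>lborel\<close>, where parametrised integrals are measurable.\<close>

lemma jointly_measurable_indicator:
  fixes X :: "real \<Rightarrow> 'b \<Rightarrow> real"
  assumes X: "(\<lambda>(s, \<omega>). X s \<omega>) \<in> borel_measurable (restrict_space borel A \<Otimes>\<^sub>M N)"
    and A: "A \<in> sets borel"
  shows "(\<lambda>(\<omega>, s). indicator A s * X s \<omega>) \<in> borel_measurable (N \<Otimes>\<^sub>M lborel)"
proof -
  have [measurable]: "A \<in> sets lborel" using A by simp
  have "(\<lambda>x. (snd x, fst x)) \<in> measurable (restrict_space (N \<Otimes>\<^sub>M lborel) {x. snd x \<in> A}) (restrict_space borel A \<Otimes>\<^sub>M N)"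
  proof (rule measurable_Pair)
    show "(\<lambda>x. snd x) \<in> measurable (restrict_space (N \<Otimes>\<^sub>M lborel) {x. snd x \<in> A}) (restrict_space borel A)"
      by (rule measurable_restrict_space2) (auto simp: space_restrict_space intro!: measurable_restrict_space1)
    show "(\<lambda>x. fst x) \<in> measurable (restrict_space (N \<Otimes>\<^sub>M lborel) {x. snd x \<in> A}) N"
      by (auto intro!: measurable_restrict_space1)
  qed
  from measurable_compose[OF this X]
  have "(\<lambda>x. if snd x \<in> A then X (snd x) (fst x) else 0) \<in> borel_measurable (N \<Otimes>\<^sub>M lborel)"
    by (subst measurable_If_restrict_space_iff) (auto simp: space_pair_measure)
  then show ?thesis
    by (rule measurable_cong[THEN iffD1, rotated]) (auto simp: indicator_def)
qed

text \<open>Convergence of the \<open>L\<^sup>2\<close> norms under \<open>L\<^sup>2\<close> convergence. With \<open>d = \<integral> (h - g)\<^sup>2\<close> and any \<open>e > 0\<close>, the estimate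
  \<open>\<bar>h\<^sup>2 - g\<^sup>2\<bar> \<le> (1 + 1 / e) (h - g)\<^sup>2 + e g\<^sup>2\<close> integrates to a bound by \<open>d + d / e + e S\<close>; the choice of
  \<open>e\<close> slightly larger than \<open>sqrt d\<close> makes all three terms vanish in the limit.\<close>

lemma square_integral_tendsto:
  fixes g :: "'b \<Rightarrow> real" and h :: "nat \<Rightarrow> 'b \<Rightarrow> real"
  assumes m: "g \<in> borel_measurable M" "\<And>k. h k \<in> borel_measurable M"
    and i: "integrable M (\<lambda>x. (g x)\<^sup>2)" "\<And>k. integrable M (\<lambda>x. (h k x)\<^sup>2)"
    and lim: "(\<lambda>k. \<integral>x. (h k x - g x)\<^sup>2 \<partial>M) \<longlonglongrightarrow> 0"
  shows "(\<lambda>k. \<integral>x. (h k x)\<^sup>2 \<partial>M) \<longlonglongrightarrow> (\<integral>x. (g x)\<^sup>2 \<partial>M)"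
proof -
  define d where "d k = (\<integral>x. (h k x - g x)\<^sup>2 \<partial>M)" for k
  define S where "S = (\<integral>x. (g x)\<^sup>2 \<partial>M)"
  \<comment> \<open>the summand \<open>1 / Suc k\<close> keeps \<open>e k\<close> positive when \<open>d k = 0\<close>\<close>
  define e where "e k = sqrt (d k) + 1 / real (Suc k)" for k
  have d0: "0 \<le> d k" for k unfolding d_def by simp
  have e0: "0 < e k" for k unfolding e_def using d0 by (simp add: add_nonneg_pos)
  have di: "integrable M (\<lambda>x. (h k x - g x)\<^sup>2)" for k
  proof (rule Bochner_Integration.integrable_bound)
    show "integrable M (\<lambda>x. 2 * (h k x)\<^sup>2 + 2 * (g x)\<^sup>2)" using i by auto
    have "(a - b)\<^sup>2 \<le> 2 * a\<^sup>2 + 2 * b\<^sup>2" for a b :: real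
      using zero_le_power2[of "a + b"] by (simp add: power2_eq_square algebra_simps)
    then show "AE x in M. norm ((h k x - g x)\<^sup>2) \<le> norm (2 * (h k x)\<^sup>2 + 2 * (g x)\<^sup>2)" by auto
  qed (use m in auto)
  have bd: "\<bar>(\<integral>x. (h k x)\<^sup>2 \<partial>M) - S\<bar> \<le> d k + sqrt (d k) + e k * S" for k
  proof -
    have pt: "\<bar>a\<^sup>2 - b\<^sup>2\<bar> \<le> (1 + 1 / e k) * (a - b)\<^sup>2 + e k * b\<^sup>2" for a b
    proof -
      let ?y = "a - b"
      have 1: "a\<^sup>2 - b\<^sup>2 = ?y\<^sup>2 + 2 * b * ?y" by (simp add: power2_eq_square algebra_simps)
      have 2: "0 \<le> (e k * b - ?y)\<^sup>2 / e k" "0 \<le> (e k * b + ?y)\<^sup>2 / e k" using e0[of k] by auto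
      have 3: "(e k * b - ?y)\<^sup>2 / e k = e k * b\<^sup>2 - 2 * b * ?y + ?y\<^sup>2 / e k"
        "(e k * b + ?y)\<^sup>2 / e k = e k * b\<^sup>2 + 2 * b * ?y + ?y\<^sup>2 / e k"
        using e0[of k] by (auto simp: power2_eq_square field_simps)
      have 4: "(1 + 1 / e k) * ?y\<^sup>2 = ?y\<^sup>2 + ?y\<^sup>2 / e k" by (simp add: field_simps)
      show ?thesis using 1 2 3 4 zero_le_power2[of ?y] by linarith
    qed
    have "\<bar>(\<integral>x. (h k x)\<^sup>2 \<partial>M) - S\<bar> = \<bar>\<integral>x. (h k x)\<^sup>2 - (g x)\<^sup>2 \<partial>M\<bar>"
      unfolding S_def using i by simp
    also have "\<dots> \<le> (\<integral>x. \<bar>(h k x)\<^sup>2 - (g x)\<^sup>2\<bar> \<partial>M)" by (rule integral_abs_bound)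
    also have "\<dots> \<le> (\<integral>x. (1 + 1 / e k) * (h k x - g x)\<^sup>2 + e k * (g x)\<^sup>2 \<partial>M)"
      using i di pt by (intro integral_mono) auto
    also have "\<dots> = (1 + 1 / e k) * d k + e k * S"
      unfolding d_def S_def using i di by simp
    also have "(1 + 1 / e k) * d k \<le> d k + sqrt (d k)"
    proof -
      have "d k = sqrt (d k) * sqrt (d k)" using d0 by simp
      also have "\<dots> \<le> sqrt (d k) * e k" unfolding e_def using d0 by (intro mult_left_mono) auto
      finally have "d k / e k \<le> sqrt (d k)" using e0[of k] by (simp add: divide_le_eq)
      then show ?thesis by (simp add: algebra_simps)
    qed
    finally show ?thesis by simp
  qed
  have sd: "(\<lambda>k. sqrt (d k)) \<longlonglongrightarrow> 0" using tendsto_real_sqrt[OF lim] by (simp add: d_def)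
  have "(\<lambda>k. d k + sqrt (d k) + e k * S) \<longlonglongrightarrow> 0 + 0 + (0 + 0) * S"
    unfolding e_def
  proof (intro tendsto_add tendsto_mult tendsto_const sd)
    show "d \<longlonglongrightarrow> 0" using lim by (simp add: d_def[abs_def])
    show "(\<lambda>k. 1 / real (Suc k)) \<longlonglongrightarrow> 0"
      using LIMSEQ_inverse_real_of_nat unfolding inverse_eq_divide .
  qed
  then have lim0: "(\<lambda>k. d k + sqrt (d k) + e k * S) \<longlonglongrightarrow> 0" by simp
  have "(\<lambda>k. \<bar>(\<integral>x. (h k x)\<^sup>2 \<partial>M) - S\<bar>) \<longlonglongrightarrow> 0"
    by (rule tendsto_sandwich[OF _ _ tendsto_const lim0]) (use bd in auto)
  then show ?thesis unfolding S_def
    by (simp add: LIM_zero_iff tendsto_rabs_zero_iff)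
qed

lemma min_one_abs_tendsto_zero:
  fixes x :: "nat \<Rightarrow> real"
  assumes "(\<lambda>k. min 1 \<bar>x k\<bar>) \<longlonglongrightarrow> 0"
  shows "x \<longlonglongrightarrow> 0"
proof -
  have "\<forall>\<^sub>F k in sequentially. min 1 \<bar>x k\<bar> < 1"
    using order_tendstoD(2)[OF assms, of 1] by simp
  then have "(\<lambda>k. \<bar>x k\<bar>) \<longlonglongrightarrow> 0"
    by (rule Lim_transform_eventually[OF assms, OF eventually_mono]) auto
  then show ?thesis by (simp add: tendsto_rabs_zero_iff)
qed

context prob_space begin

text \<open>Truncation at \<open>1\<close> makes the variables integrable, so that the passage to an almost surely
  convergent subsequence reduces to the one for \<open>L\<^sup>1\<close> convergence.\<close>

lemma converges_in_probability_imp_truncated_L1: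
  assumes conv: "converges_in_probability M U (\<lambda>_. 0)" and [measurable]: "\<And>k. U k \<in> borel_measurable M"
  shows "(\<lambda>k. \<integral>\<omega>. min 1 \<bar>U k \<omega>\<bar> \<partial>M) \<longlonglongrightarrow> 0"
proof (rule LIMSEQ_I)
  fix e :: real assume e: "0 < e"
  have "(\<lambda>k. prob {\<omega> \<in> space M. e/2 \<le> \<bar>U k \<omega>\<bar>}) \<longlonglongrightarrow> 0"
    using conv e unfolding converges_in_probability_def by (auto dest!: spec[of _ "e/2"])
  from LIMSEQ_D[OF this, of "e/2"] e obtain k0
    where k0: "\<And>k. k \<ge> k0 \<Longrightarrow> prob {\<omega> \<in> space M. e/2 \<le> \<bar>U k \<omega>\<bar>} < e/2" by auto
  show "\<exists>k0. \<forall>k\<ge>k0. norm ((\<integral>\<omega>. min 1 \<bar>U k \<omega>\<bar> \<partial>M) - 0) < e"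
  proof (intro exI allI impI)
    fix k assume k: "k0 \<le> k"
    let ?A = "{\<omega> \<in> space M. e/2 \<le> \<bar>U k \<omega>\<bar>}"
    have "(\<integral>\<omega>. min 1 \<bar>U k \<omega>\<bar> \<partial>M) \<le> (\<integral>\<omega>. e/2 + indicator ?A \<omega> \<partial>M)"
    proof (rule integral_mono)
      show "integrable M (\<lambda>\<omega>. min 1 \<bar>U k \<omega>\<bar>)" by (rule integrable_const_bound[of _ 1]) auto
      show "integrable M (\<lambda>\<omega>. e/2 + indicator ?A \<omega>)"
        by (intro Bochner_Integration.integrable_add integrable_real_indicator integrable_const) (auto simp: emeasure_eq_measure)
      fix \<omega> assume "\<omega> \<in> space M"
      then show "min 1 \<bar>U k \<omega>\<bar> \<le> e/2 + indicator ?A \<omega>" using e by (auto simp: indicator_def)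
    qed
    also have "\<dots> = e/2 + prob ?A"
      by (subst Bochner_Integration.integral_add) (auto simp: prob_space emeasure_eq_measure)
    also have "\<dots> < e" using k0[OF k] by simp
    finally have "(\<integral>\<omega>. min 1 \<bar>U k \<omega>\<bar> \<partial>M) < e" .
    moreover have "0 \<le> (\<integral>\<omega>. min 1 \<bar>U k \<omega>\<bar> \<partial>M)" by (rule integral_nonneg_AE) auto
    ultimately show "norm ((\<integral>\<omega>. min 1 \<bar>U k \<omega>\<bar> \<partial>M) - 0) < e" by simp
  qed
qed

lemma converges_in_probability_common_AE_subseq:
  assumes U: "converges_in_probability M U (\<lambda>_. 0)" "\<And>k. U k \<in> borel_measurable M"
    and V: "converges_in_probability M V (\<lambda>_. 0)" "\<And>k. V k \<in> borel_measurable M"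
  obtains r :: "nat \<Rightarrow> nat" where "strict_mono r"
    "AE \<omega> in M. (\<lambda>k. U (r k) \<omega>) \<longlonglongrightarrow> 0 \<and> (\<lambda>k. V (r k) \<omega>) \<longlonglongrightarrow> 0"
proof -
  note [measurable] = U(2) V(2)
  let ?u = "\<lambda>k \<omega>. min 1 \<bar>U k \<omega>\<bar> + min 1 \<bar>V k \<omega>\<bar>"
  have iU: "integrable M (\<lambda>\<omega>. min 1 \<bar>U k \<omega>\<bar>)" and iV: "integrable M (\<lambda>\<omega>. min 1 \<bar>V k \<omega>\<bar>)" for k
    by (rule integrable_const_bound[of _ 1]; auto)+
  have "(\<lambda>k. \<integral>\<omega>. norm (?u k \<omega>) \<partial>M) = (\<lambda>k. (\<integral>\<omega>. min 1 \<bar>U k \<omega>\<bar> \<partial>M) + (\<integral>\<omega>. min 1 \<bar>V k \<omega>\<bar> \<partial>M))"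
    using iU iV by simp
  also have "\<dots> \<longlonglongrightarrow> 0 + 0"
    by (rule tendsto_add; rule converges_in_probability_imp_truncated_L1; fact)
  finally have "\<exists>r::nat\<Rightarrow>nat. strict_mono r \<and> (AE x in M. (\<lambda>n. ?u (r n) x) \<longlonglongrightarrow> 0)"
    using iU iV by (intro tendsto_L1_AE_subseq) auto
  then obtain r :: "nat \<Rightarrow> nat" where r: "strict_mono r" "AE x in M. (\<lambda>n. ?u (r n) x) \<longlonglongrightarrow> 0" by blast
  have *: "(\<lambda>k. U (r k) \<omega>) \<longlonglongrightarrow> 0 \<and> (\<lambda>k. V (r k) \<omega>) \<longlonglongrightarrow> 0" if lim: "(\<lambda>n. ?u (r n) \<omega>) \<longlonglongrightarrow> 0" for \<omega>
  proof
    show "(\<lambda>k. U (r k) \<omega>) \<longlonglongrightarrow> 0"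
      by (rule min_one_abs_tendsto_zero, rule tendsto_sandwich[OF _ _ tendsto_const lim]) auto
    show "(\<lambda>k. V (r k) \<omega>) \<longlonglongrightarrow> 0"
      by (rule min_one_abs_tendsto_zero, rule tendsto_sandwich[OF _ _ tendsto_const lim]) auto
  qed
  have "AE \<omega> in M. (\<lambda>k. U (r k) \<omega>) \<longlonglongrightarrow> 0 \<and> (\<lambda>k. V (r k) \<omega>) \<longlonglongrightarrow> 0"
    using r(2) by eventually_elim (rule *)
  with r(1) show thesis by (rule that)
qed

end

context filtered_space begin

lemma progressive_joint:
  assumes X: "progressively_measurable F a b X" and s: "a \<le> s" "s \<le> b" "0 \<le> s" "s \<le> T"
  shows "(\<lambda>(\<omega>, \<tau>). indicator {a..s} \<tau> * X \<tau> \<omega>) \<in> borel_measurable (F s \<Otimes>\<^sub>M lborel)"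
    "(\<lambda>(\<omega>, \<tau>). indicator {a..s} \<tau> * X \<tau> \<omega>) \<in> borel_measurable (\<mu> \<Otimes>\<^sub>M lborel)"
proof -
  have 1: "(\<lambda>(\<tau>, \<omega>). X \<tau> \<omega>) \<in> borel_measurable (restrict_space borel {a..s} \<Otimes>\<^sub>M F s)"
    using X s by (auto simp: progressively_measurable_def)
  show 2: "(\<lambda>(\<omega>, \<tau>). indicator {a..s} \<tau> * X \<tau> \<omega>) \<in> borel_measurable (F s \<Otimes>\<^sub>M lborel)"
    by (rule jointly_measurable_indicator[OF 1]) auto
  have "(\<lambda>x. (fst x, snd x)) \<in> measurable (\<mu> \<Otimes>\<^sub>M lborel) (F s \<Otimes>\<^sub>M lborel)"
    using measurable_F_imp[of s "\<lambda>x. x" "F s"] s by (intro measurable_Pair) (auto intro: measurable_compose[OF measurable_fst])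
  from measurable_compose[OF this 2] show "(\<lambda>(\<omega>, \<tau>). indicator {a..s} \<tau> * X \<tau> \<omega>) \<in> borel_measurable (\<mu> \<Otimes>\<^sub>M lborel)"
    by simp
qed

end

context brownian_space begin

lemma simple_process_joint:
  assumes D: "simple_integrand_data \<mu> F a b n \<theta> \<xi>" and ab: "0 \<le> a" "b \<le> T"
  shows "(\<lambda>(\<omega>, s). simple_process n \<theta> \<xi> s \<omega>) \<in> borel_measurable (\<mu> \<Otimes>\<^sub>M lborel)"
proof -
  have [measurable]: "\<xi> i \<in> borel_measurable \<mu>" if "i \<in> {..<n}" for i
    using measurable_F_imp[of "\<theta> i" "\<xi> i"] D that simple_data_range[OF D, of i] ab
    unfolding simple_integrand_data_def by auto
  show ?thesis unfolding simple_process_def split_beta' by measurable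
qed

text \<open>Along a subsequence both the clocks \<open>\<integral> X\<^sub>k\<^sup>2\<close> of the approximating simple integrands and their
  stochastic integrals converge almost surely. Where \<open>\<integral> X\<^sup>2 < N\<close>, the approximating clocks are
  eventually below \<open>N\<close>, so the truncated integrals \<open>J k\<close> of \<open>truncated_simple_integrand\<close> converge to \<open>I\<close>
  there. Fatou's lemma on the left and dominated convergence (by \<open>N\<close>) on the right conclude.\<close>

lemma truncated_ito_inequality:
  assumes I: "has_ito_integral \<mu> F W a b X I" and ab: "0 \<le> a" "a \<le> b" "b \<le> T" and N: "0 \<le> N"
  shows "(\<integral>\<^sup>+\<omega>. ennreal ((I \<omega>)\<^sup>2) * indicator {\<omega>. (LINT s:{a..b}|lborel. (X s \<omega>)\<^sup>2) < N} \<omega> \<partial>\<mu>)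
     \<le> (\<integral>\<^sup>+\<omega>. ennreal (min (LINT s:{a..b}|lborel. (X s \<omega>)\<^sup>2) N) \<partial>\<mu>)"
proof -
  from I obtain n \<theta> \<xi> where prog: "progressively_measurable F a b X"
    and sq: "AE \<omega> in \<mu>. set_integrable lborel {a..b} (\<lambda>s. (X s \<omega>)\<^sup>2)"
    and Im[measurable]: "I \<in> borel_measurable \<mu>"
    and D: "\<And>k. simple_integrand_data \<mu> F a b (n k) (\<theta> k) (\<xi> k)"
    and c1: "converges_in_probability \<mu>
          (\<lambda>k \<omega>. LINT s:{a..b}|lborel. (simple_process (n k) (\<theta> k) (\<xi> k) s \<omega> - X s \<omega>)\<^sup>2) (\<lambda>\<omega>. 0)"
    and c2: "converges_in_probability \<mu> (\<lambda>k. simple_ito_integral W (n k) (\<theta> k) (\<xi> k)) I"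
    unfolding has_ito_integral_def by blast
  define x where "x \<omega> s = indicator {a..b} s * X s \<omega>" for \<omega> s
  define y where "y k \<omega> s = indicator {a..b} s * simple_process (n k) (\<theta> k) (\<xi> k) s \<omega>" for k \<omega> s
  define Ik where "Ik k = simple_ito_integral W (n k) (\<theta> k) (\<xi> k)" for k
  have xm[measurable]: "(\<lambda>(\<omega>, s). x \<omega> s) \<in> borel_measurable (\<mu> \<Otimes>\<^sub>M lborel)"
    unfolding x_def using progressive_joint(2)[OF prog, of b] ab by auto
  have ym[measurable]: "(\<lambda>(\<omega>, s). y k \<omega> s) \<in> borel_measurable (\<mu> \<Otimes>\<^sub>M lborel)" for k
  proof -
    note [measurable] = simple_process_joint[OF D ab(1,3), of k]
    show ?thesis unfolding y_def by measurable
  qed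
  have Ikm[measurable]: "Ik k \<in> borel_measurable \<mu>" for k
    unfolding Ik_def
    by (rule measurable_F_imp[OF _ simple_ito_integral_measurable_F[OF D ab(1,3)]])
      (use simple_data_range[OF D, of "n k" k] ab in auto)
  have sqx: "(LINT s:{a..b}|lborel. (X s \<omega>)\<^sup>2) = (\<integral>s. (x \<omega> s)\<^sup>2 \<partial>lborel)" for \<omega>
    unfolding set_lebesgue_integral_def x_def
    by (intro Bochner_Integration.integral_cong) (auto simp: indicator_def)
  have sqy: "(LINT s:{a..b}|lborel. (simple_process (n k) (\<theta> k) (\<xi> k) s \<omega>)\<^sup>2) = (\<integral>s. (y k \<omega> s)\<^sup>2 \<partial>lborel)" for k \<omega>
    unfolding set_lebesgue_integral_def y_def
    by (intro Bochner_Integration.integral_cong) (auto simp: indicator_def)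
  have sqd: "(LINT s:{a..b}|lborel. (simple_process (n k) (\<theta> k) (\<xi> k) s \<omega> - X s \<omega>)\<^sup>2) = (\<integral>s. (y k \<omega> s - x \<omega> s)\<^sup>2 \<partial>lborel)" for k \<omega>
    unfolding set_lebesgue_integral_def y_def x_def
    by (intro Bochner_Integration.integral_cong) (auto simp: indicator_def)
  have ix: "AE \<omega> in \<mu>. integrable lborel (\<lambda>s. (x \<omega> s)\<^sup>2)"
  proof -
    have "set_integrable lborel {a..b} (\<lambda>s. (X s \<omega>)\<^sup>2) \<longleftrightarrow> integrable lborel (\<lambda>s. (x \<omega> s)\<^sup>2)" for \<omega>
      unfolding set_integrable_def x_def
      by (intro Bochner_Integration.integrable_cong) (auto simp: indicator_def)
    then show ?thesis using sq by simp
  qed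
  have iy: "integrable lborel (\<lambda>s. (y k \<omega> s)\<^sup>2)" for k \<omega>
  proof -
    have "set_integrable lborel {a..b} (\<lambda>s. (simple_process (n k) (\<theta> k) (\<xi> k) s \<omega>)\<^sup>2) \<longleftrightarrow> integrable lborel (\<lambda>s. (y k \<omega> s)\<^sup>2)"
      unfolding set_integrable_def y_def
      by (intro Bochner_Integration.integrable_cong) (auto simp: indicator_def)
    then show ?thesis using simple_process_square_integral(1)[OF D, of k \<omega>] by simp
  qed
  let ?S = "\<lambda>\<omega>. \<integral>s. (x \<omega> s)\<^sup>2 \<partial>lborel" and ?Sk = "\<lambda>k \<omega>. \<integral>s. (y k \<omega> s)\<^sup>2 \<partial>lborel"
  have Sm[measurable]: "?S \<in> borel_measurable \<mu>" "?Sk k \<in> borel_measurable \<mu>" for k by measurable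
  obtain r :: "nat \<Rightarrow> nat" where r: "strict_mono r" and
    ae: "AE \<omega> in \<mu>. (\<lambda>k. \<integral>s. (y (r k) \<omega> s - x \<omega> s)\<^sup>2 \<partial>lborel) \<longlonglongrightarrow> 0 \<and> (\<lambda>k. Ik (r k) \<omega> - I \<omega>) \<longlonglongrightarrow> 0"
  proof (rule converges_in_probability_common_AE_subseq)
    show "converges_in_probability \<mu> (\<lambda>k \<omega>. \<integral>s. (y k \<omega> s - x \<omega> s)\<^sup>2 \<partial>lborel) (\<lambda>_. 0)"
      using c1 unfolding sqd .
    show "converges_in_probability \<mu> (\<lambda>k \<omega>. Ik k \<omega> - I \<omega>) (\<lambda>_. 0)"
      using c2 unfolding Ik_def converges_in_probability_def by simp
    show "(\<lambda>\<omega>. \<integral>s. (y k \<omega> s - x \<omega> s)\<^sup>2 \<partial>lborel) \<in> borel_measurable \<mu>" for k by measurable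
    show "(\<lambda>\<omega>. Ik k \<omega> - I \<omega>) \<in> borel_measurable \<mu>" for k by measurable
  qed
  have "\<exists>J. J \<in> borel_measurable \<mu> \<and> (\<integral>\<^sup>+\<omega>. ennreal ((J \<omega>)\<^sup>2) \<partial>\<mu>) \<le> (\<integral>\<^sup>+\<omega>. ennreal (min (?Sk (r k) \<omega>) N) \<partial>\<mu>) \<and>
     (\<forall>\<omega>. ?Sk (r k) \<omega> \<le> N \<longrightarrow> J \<omega> = Ik (r k) \<omega>)" for k
    using truncated_simple_integrand[OF D ab(1,3) N, of "r k"] unfolding sqy Ik_def by metis
  then obtain J where Jm[measurable]: "\<And>k. J k \<in> borel_measurable \<mu>"
    and JN: "\<And>k. (\<integral>\<^sup>+\<omega>. ennreal ((J k \<omega>)\<^sup>2) \<partial>\<mu>) \<le> (\<integral>\<^sup>+\<omega>. ennreal (min (?Sk (r k) \<omega>) N) \<partial>\<mu>)"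
    and JI: "\<And>k \<omega>. ?Sk (r k) \<omega> \<le> N \<Longrightarrow> J k \<omega> = Ik (r k) \<omega>" by metis
  have SkS: "AE \<omega> in \<mu>. (\<lambda>k. ?Sk (r k) \<omega>) \<longlonglongrightarrow> ?S \<omega>"
    using ae ix AE_space
  proof eventually_elim
    case (elim \<omega>)
    show ?case
    proof (rule square_integral_tendsto)
      show "x \<omega> \<in> borel_measurable lborel" "y (r k) \<omega> \<in> borel_measurable lborel" for k
        using measurable_Pair2[OF xm elim(3)] measurable_Pair2[OF ym elim(3)] by auto
    qed (use elim iy in auto)
  qed
  have "(\<integral>\<^sup>+\<omega>. ennreal ((I \<omega>)\<^sup>2) * indicator {\<omega>. ?S \<omega> < N} \<omega> \<partial>\<mu>) \<le> (\<integral>\<^sup>+\<omega>. liminf (\<lambda>k. ennreal ((J k \<omega>)\<^sup>2)) \<partial>\<mu>)"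
  proof (rule nn_integral_mono_AE)
    show "AE \<omega> in \<mu>. ennreal ((I \<omega>)\<^sup>2) * indicator {\<omega>. ?S \<omega> < N} \<omega> \<le> liminf (\<lambda>k. ennreal ((J k \<omega>)\<^sup>2))"
      using ae SkS
    proof eventually_elim
      case (elim \<omega>)
      show ?case
      proof (cases "?S \<omega> < N")
        case True
        have ev: "\<forall>\<^sub>F k in sequentially. ?Sk (r k) \<omega> < N" using order_tendstoD(2)[OF elim(2) True] .
        have lim: "(\<lambda>k. Ik (r k) \<omega>) \<longlonglongrightarrow> I \<omega>" using elim(1) by (simp add: LIM_zero_iff)
        have "(\<lambda>k. J k \<omega>) \<longlonglongrightarrow> I \<omega>"
          by (rule Lim_transform_eventually[OF lim], rule eventually_mono[OF ev]) (simp add: JI)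
        then have "(\<lambda>k. ennreal ((J k \<omega>)\<^sup>2)) \<longlonglongrightarrow> ennreal ((I \<omega>)\<^sup>2)"
          by (rule tendsto_ennrealI[OF tendsto_power])
        then have "liminf (\<lambda>k. ennreal ((J k \<omega>)\<^sup>2)) = ennreal ((I \<omega>)\<^sup>2)"
          by (rule lim_imp_Liminf[rotated]) simp
        then show ?thesis using True by simp
      qed auto
    qed
  qed
  also have "\<dots> \<le> liminf (\<lambda>k. \<integral>\<^sup>+\<omega>. ennreal ((J k \<omega>)\<^sup>2) \<partial>\<mu>)"
    by (rule nn_integral_liminf) auto
  also have "\<dots> \<le> liminf (\<lambda>k. \<integral>\<^sup>+\<omega>. ennreal (min (?Sk (r k) \<omega>) N) \<partial>\<mu>)"
    using JN by (intro Liminf_mono) auto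
  also have "\<dots> = (\<integral>\<^sup>+\<omega>. ennreal (min (?S \<omega>) N) \<partial>\<mu>)"
  proof (rule lim_imp_Liminf)
    show "(\<lambda>k. \<integral>\<^sup>+\<omega>. ennreal (min (?Sk (r k) \<omega>) N) \<partial>\<mu>) \<longlonglongrightarrow> (\<integral>\<^sup>+\<omega>. ennreal (min (?S \<omega>) N) \<partial>\<mu>)"
    proof (rule nn_integral_dominated_convergence[where w = "\<lambda>_. ennreal N"])
      show "AE \<omega> in \<mu>. (\<lambda>k. ennreal (min (?Sk (r k) \<omega>) N)) \<longlonglongrightarrow> ennreal (min (?S \<omega>) N)"
        using SkS by eventually_elim (intro tendsto_ennrealI tendsto_min tendsto_const)
    qed (auto intro!: ennreal_leI simp: emeasure_space_1)
  qed simp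
  finally show ?thesis unfolding sqx .
qed

end


section \<open>Second moments of the price\<close>

text \<open>The supremum \<open>S\<close> of \<open>\<psi> s exp (- 2 B (s - t))\<close> is finite because \<open>\<psi>\<close> is bounded, and the weight makes
  the integral inequality read \<open>S \<le> A (T - t) + S / 2\<close>. The a priori bound \<open>N\<close>
  serves only this finiteness and disappears from the conclusion.\<close>

lemma gronwall_integral:
  fixes \<psi> :: "real \<Rightarrow> real"
  assumes tT: "t \<le> T" and AB: "0 \<le> A" "0 < B" and bd: "\<And>s. s \<in> {t..T} \<Longrightarrow> 0 \<le> \<psi> s" "\<And>s. s \<in> {t..T} \<Longrightarrow> \<psi> s \<le> N"
    and ineq: "\<And>s. s \<in> {t..T} \<Longrightarrow> ennreal (\<psi> s) \<le> (\<integral>\<^sup>+\<tau>. ennreal (A + B * \<psi> \<tau>) * indicator {t..s} \<tau> \<partial>lborel)"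
  shows "\<psi> T \<le> 2 * A * (T - t) * exp (2 * B * (T - t))"
proof -
  define g where "g s = \<psi> s * exp (- (2 * B * (s - t)))" for s
  define S where "S = (SUP s\<in>{t..T}. g s)"
  have N0: "0 \<le> N" using bd[of t] tT by fastforce
  have "g s \<le> N" if "s \<in> {t..T}" for s
  proof -
    have "g s \<le> \<psi> s * 1" unfolding g_def using bd[OF that] that AB by (intro mult_left_mono) auto
    then show ?thesis using bd[OF that] by simp
  qed
  then have bdd: "bdd_above (g ` {t..T})" by (auto intro!: bdd_aboveI[of _ N])
  have gS: "g s \<le> S" if "s \<in> {t..T}" for s unfolding S_def by (rule cSUP_upper[OF that bdd])
  have S0: "0 \<le> S" using gS[of t] bd[of t] tT by (auto simp: g_def)
  have \<psi>S: "\<psi> s \<le> S * exp (2 * B * (s - t))" if "s \<in> {t..T}" for s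
    using gS[OF that] unfolding g_def exp_minus by (simp add: field_simps)
  have gb: "g s \<le> A * (T - t) + S / 2" if s: "s \<in> {t..T}" for s
  proof -
    have "ennreal (\<psi> s) \<le> (\<integral>\<^sup>+\<tau>. ennreal (A + B * \<psi> \<tau>) * indicator {t..s} \<tau> \<partial>lborel)" by (rule ineq[OF s])
    also have "\<dots> \<le> (\<integral>\<^sup>+\<tau>. ennreal (A + B * (S * exp (2 * B * (\<tau> - t)))) * indicator {t..s} \<tau> \<partial>lborel)"
      using \<psi>S s AB by (intro nn_integral_mono) (auto simp: indicator_def intro!: ennreal_leI mult_left_mono)
    also have "\<dots> = ennreal ((A * s + S / 2 * exp (2 * B * (s - t))) - (A * t + S / 2 * exp (2 * B * (t - t))))"
    proof (rule nn_integral_FTC_Icc)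
      fix x assume "x \<in> {t..s}"
      show "DERIV (\<lambda>x. A * x + S / 2 * exp (2 * B * (x - t))) x :> A + B * (S * exp (2 * B * (x - t)))"
        by (auto intro!: derivative_eq_intros simp: field_simps)
      show "0 \<le> A + B * (S * exp (2 * B * (x - t)))" using AB S0 by simp
    qed (use s in auto)
    also have "\<dots> = ennreal (A * (s - t) + S / 2 * (exp (2 * B * (s - t)) - 1))" by (simp add: algebra_simps)
    finally have "\<psi> s \<le> A * (s - t) + S / 2 * (exp (2 * B * (s - t)) - 1)"
      using s AB S0 by (subst (asm) ennreal_le_iff) (auto intro!: add_nonneg_nonneg mult_nonneg_nonneg)
    also have "\<dots> \<le> A * (T - t) * exp (2 * B * (s - t)) + S / 2 * exp (2 * B * (s - t))"
    proof (rule add_mono)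
      have "A * (s - t) * 1 \<le> A * (T - t) * exp (2 * B * (s - t))"
        using s AB by (intro mult_mono) auto
      then show "A * (s - t) \<le> A * (T - t) * exp (2 * B * (s - t))" by simp
      show "S / 2 * (exp (2 * B * (s - t)) - 1) \<le> S / 2 * exp (2 * B * (s - t))"
        using S0 by (intro mult_left_mono) auto
    qed
    also have "\<dots> = (A * (T - t) + S / 2) * exp (2 * B * (s - t))" by (simp add: algebra_simps)
    finally show ?thesis unfolding g_def exp_minus by (simp add: field_simps)
  qed
  have "S \<le> A * (T - t) + S / 2"
    unfolding S_def by (rule cSUP_least) (use tT gb in \<open>auto simp: S_def\<close>)
  then have "S \<le> 2 * A * (T - t)" by simp
  moreover have "\<psi> T \<le> S * exp (2 * B * (T - t))" using \<psi>S[of T] tT by simp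
  ultimately show ?thesis by (meson mult_right_mono exp_ge_zero order_trans)
qed

text \<open>Integrate \<open>(l g - c)\<^sup>2 \<ge> 0\<close>, where \<open>l\<close> is the length of the interval and \<open>c\<close> the integral of \<open>g\<close>.\<close>

lemma integral_square_le_length_mult:
  fixes g :: "real \<Rightarrow> real"
  assumes ab: "a \<le> b" and g: "continuous_on {a..b} g"
  shows "(LINT x:{a..b}|lborel. g x)\<^sup>2 \<le> (b - a) * (LINT x:{a..b}|lborel. (g x)\<^sup>2)"
proof (cases "a = b")
  case True
  have "AE x in lborel. indicator {a..b} x * g x = 0"
    using AE_lborel_singleton[of b] by eventually_elim (simp add: True indicator_def)
  then have "(LINT x:{a..b}|lborel. g x) = 0"
    by (simp add: set_lebesgue_integral_def integral_eq_zero_AE)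
  then show ?thesis using True by simp
next
  case False
  define l where "l = b - a"
  define c where "c = (LINT x:{a..b}|lborel. g x)"
  have l: "0 < l" using ab False by (simp add: l_def)
  have i1: "set_integrable lborel {a..b} g" "set_integrable lborel {a..b} (\<lambda>x. (g x)\<^sup>2)"
    "set_integrable lborel {a..b} (\<lambda>x. 1 :: real)"
    by (auto intro!: borel_integrable_atLeastAtMost' continuous_intros g)
  have one: "(LINT x:{a..b}|lborel. c\<^sup>2) = c\<^sup>2 * l"
    using ab by (simp add: set_lebesgue_integral_def l_def)
  have "0 \<le> (LINT x:{a..b}|lborel. (l * g x - c)\<^sup>2)"
    unfolding set_lebesgue_integral_def by (rule integral_nonneg_AE) auto
  also have "\<dots> = (LINT x:{a..b}|lborel. l\<^sup>2 * (g x)\<^sup>2 - (2 * l * c) * g x + c\<^sup>2)"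
    by (simp add: power2_eq_square algebra_simps)
  also have "\<dots> = l\<^sup>2 * (LINT x:{a..b}|lborel. (g x)\<^sup>2) - (2 * l * c) * c + c\<^sup>2 * l"
  proof -
    have 1: "set_integrable lborel {a..b} (\<lambda>x. l\<^sup>2 * (g x)\<^sup>2)" "set_integrable lborel {a..b} (\<lambda>x. (2 * l * c) * g x)"
       "set_integrable lborel {a..b} (\<lambda>x. c\<^sup>2)"
      by (auto intro!: borel_integrable_atLeastAtMost' continuous_intros g)
    show ?thesis
      by (subst set_integral_add, intro set_integral_diff 1, rule 1, subst set_integral_diff, rule 1, rule 1)
        (simp add: c_def[symmetric] one)
  qed
  also have "\<dots> = l * (l * (LINT x:{a..b}|lborel. (g x)\<^sup>2) - c\<^sup>2)"
    by (simp add: power2_eq_square algebra_simps)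
  finally show ?thesis using l unfolding c_def l_def by (simp add: zero_le_mult_iff)
qed

text \<open>The clock \<open>y s = \<integral>\<^sub>t\<^sup>s q\<close> is continuous and, as \<open>q \<ge> 1\<close>, strictly increasing. So it attains the value
  \<open>min (y s) N\<close> at some time \<open>x \<le> s\<close>, and before \<open>x\<close> it stays strictly below \<open>N\<close>. Capping the clock
  therefore amounts to letting it run only while it is below \<open>N\<close>.\<close>

lemma running_integral_capped:
  fixes q :: "real \<Rightarrow> real"
  assumes q: "continuous_on {t..T} q" "\<And>x. x \<in> {t..T} \<Longrightarrow> 1 \<le> q x" and s: "s \<in> {t..T}" and N: "0 \<le> N"
  shows "ennreal (min (LINT x:{t..s}|lborel. q x) N)
     \<le> (\<integral>\<^sup>+\<tau>. ennreal (q \<tau>) * indicator {\<tau>. (LINT x:{t..\<tau>}|lborel. q x) < N} \<tau> * indicator {t..s} \<tau> \<partial>lborel)"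
proof -
  define y where "y = (\<lambda>\<tau>. LINT x:{t..\<tau>}|lborel. q x)"
  have int: "set_integrable lborel {t..\<tau>} q" if "\<tau> \<le> T" for \<tau>
    by (rule borel_integrable_atLeastAtMost', rule continuous_on_subset[OF q(1)]) (use that in auto)
  have yi: "y \<tau> = integral {t..\<tau>} q" if "\<tau> \<le> T" for \<tau>
    unfolding y_def by (rule set_borel_integral_eq_integral(2)[OF int[OF that]])
  have yc: "continuous_on {t..T} y"
    using indefinite_integral_continuous_1[OF integrable_continuous_real[OF q(1)]]
    by (rule continuous_on_cong[THEN iffD1, rotated 2]) (auto simp: yi)
  have yt: "y t = 0" using yi[of t] s by simp
  have mono: "y a + (b - a) \<le> y b" if "t \<le> a" "a \<le> b" "b \<le> T" for a b
  proof -
    have "integral {t..a} q + integral {a..b} q = integral {t..b} q"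
      using that by (intro Henstock_Kurzweil_Integration.integral_combine integrable_continuous_real continuous_on_subset[OF q(1)]) auto
    moreover have "integral {a..b} (\<lambda>_. 1) \<le> integral {a..b} q"
      using that q(2) by (intro integral_le integrable_continuous_real continuous_on_subset[OF q(1)]) auto
    ultimately show ?thesis using yi that by simp
  qed
  have "\<exists>x\<in>{t..s}. y x = min (y s) N"
    using IVT'[of y t "min (y s) N" s] yt N s mono[of t s] continuous_on_subset[OF yc, of "{t..s}"] by auto
  then obtain x where x: "x \<in> {t..s}" "y x = min (y s) N" by blast
  have "ennreal (y x) = (\<integral>\<^sup>+\<tau>. ennreal (q \<tau>) * indicator {t..x} \<tau> \<partial>lborel)"
  proof -
    have "(\<integral>\<^sup>+\<tau>. ennreal (indicator {t..x} \<tau> * q \<tau>) \<partial>lborel) = ennreal (\<integral>\<tau>. indicator {t..x} \<tau> * q \<tau> \<partial>lborel)"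
    proof (rule nn_integral_eq_integral)
      show "integrable lborel (\<lambda>\<tau>. indicator {t..x} \<tau> * q \<tau>)"
        using int[of x] x s by (simp add: set_integrable_def)
      show "AE \<tau> in lborel. 0 \<le> indicator {t..x} \<tau> * q \<tau>"
      proof (rule AE_I2)
        fix \<tau> show "0 \<le> indicator {t..x} \<tau> * q \<tau>" using q(2)[of \<tau>] x s by (auto simp: indicator_def)
      qed
    qed
    moreover have "ennreal (indicator {t..x} \<tau> * q \<tau>) = ennreal (q \<tau>) * indicator {t..x} \<tau>" for \<tau>
      by (simp add: indicator_def)
    ultimately show ?thesis by (simp add: y_def set_lebesgue_integral_def)
  qed
  also have "\<dots> \<le> (\<integral>\<^sup>+\<tau>. ennreal (q \<tau>) * indicator {\<tau>. y \<tau> < N} \<tau> * indicator {t..s} \<tau> \<partial>lborel)"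
  proof (rule nn_integral_mono_AE)
    show "AE \<tau> in lborel. ennreal (q \<tau>) * indicator {t..x} \<tau> \<le> ennreal (q \<tau>) * indicator {\<tau>. y \<tau> < N} \<tau> * indicator {t..s} \<tau>"
      using AE_lborel_singleton[of x]
    proof eventually_elim
      case (elim \<tau>)
      show ?case
      proof (cases "\<tau> \<in> {t..x}")
        case True
        then have "y \<tau> < y x" using mono[of \<tau> x] elim x s by auto
        then have "y \<tau> < N" using x by simp
        then show ?thesis using True x by simp
      qed simp
    qed
  qed
  finally show ?thesis using x(2) unfolding y_def by simp
qed


lemma lipschitz_linear_growth:
  fixes f :: "real \<Rightarrow> real \<Rightarrow> real"
  assumes cont: "continuous_on ({0..T} \<times> UNIV) (\<lambda>(s, x). f s x)" and lip: "\<exists>L. \<forall>s\<in>{0..T}. L-lipschitz_on UNIV (f s)"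
  obtains G where "1 \<le> G" "\<And>s x. s \<in> {0..T} \<Longrightarrow> (f s x)\<^sup>2 \<le> G * (1 + x\<^sup>2)"
proof -
  from lip obtain L where L: "\<And>s. s \<in> {0..T} \<Longrightarrow> L-lipschitz_on UNIV (f s)" by blast
  have "continuous_on {0..T} (\<lambda>s. f s 0)"
    using continuous_on_compose2[OF cont, of "{0..T}" "\<lambda>s. (s, 0)"] by (simp add: continuous_on_Pair image_subset_iff)
  then have "bounded ((\<lambda>s. f s 0) ` {0..T})"
    by (intro compact_imp_bounded compact_continuous_image) auto
  then obtain c where c: "\<And>s. s \<in> {0..T} \<Longrightarrow> \<bar>f s 0\<bar> \<le> c"
    unfolding bounded_iff by (metis imageI real_norm_def)
  show thesis
  proof (rule that[of "1 + 2 * c\<^sup>2 + 2 * L\<^sup>2"])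
    show "1 \<le> 1 + 2 * c\<^sup>2 + 2 * L\<^sup>2" by simp
    fix s x assume s: "s \<in> {0..T}"
    have "\<bar>f s x - f s 0\<bar> \<le> L * \<bar>x\<bar>" using lipschitz_onD[OF L[OF s], of x 0] by (simp add: dist_real_def)
    then have "\<bar>f s x\<bar> \<le> c + L * \<bar>x\<bar>" using c[OF s] by linarith
    then have "\<bar>f s x\<bar>\<^sup>2 \<le> (c + L * \<bar>x\<bar>)\<^sup>2" by (intro power_mono) auto
    also have "\<dots> \<le> 2 * c\<^sup>2 + 2 * L\<^sup>2 * x\<^sup>2"
    proof -
      have "0 \<le> (c - L * \<bar>x\<bar>)\<^sup>2" by simp
      then show ?thesis by (simp add: power2_eq_square algebra_simps)
    qed
    also have "\<dots> \<le> (1 + 2 * c\<^sup>2 + 2 * L\<^sup>2) * (1 + x\<^sup>2)" by (simp add: algebra_simps)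
    finally show "(f s x)\<^sup>2 \<le> (1 + 2 * c\<^sup>2 + 2 * L\<^sup>2) * (1 + x\<^sup>2)" by simp
  qed
qed

text \<open>Square \<open>Z s = p + \<integral> f + I\<close> by \<open>(a + b + c)\<^sup>2 \<le> 3 a\<^sup>2 + 3 b\<^sup>2 + 3 c\<^sup>2\<close> and estimate the square of the
  drift integral by the length of the interval times the integral of the square. The latter is
  applied to the continuous majorant \<open>sqrt (G (1 + Z\<^sup>2))\<close> of \<open>\<bar>f\<bar>\<close>.\<close>

lemma strong_solution_pathwise_bound:
  fixes f :: "real \<Rightarrow> real \<Rightarrow> real" and Z :: "real \<Rightarrow> real" and G I p :: real
  assumes t: "0 \<le> t" "t \<le> s" "s \<le> T" and G: "0 \<le> G" and fG: "\<And>x. x \<in> {t..s} \<Longrightarrow> (f x (Z x))\<^sup>2 \<le> G * (1 + (Z x)\<^sup>2)"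
    and Z: "continuous_on {t..s} Z" and eq: "Z s = p + (LINT x:{t..s}|lborel. f x (Z x)) + I"
  shows "1 + (Z s)\<^sup>2 \<le> (1 + 3 * p\<^sup>2) + 3 * T * G * (LINT x:{t..s}|lborel. 1 + (Z x)\<^sup>2) + 3 * I\<^sup>2"
proof -
  let ?g = "\<lambda>x. sqrt (G * (1 + (Z x)\<^sup>2))"
  have gc: "continuous_on {t..s} ?g" by (intro continuous_intros Z)
  have gi: "set_integrable lborel {t..s} ?g" by (rule borel_integrable_atLeastAtMost'[OF gc])
  have "\<bar>LINT x:{t..s}|lborel. f x (Z x)\<bar> \<le> (\<integral>x. \<bar>indicator {t..s} x * f x (Z x)\<bar> \<partial>lborel)"
    unfolding set_lebesgue_integral_def real_scaleR_def by (rule integral_abs_bound)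
  also have "\<dots> \<le> (LINT x:{t..s}|lborel. ?g x)"
    unfolding set_lebesgue_integral_def real_scaleR_def
  proof (rule integral_mono')
    show "integrable lborel (\<lambda>x. indicator {t..s} x * ?g x)" using gi by (simp add: set_integrable_def)
    fix x :: real
    show "\<bar>indicator {t..s} x * f x (Z x)\<bar> \<le> indicator {t..s} x * ?g x"
    proof (cases "x \<in> {t..s}")
      case True
      have "\<bar>f x (Z x)\<bar> \<le> ?g x" by (rule real_le_rsqrt) (use fG[OF True] in simp)
      then show ?thesis using True by simp
    qed simp
    show "0 \<le> indicator {t..s} x * ?g x" using G by simp
  qed
  finally have "\<bar>LINT x:{t..s}|lborel. f x (Z x)\<bar>\<^sup>2 \<le> (LINT x:{t..s}|lborel. ?g x)\<^sup>2" by (intro power_mono) auto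
  also have "\<dots> \<le> (s - t) * (LINT x:{t..s}|lborel. (?g x)\<^sup>2)"
    by (rule integral_square_le_length_mult[OF t(2) gc])
  also have "\<dots> = (s - t) * (G * (LINT x:{t..s}|lborel. 1 + (Z x)\<^sup>2))" using G by simp
  also have "\<dots> \<le> T * (G * (LINT x:{t..s}|lborel. 1 + (Z x)\<^sup>2))"
  proof -
    have "0 \<le> (LINT x:{t..s}|lborel. 1 + (Z x)\<^sup>2)"
      unfolding set_lebesgue_integral_def by (rule integral_nonneg_AE) auto
    then show ?thesis using t G by (intro mult_right_mono mult_nonneg_nonneg) auto
  qed
  finally have F: "(LINT x:{t..s}|lborel. f x (Z x))\<^sup>2 \<le> T * (G * (LINT x:{t..s}|lborel. 1 + (Z x)\<^sup>2))" by simp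
  have "(a + b + c)\<^sup>2 \<le> 3 * a\<^sup>2 + 3 * b\<^sup>2 + 3 * c\<^sup>2" for a b c :: real
    using zero_le_power2[of "a - b"] zero_le_power2[of "a - c"] zero_le_power2[of "b - c"]
    by (simp add: power2_eq_square algebra_simps)
  from this[of p "LINT x:{t..s}|lborel. f x (Z x)" I] show ?thesis using F eq by simp
qed

context brownian_space begin

text \<open>The capped clock \<open>\<psi> N s = E (min (y s) N)\<close> grows at rate at most \<open>E (1 + P\<^sub>s\<^sup>2; y s < N)\<close>. Linear growth
  gives \<open>\<integral> \<sigma>\<^sup>2 \<le> G y\<close>, so the truncated Ito inequality at level \<open>G N\<close> controls the martingale part on
  \<open>{y s < N}\<close> by \<open>G \<psi> N s\<close>; the drift contributes another multiple of \<open>\<psi> N s\<close>. Hence the rate is at most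
  \<open>A + B \<psi> N s\<close> (the fact \<open>rate\<close> below), Gronwall's lemma bounds \<open>\<psi> N T\<close> independently of \<open>N\<close>, and \<open>N\<close>
  tends to infinity by Fatou's lemma.\<close>

lemma strong_solution_second_moment:
  assumes sol: "strong_solution T \<mu> F W f \<sigma> t p P" and t: "0 \<le> t" "t \<le> T" and G: "1 \<le> G"
    and fG: "\<And>s x. s \<in> {0..T} \<Longrightarrow> (f s x)\<^sup>2 \<le> G * (1 + x\<^sup>2)"
    and \<sigma>G: "\<And>s x. s \<in> {0..T} \<Longrightarrow> (\<sigma> s x)\<^sup>2 \<le> G * (1 + x\<^sup>2)"
  defines "A \<equiv> 1 + 3 * p\<^sup>2" and "B \<equiv> 3 * T * G + 3 * G"
  shows "(\<integral>\<^sup>+\<omega>. ennreal (LINT s:{t..T}|lborel. 1 + (P s \<omega>)\<^sup>2) \<partial>\<mu>) \<le> ennreal (2 * A * T * exp (2 * B * T))"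
proof -
  from sol obtain I where prog: "progressively_measurable F t T P"
    and cont: "AE \<omega> in \<mu>. continuous_on {t..T} (\<lambda>s. P s \<omega>)"
    and I: "\<And>s. s \<in> {t..T} \<Longrightarrow> has_ito_integral \<mu> F W t s (\<lambda>\<tau> \<omega>. \<sigma> \<tau> (P \<tau> \<omega>)) (I s)"
    and eq: "\<And>s. s \<in> {t..T} \<Longrightarrow> AE \<omega> in \<mu>. P s \<omega> = p + (LINT \<tau>:{t..s}|lborel. f \<tau> (P \<tau> \<omega>)) + I s \<omega>"
    unfolding strong_solution_def by blast
  define q where "q \<omega> s = 1 + (indicator {t..T} s * P s \<omega>)\<^sup>2" for \<omega> s
  define y where "y s \<omega> = (\<integral>x. (if t \<le> x \<and> x \<le> s then q \<omega> x else 0) \<partial>lborel)" for s \<omega>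
  have Pm[measurable]: "(\<lambda>(\<omega>, s). indicator {t..T} s * P s \<omega>) \<in> borel_measurable (\<mu> \<Otimes>\<^sub>M lborel)"
    using progressive_joint(2)[OF prog, of T] t by auto
  have qm[measurable]: "(\<lambda>(\<omega>, s). q \<omega> s) \<in> borel_measurable (\<mu> \<Otimes>\<^sub>M lborel)"
    unfolding q_def by measurable
  have ym[measurable]: "(\<lambda>(\<omega>, s). y s \<omega>) \<in> borel_measurable (\<mu> \<Otimes>\<^sub>M lborel)"
    unfolding y_def by measurable
  have ym1[measurable]: "y s \<in> borel_measurable \<mu>" for s unfolding y_def by measurable
  have yq: "y s \<omega> = (LINT x:{t..s}|lborel. q \<omega> x)" for s \<omega>
    unfolding y_def set_lebesgue_integral_def by (intro Bochner_Integration.integral_cong) (auto simp: indicator_def)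
  have yP: "y s \<omega> = (LINT x:{t..s}|lborel. 1 + (P x \<omega>)\<^sup>2)" if "s \<in> {t..T}" for s \<omega>
    unfolding yq set_lebesgue_integral_def q_def by (intro Bochner_Integration.integral_cong) (use that in \<open>auto simp: indicator_def\<close>)
  have y0: "0 \<le> y s \<omega>" for s \<omega>
    unfolding yq set_lebesgue_integral_def by (rule integral_nonneg_AE) (auto simp: q_def)
  have AB: "0 \<le> A" "0 < B" using G t by (auto simp: A_def B_def add_nonneg_pos)
  have contq: "AE \<omega> in \<mu>. continuous_on {t..T} (q \<omega>)"
    using cont
  proof eventually_elim
    case (elim \<omega>)
    have "continuous_on {t..T} (\<lambda>s. 1 + (P s \<omega>)\<^sup>2)" by (intro continuous_intros elim)
    then show ?case by (rule continuous_on_cong[THEN iffD1, rotated 2]) (auto simp: q_def)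
  qed
  define \<psi> where "\<psi> N s = (\<integral>\<omega>. min (y s \<omega>) N \<partial>\<mu>)" for N s
  have \<psi>i: "integrable \<mu> (\<lambda>\<omega>. min (y s \<omega>) N)" if "0 \<le> N" for N s
    by (rule integrable_const_bound[of _ N]) (use that y0 in auto)
  have \<psi>e: "(\<integral>\<^sup>+\<omega>. ennreal (min (y s \<omega>) N) \<partial>\<mu>) = ennreal (\<psi> N s)" if "0 \<le> N" for N s
    unfolding \<psi>_def by (rule nn_integral_eq_integral[OF \<psi>i[OF that]]) (use that y0 in auto)
  have \<psi>0: "0 \<le> \<psi> N s" if "0 \<le> N" for N s
    unfolding \<psi>_def by (rule integral_nonneg_AE) (use that y0 in auto)
  have rate: "(\<integral>\<^sup>+\<omega>. ennreal (q \<omega> s) * indicator {\<omega>. y s \<omega> < N} \<omega> \<partial>\<mu>) \<le> ennreal (A + B * \<psi> N s)"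
    if s: "s \<in> {t..T}" and N: "0 \<le> N" for s N
  proof -
    have Im[measurable]: "I s \<in> borel_measurable \<mu>" and sqi: "AE \<omega> in \<mu>. set_integrable lborel {t..s} (\<lambda>x. (\<sigma> x (P x \<omega>))\<^sup>2)"
      using I[OF s] unfolding has_ito_integral_def by auto
    let ?V = "\<lambda>\<omega>. LINT x:{t..s}|lborel. (\<sigma> x (P x \<omega>))\<^sup>2"
    have V: "AE \<omega> in \<mu>. ?V \<omega> \<le> G * y s \<omega>"
      using sqi cont
    proof eventually_elim
      case (elim \<omega>)
      have "set_integrable lborel {t..s} (\<lambda>x. G * (1 + (P x \<omega>)\<^sup>2))"
        using s by (intro borel_integrable_atLeastAtMost' continuous_intros continuous_on_subset[OF elim(2)]) auto
      then have "?V \<omega> \<le> (LINT x:{t..s}|lborel. G * (1 + (P x \<omega>)\<^sup>2))"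
        using elim(1) \<sigma>G s t by (intro set_integral_mono) auto
      then show ?case unfolding yP[OF s] by simp
    qed
    have I2: "(\<integral>\<^sup>+\<omega>. ennreal ((I s \<omega>)\<^sup>2) * indicator {\<omega>. y s \<omega> < N} \<omega> \<partial>\<mu>) \<le> ennreal (G * \<psi> N s)"
    proof -
      have "(\<integral>\<^sup>+\<omega>. ennreal ((I s \<omega>)\<^sup>2) * indicator {\<omega>. y s \<omega> < N} \<omega> \<partial>\<mu>)
         \<le> (\<integral>\<^sup>+\<omega>. ennreal ((I s \<omega>)\<^sup>2) * indicator {\<omega>. ?V \<omega> < G * N} \<omega> \<partial>\<mu>)"
      proof (rule nn_integral_mono_AE)
        show "AE \<omega> in \<mu>. ennreal ((I s \<omega>)\<^sup>2) * indicator {\<omega>. y s \<omega> < N} \<omega> \<le> ennreal ((I s \<omega>)\<^sup>2) * indicator {\<omega>. ?V \<omega> < G * N} \<omega>"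
          using V
        proof eventually_elim
          case (elim \<omega>)
          have "?V \<omega> < G * N" if "y s \<omega> < N"
            using elim mult_strict_left_mono[OF that, of G] G by linarith
          then show ?case by (simp add: indicator_def)
        qed
      qed
      also have "\<dots> \<le> (\<integral>\<^sup>+\<omega>. ennreal (min (?V \<omega>) (G * N)) \<partial>\<mu>)"
        by (rule truncated_ito_inequality[OF I[OF s]]) (use s t G N in auto)
      also have "\<dots> \<le> (\<integral>\<^sup>+\<omega>. ennreal G * ennreal (min (y s \<omega>) N) \<partial>\<mu>)"
      proof (rule nn_integral_mono_AE)
        show "AE \<omega> in \<mu>. ennreal (min (?V \<omega>) (G * N)) \<le> ennreal G * ennreal (min (y s \<omega>) N)"
          using V
        proof eventually_elim
          case (elim \<omega>)
          have "min (?V \<omega>) (G * N) \<le> G * min (y s \<omega>) N"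
            using elim G by (simp add: min_mult_distrib_left min.mono)
          then have "ennreal (min (?V \<omega>) (G * N)) \<le> ennreal (G * min (y s \<omega>) N)" by (rule ennreal_leI)
          also have "\<dots> = ennreal G * ennreal (min (y s \<omega>) N)"
            by (rule ennreal_mult) (use G y0[of s \<omega>] N in auto)
          finally show ?case .
        qed
      qed
      also have "\<dots> = ennreal (G * \<psi> N s)"
        using \<psi>e[OF N] G \<psi>0[OF N] by (subst nn_integral_cmult) (auto simp: ennreal_mult[symmetric])
      finally show ?thesis .
    qed
    have "(\<integral>\<^sup>+\<omega>. ennreal (q \<omega> s) * indicator {\<omega>. y s \<omega> < N} \<omega> \<partial>\<mu>)
       \<le> (\<integral>\<^sup>+\<omega>. ennreal (A + 3 * T * G * min (y s \<omega>) N) + 3 * (ennreal ((I s \<omega>)\<^sup>2) * indicator {\<omega>. y s \<omega> < N} \<omega>) \<partial>\<mu>)"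
    proof (rule nn_integral_mono_AE)
      show "AE \<omega> in \<mu>. ennreal (q \<omega> s) * indicator {\<omega>. y s \<omega> < N} \<omega>
         \<le> ennreal (A + 3 * T * G * min (y s \<omega>) N) + 3 * (ennreal ((I s \<omega>)\<^sup>2) * indicator {\<omega>. y s \<omega> < N} \<omega>)"
        using cont eq[OF s]
      proof eventually_elim
        case (elim \<omega>)
        have "1 + (P s \<omega>)\<^sup>2 \<le> A + 3 * T * G * y s \<omega> + 3 * (I s \<omega>)\<^sup>2"
          unfolding A_def yP[OF s]
          by (rule strong_solution_pathwise_bound[where f = f and Z = "\<lambda>s. P s \<omega>"])
            (use s t G fG elim in \<open>auto intro: continuous_on_subset[OF elim(1)]\<close>)
        then have "ennreal (q \<omega> s) \<le> ennreal (A + 3 * T * G * y s \<omega> + 3 * (I s \<omega>)\<^sup>2)"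
          using s by (intro ennreal_leI) (simp add: q_def)
        also have "\<dots> = ennreal (A + 3 * T * G * y s \<omega>) + 3 * ennreal ((I s \<omega>)\<^sup>2)"
          using AB t G y0[of s \<omega>] by (subst ennreal_plus) (auto simp: ennreal_mult)
        finally show ?case by (simp add: indicator_def)
      qed
    qed
    also have "\<dots> = (\<integral>\<^sup>+\<omega>. ennreal (A + 3 * T * G * min (y s \<omega>) N) \<partial>\<mu>) + 3 * (\<integral>\<^sup>+\<omega>. ennreal ((I s \<omega>)\<^sup>2) * indicator {\<omega>. y s \<omega> < N} \<omega> \<partial>\<mu>)"
      by (subst nn_integral_add) (auto simp: nn_integral_cmult)
    also have "(\<integral>\<^sup>+\<omega>. ennreal (A + 3 * T * G * min (y s \<omega>) N) \<partial>\<mu>) = ennreal (A + 3 * T * G * \<psi> N s)"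
    proof -
      have "(\<integral>\<^sup>+\<omega>. ennreal (A + 3 * T * G * min (y s \<omega>) N) \<partial>\<mu>) = ennreal (\<integral>\<omega>. A + 3 * T * G * min (y s \<omega>) N \<partial>\<mu>)"
        by (rule nn_integral_eq_integral) (use \<psi>i[OF N] AB t G y0 N in auto)
      also have "(\<integral>\<omega>. A + 3 * T * G * min (y s \<omega>) N \<partial>\<mu>) = A + 3 * T * G * \<psi> N s"
        unfolding \<psi>_def using \<psi>i[OF N, of s] by (simp add: prob_space)
      finally show ?thesis .
    qed
    also have "ennreal (A + 3 * T * G * \<psi> N s) + 3 * (\<integral>\<^sup>+\<omega>. ennreal ((I s \<omega>)\<^sup>2) * indicator {\<omega>. y s \<omega> < N} \<omega> \<partial>\<mu>)
       \<le> ennreal (A + 3 * T * G * \<psi> N s) + 3 * ennreal (G * \<psi> N s)"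
      by (intro add_left_mono mult_left_mono I2) auto
    also have "3 * ennreal (G * \<psi> N s) = ennreal (3 * (G * \<psi> N s))"
      using G \<psi>0[OF N] by (simp add: ennreal_mult)
    also have "ennreal (A + 3 * T * G * \<psi> N s) + ennreal (3 * (G * \<psi> N s)) = ennreal (A + B * \<psi> N s)"
      using AB t G \<psi>0[OF N] by (subst ennreal_plus[symmetric]) (auto simp: B_def algebra_simps)
    finally show ?thesis .
  qed
  have bound: "\<psi> N T \<le> 2 * A * T * exp (2 * B * T)" if N: "0 \<le> N" for N
  proof -
    have "\<psi> N T \<le> 2 * A * (T - t) * exp (2 * B * (T - t))"
    proof (rule gronwall_integral[OF t(2) AB])
      fix s assume s: "s \<in> {t..T}"
      show "0 \<le> \<psi> N s" by (rule \<psi>0[OF N])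
      show "\<psi> N s \<le> N"
        unfolding \<psi>_def by (rule integral_le_const[OF \<psi>i[OF N]]) auto
      have "ennreal (\<psi> N s) = (\<integral>\<^sup>+\<omega>. ennreal (min (y s \<omega>) N) \<partial>\<mu>)" using \<psi>e[OF N] by simp
      also have "\<dots> \<le> (\<integral>\<^sup>+\<omega>. \<integral>\<^sup>+\<tau>. ennreal (q \<omega> \<tau>) * indicator {\<tau>. y \<tau> \<omega> < N} \<tau> * indicator {t..s} \<tau> \<partial>lborel \<partial>\<mu>)"
      proof (rule nn_integral_mono_AE)
        show "AE \<omega> in \<mu>. ennreal (min (y s \<omega>) N) \<le> (\<integral>\<^sup>+\<tau>. ennreal (q \<omega> \<tau>) * indicator {\<tau>. y \<tau> \<omega> < N} \<tau> * indicator {t..s} \<tau> \<partial>lborel)"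
          using contq
        proof eventually_elim
          case (elim \<omega>)
          show ?case unfolding yq
            by (rule running_integral_capped[OF elim _ s N]) (simp add: q_def)
        qed
      qed
      also have "\<dots> = (\<integral>\<^sup>+\<tau>. \<integral>\<^sup>+\<omega>. ennreal (q \<omega> \<tau>) * indicator {\<tau>. y \<tau> \<omega> < N} \<tau> * indicator {t..s} \<tau> \<partial>\<mu> \<partial>lborel)"
      proof (rule pair_sigma_finite.Fubini'[symmetric])
        show "pair_sigma_finite \<mu> lborel" by unfold_locales
        have "(\<lambda>x. ennreal (q (fst x) (snd x)) * indicator {x. y (snd x) (fst x) < N} x * indicator {t..s} (snd x)) \<in> borel_measurable (\<mu> \<Otimes>\<^sub>M lborel)"
          by measurable
        then show "(\<lambda>(\<omega>, \<tau>). ennreal (q \<omega> \<tau>) * indicator {\<tau>. y \<tau> \<omega> < N} \<tau> * indicator {t..s} \<tau>) \<in> borel_measurable (\<mu> \<Otimes>\<^sub>M lborel)"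
          by (simp add: split_beta' indicator_def)
      qed
      also have "\<dots> = (\<integral>\<^sup>+\<tau>. (\<integral>\<^sup>+\<omega>. ennreal (q \<omega> \<tau>) * indicator {\<omega>. y \<tau> \<omega> < N} \<omega> \<partial>\<mu>) * indicator {t..s} \<tau> \<partial>lborel)"
        by (intro nn_integral_cong) (auto simp: indicator_def)
      also have "\<dots> \<le> (\<integral>\<^sup>+\<tau>. ennreal (A + B * \<psi> N \<tau>) * indicator {t..s} \<tau> \<partial>lborel)"
        using rate[OF _ N] s by (intro nn_integral_mono) (auto simp: indicator_def)
      finally show "ennreal (\<psi> N s) \<le> (\<integral>\<^sup>+\<tau>. ennreal (A + B * \<psi> N \<tau>) * indicator {t..s} \<tau> \<partial>lborel)" .
    qed
    also have "\<dots> \<le> 2 * A * T * exp (2 * B * T)"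
      using t AB by (intro mult_mono mult_left_mono) auto
    finally show ?thesis .
  qed
  have "(\<integral>\<^sup>+\<omega>. ennreal (y T \<omega>) \<partial>\<mu>) \<le> (\<integral>\<^sup>+\<omega>. liminf (\<lambda>n. ennreal (min (y T \<omega>) (real n))) \<partial>\<mu>)"
  proof (rule nn_integral_mono)
    fix \<omega>
    have "\<forall>\<^sub>F n in sequentially. y T \<omega> \<le> real n"
      using real_arch_simple[of "y T \<omega>"] unfolding eventually_sequentially
      by (meson of_nat_mono order_trans)
    then have "\<forall>\<^sub>F n in sequentially. ennreal (y T \<omega>) = ennreal (min (y T \<omega>) (real n))"
      by (rule eventually_mono) simp
    then have "(\<lambda>n. ennreal (min (y T \<omega>) (real n))) \<longlonglongrightarrow> ennreal (y T \<omega>)"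
      by (rule Lim_transform_eventually[OF tendsto_const])
    then have "liminf (\<lambda>n. ennreal (min (y T \<omega>) (real n))) = ennreal (y T \<omega>)"
      by (rule lim_imp_Liminf[rotated]) simp
    then show "ennreal (y T \<omega>) \<le> liminf (\<lambda>n. ennreal (min (y T \<omega>) (real n)))" by simp
  qed
  also have "\<dots> \<le> liminf (\<lambda>n. \<integral>\<^sup>+\<omega>. ennreal (min (y T \<omega>) (real n)) \<partial>\<mu>)"
    by (rule nn_integral_liminf) auto
  also have "\<dots> \<le> liminf (\<lambda>n. ennreal (2 * A * T * exp (2 * B * T)))"
    using bound \<psi>e by (intro Liminf_mono) (auto intro!: always_eventually ennreal_leI)
  also have "\<dots> = ennreal (2 * A * T * exp (2 * B * T))" by (simp add: Liminf_const)
  finally show ?thesis using yP[of T] t by simp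
qed

end


section \<open>Projecting a control onto the admissible ones\<close>

lemma bounded_path_integrable:
  fixes g :: "real \<Rightarrow> real"
  assumes g: "(\<lambda>s. indicator {t..T} s * g s) \<in> borel_measurable lborel" and b: "\<And>s. s \<in> {t..T} \<Longrightarrow> \<bar>g s\<bar> \<le> c"
    and ab: "t \<le> a" "b \<le> T"
  shows "set_integrable lborel {a..b} g"
proof -
  have 1: "set_integrable lborel {t..T} g"
    unfolding set_integrable_def real_scaleR_def
  proof (rule Bochner_Integration.integrable_bound)
    show "integrable lborel (\<lambda>s. indicator {t..T} s * c)"
      by (intro integrable_mult_left integrable_real_indicator) (auto simp: emeasure_lborel_Icc_eq)
    show "AE s in lborel. norm (indicator {t..T} s * g s) \<le> norm (indicator {t..T} s * c)"
      using b by (intro AE_I2) (force simp: indicator_def)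
  qed (rule g)
  then show ?thesis by (rule set_integrable_subset) (use ab in auto)
qed

lemma running_integral_combine:
  fixes g :: "real \<Rightarrow> real"
  assumes g: "set_integrable lborel {t..T} g" and ab: "t \<le> a" "a \<le> b" "b \<le> T"
  shows "(LINT x:{t..b}|lborel. g x) = (LINT x:{t..a}|lborel. g x) + (LINT x:{a..b}|lborel. g x)"
proof -
  have i: "set_integrable lborel {t..b} g" "set_integrable lborel {t..a} g" "set_integrable lborel {a..b} g"
    by (rule set_integrable_subset[OF g]; use ab in auto)+
  note e = i[THEN set_borel_integral_eq_integral(2)]
  show ?thesis unfolding e
    by (rule Henstock_Kurzweil_Integration.integral_combine[symmetric])
      (use ab i(1) in \<open>auto intro: set_borel_integral_eq_integral(1)\<close>)
qed

text \<open>\<open>G\<close> is nondecreasing and continuous, so it is at least \<open>L\<close> exactly from the first hitting time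
  \<open>\<tau>\<close> of the level on, and \<open>G \<tau> = L\<close>.\<close>

lemma integral_beyond_level:
  fixes g :: "real \<Rightarrow> real" and t T z L :: real
  assumes g: "set_integrable lborel {t..T} g" and pos: "\<And>s. s \<in> {t..T} \<Longrightarrow> 0 \<le> g s" and tT: "t \<le> T"
  defines "G \<equiv> \<lambda>s. z + (LINT x:{t..s}|lborel. g x)"
  assumes zL: "z \<le> L" and LT: "L \<le> G T"
  shows "set_integrable lborel {t..T} (\<lambda>s. if L \<le> G s then g s else 0)"
    "(LINT s:{t..T}|lborel. if L \<le> G s then g s else 0) = G T - L"
proof -
  have int: "set_integrable lborel {t..s} g" if "s \<le> T" for s
    by (rule set_integrable_subset[OF g]) (use that in auto)
  have comb: "G b = G a + (LINT x:{a..b}|lborel. g x)" if "t \<le> a" "a \<le> b" "b \<le> T" for a b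
    unfolding G_def using running_integral_combine[OF g that] by simp
  have mono: "G a \<le> G b" if "t \<le> a" "a \<le> b" "b \<le> T" for a b
  proof -
    have "0 \<le> (LINT x:{a..b}|lborel. g x)"
      unfolding set_lebesgue_integral_def
      by (rule integral_nonneg_AE) (use that pos in \<open>auto simp: indicator_def\<close>)
    then show ?thesis using comb[OF that] by simp
  qed
  have cont: "continuous_on {t..T} G"
  proof -
    have "continuous_on {t..T} (\<lambda>s. z + integral {t..s} g)"
      by (intro continuous_intros indefinite_integral_continuous_1 set_borel_integral_eq_integral(1)[OF g])
    then show ?thesis
      by (rule continuous_on_cong[THEN iffD1, rotated 2])
        (auto simp: G_def set_borel_integral_eq_integral(2)[OF int])
  qed
  have Gt: "G t = z" unfolding G_def set_borel_integral_eq_integral(2)[OF int[OF tT]] by simp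
  define H where "H = {s \<in> {t..T}. L \<le> G s}"
  define \<tau> where "\<tau> = Inf H"
  have "H = {t..T} \<inter> G -` {L..}" by (auto simp: H_def)
  then have Hcl: "closed H"
    using continuous_closed_preimage[OF cont closed_atLeastAtMost closed_atLeast] by simp
  have HT: "T \<in> H" using tT LT by (auto simp: H_def)
  have Hbb: "bdd_below H" by (rule bdd_belowI[of _ t]) (auto simp: H_def)
  have \<tau>H: "\<tau> \<in> H" unfolding \<tau>_def by (rule closed_contains_Inf[OF _ Hbb Hcl]) (use HT in auto)
  then have \<tau>: "t \<le> \<tau>" "\<tau> \<le> T" "L \<le> G \<tau>" by (auto simp: H_def)
  obtain x where x: "t \<le> x" "x \<le> T" "G x = L" using IVT'[of G t L T] Gt zL LT tT cont by auto
  have "\<tau> \<le> x" unfolding \<tau>_def by (rule cInf_lower[OF _ Hbb]) (use x in \<open>auto simp: H_def\<close>)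
  then have G\<tau>: "G \<tau> = L" using mono[of \<tau> x] \<tau> x by auto
  have eq: "indicator {t..T} s *\<^sub>R (if L \<le> G s then g s else 0) = indicator {\<tau>..T} s *\<^sub>R g s" for s
  proof -
    have "L \<le> G s \<longleftrightarrow> \<tau> \<le> s" if "s \<in> {t..T}"
    proof
      assume "L \<le> G s"
      then show "\<tau> \<le> s" unfolding \<tau>_def using that by (intro cInf_lower[OF _ Hbb]) (auto simp: H_def)
    next
      assume "\<tau> \<le> s"
      then show "L \<le> G s" using mono[of \<tau> s] \<tau> that by auto
    qed
    then show ?thesis using \<tau> by (auto simp: indicator_def)
  qed
  show "set_integrable lborel {t..T} (\<lambda>s. if L \<le> G s then g s else 0)"
    unfolding set_integrable_def eq
    using set_integrable_subset[OF g, of "{\<tau>..T}"] \<tau> unfolding set_integrable_def by auto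
  have "(LINT s:{t..T}|lborel. if L \<le> G s then g s else 0) = (LINT s:{\<tau>..T}|lborel. g s)"
    unfolding set_lebesgue_integral_def eq ..
  also have "\<dots> = G T - L" using comb[of \<tau> T] \<tau> G\<tau> by simp
  finally show "(LINT s:{t..T}|lborel. if L \<le> G s then g s else 0) = G T - L" .
qed

text \<open>The conditions are evaluated along the original control. This is equivalent to stopping at the
  first hitting time of a boundary, because \<open>Z s\<close> is nondecreasing and \<open>Z s + ub (T - s)\<close> is
  nonincreasing: once one of the two inequalities holds, it keeps holding.\<close>

definition clamped_control ::
  "real \<Rightarrow> real \<Rightarrow> real \<Rightarrow> real \<Rightarrow> real \<Rightarrow> real \<Rightarrow> (real \<Rightarrow> 'a \<Rightarrow> real) \<Rightarrow> real \<Rightarrow> 'a \<Rightarrow> real" where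
  "clamped_control T ub m M t z u s \<omega> =
     (if M \<le> cumulated t z u s \<omega> then 0
      else if cumulated t z u s \<omega> + ub * (T - s) \<le> m then ub else u s \<omega>)"

text \<open>At most one of the two modifications acts on a path, according to the terminal value \<open>Z\<close>: if \<open>M \<le> Z\<close>
  then \<open>Z s + ub (T - s) \<ge> Z > m\<close> throughout, and if \<open>Z \<le> m\<close> then \<open>Z s \<le> m < M\<close> throughout. In the first
  case \<open>integral_beyond_level\<close> computes the amount removed. The second case is its mirror image under
  \<open>u \<mapsto> ub - u\<close>, which turns \<open>Z s\<close> into \<open>- (Z s + ub (T - s))\<close> and the level \<open>m\<close> into \<open>- m\<close>.\<close>

lemma clamped_control_path:
  assumes u: "set_integrable lborel {t..T} (\<lambda>s. u s \<omega>)" and bd: "\<And>s. s \<in> {t..T} \<Longrightarrow> u s \<omega> \<in> {0..ub}"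
    and tT: "t \<le> T" and mM: "m < M" and z: "z \<le> M" "m \<le> z + ub * (T - t)"
  defines "w \<equiv> clamped_control T ub m M t z u" and "Z \<equiv> cumulated t z u T \<omega>"
  shows "cumulated t z w T \<omega> \<in> {m..M}"
    "(LINT s:{t..T}|lborel. \<bar>u s \<omega> - w s \<omega>\<bar>) = max 0 (Z - M) + max 0 (m - Z)"
proof -
  let ?g = "\<lambda>s. u s \<omega>" and ?Z = "\<lambda>s. cumulated t z u s \<omega>"
  have ii: "set_integrable lborel {t..s} ?g" if "s \<le> T" for s
    by (rule set_integrable_subset[OF u]) (use that in auto)
  have icmul: "set_integrable lborel {a..b} (\<lambda>_. ub)" for a b :: real
    by (rule borel_integrable_atLeastAtMost') (intro continuous_intros)
  have cub: "(LINT x:{a..b}|lborel. ub) = ub * (b - a)" if "a \<le> b" for a b :: real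
    using that by (simp add: set_lebesgue_integral_def)
  have inc: "?Z s \<le> Z" "Z \<le> ?Z s + ub * (T - s)" if s: "s \<in> {t..T}" for s
  proof -
    have "Z = ?Z s + (LINT x:{s..T}|lborel. ?g x)"
      unfolding Z_def cumulated_def using running_integral_combine[OF u, of s T] s by simp
    moreover have "0 \<le> (LINT x:{s..T}|lborel. ?g x)"
      unfolding set_lebesgue_integral_def
      by (rule integral_nonneg_AE) (use s bd in \<open>auto simp: indicator_def\<close>)
    moreover have "(LINT x:{s..T}|lborel. ?g x) \<le> (LINT x:{s..T}|lborel. ub)"
    proof (rule set_integral_mono)
      show "set_integrable lborel {s..T} ?g" by (rule set_integrable_subset[OF u]) (use s in auto)
    qed (use icmul bd s in auto)
    ultimately show "?Z s \<le> Z" "Z \<le> ?Z s + ub * (T - s)" using cub[of s T] s by auto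
  qed
  have "\<exists>d. (LINT s:{t..T}|lborel. \<bar>?g s - w s \<omega>\<bar>) = \<bar>d\<bar> \<and> set_integrable lborel {t..T} (\<lambda>s. w s \<omega>) \<and>
     (LINT s:{t..T}|lborel. w s \<omega>) = (LINT s:{t..T}|lborel. ?g s) - d \<and> d = max 0 (Z - M) - max 0 (m - Z)"
  proof -
    consider "M \<le> Z" | "Z \<le> m" | "m < Z" "Z < M" by linarith
    then show ?thesis
    proof cases
      case 1
      let ?h = "\<lambda>s. if M \<le> ?Z s then ?g s else 0"
      have h: "set_integrable lborel {t..T} ?h" "(LINT s:{t..T}|lborel. ?h s) = Z - M"
        using integral_beyond_level[OF u _ tT z(1)] bd 1 unfolding Z_def cumulated_def by auto
      have w: "w s \<omega> = ?g s - ?h s" if "s \<in> {t..T}" for s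
        using inc[OF that] 1 mM by (auto simp: w_def clamped_control_def)
      have "(LINT s:{t..T}|lborel. \<bar>?g s - w s \<omega>\<bar>) = (LINT s:{t..T}|lborel. ?h s)"
        by (rule set_lebesgue_integral_cong) (use w bd in auto)
      moreover have "set_integrable lborel {t..T} (\<lambda>s. w s \<omega>) \<longleftrightarrow> set_integrable lborel {t..T} (\<lambda>s. ?g s - ?h s)"
        by (rule set_integrable_cong) (use w in auto)
      moreover have "(LINT s:{t..T}|lborel. w s \<omega>) = (LINT s:{t..T}|lborel. ?g s - ?h s)"
        by (rule set_lebesgue_integral_cong) (use w in auto)
      ultimately show ?thesis using u h 1 mM set_integral_diff[OF u h(1)] by (intro exI[of _ "Z - M"]) auto
    next
      case 2
      let ?k = "\<lambda>s. ub - ?g s"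
      let ?G = "\<lambda>s. - (z + ub * (T - t)) + (LINT x:{t..s}|lborel. ?k x)"
      let ?h = "\<lambda>s. if - m \<le> ?G s then ?k s else 0"
      have k: "set_integrable lborel {t..T} ?k" by (rule set_integral_diff(1)[OF icmul u])
      have G: "?G s = - (?Z s + ub * (T - s))" if "s \<in> {t..T}" for s
        using set_integral_diff(2)[OF icmul ii[of s]] cub[of t s] that
        by (simp add: cumulated_def algebra_simps)
      have h: "set_integrable lborel {t..T} ?h" "(LINT s:{t..T}|lborel. ?h s) = - Z + m"
        using integral_beyond_level[OF k _ tT, where z = "- (z + ub * (T - t))" and L = "- m"] bd 2 z G[of T] tT unfolding Z_def by auto
      have w: "w s \<omega> = ?g s + ?h s" if "s \<in> {t..T}" for s
        using inc[OF that] 2 mM G[OF that] by (auto simp: w_def clamped_control_def)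
      have "(LINT s:{t..T}|lborel. \<bar>?g s - w s \<omega>\<bar>) = (LINT s:{t..T}|lborel. ?h s)"
        by (rule set_lebesgue_integral_cong) (use w bd in auto)
      moreover have "set_integrable lborel {t..T} (\<lambda>s. w s \<omega>) \<longleftrightarrow> set_integrable lborel {t..T} (\<lambda>s. ?g s + ?h s)"
        by (rule set_integrable_cong) (use w in auto)
      moreover have "(LINT s:{t..T}|lborel. w s \<omega>) = (LINT s:{t..T}|lborel. ?g s + ?h s)"
        by (rule set_lebesgue_integral_cong) (use w in auto)
      ultimately show ?thesis using u h 2 mM set_integral_add[OF u h(1)] by (intro exI[of _ "Z - m"]) auto
    next
      case 3
      have w: "w s \<omega> = ?g s" if "s \<in> {t..T}" for s
        using inc[OF that] 3 mM by (auto simp: w_def clamped_control_def)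
      have "(LINT s:{t..T}|lborel. \<bar>?g s - w s \<omega>\<bar>) = (LINT s:{t..T}|lborel. 0)"
        by (rule set_lebesgue_integral_cong) (use w bd in auto)
      moreover have "set_integrable lborel {t..T} (\<lambda>s. w s \<omega>) \<longleftrightarrow> set_integrable lborel {t..T} ?g"
        by (rule set_integrable_cong) (use w in auto)
      moreover have "(LINT s:{t..T}|lborel. w s \<omega>) = (LINT s:{t..T}|lborel. ?g s)"
        by (rule set_lebesgue_integral_cong) (use w in auto)
      ultimately show ?thesis using u 3 mM by (intro exI[of _ 0]) (auto simp: set_lebesgue_integral_def)
    qed
  qed
  then have *: "(LINT s:{t..T}|lborel. \<bar>?g s - w s \<omega>\<bar>) = \<bar>max 0 (Z - M) - max 0 (m - Z)\<bar>"
    "cumulated t z w T \<omega> = Z - (max 0 (Z - M) - max 0 (m - Z))"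
    by (auto simp: cumulated_def Z_def)
  show "cumulated t z w T \<omega> \<in> {m..M}" unfolding * using mM by (auto simp: max_def)
  show "(LINT s:{t..T}|lborel. \<bar>?g s - w s \<omega>\<bar>) = max 0 (Z - M) + max 0 (m - Z)"
    unfolding * using mM by (auto simp: max_def)
qed

lemma measurable_fst_restrict: "fst \<in> borel_measurable (restrict_space borel A \<Otimes>\<^sub>M N)"
  using measurable_fst[of "restrict_space borel A" N] by (simp add: measurable_restrict_space2_iff)

context filtered_space begin

lemma controls_progressive: "u \<in> controls T \<mu> F ub t \<Longrightarrow> progressively_measurable F t T u"
  and controls_range: "u \<in> controls T \<mu> F ub t \<Longrightarrow> s \<in> {t..T} \<Longrightarrow> \<omega> \<in> space \<mu> \<Longrightarrow> u s \<omega> \<in> {0..ub}"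
  by (auto simp: controls_def)

lemma controls_joint:
  assumes "u \<in> controls T \<mu> F ub t" "t \<in> {0..T}"
  shows "(\<lambda>(\<omega>, s). indicator {t..T} s * u s \<omega>) \<in> borel_measurable (\<mu> \<Otimes>\<^sub>M lborel)"
  using progressive_joint(2)[OF controls_progressive[OF assms(1)], of T] assms by auto

lemma controls_path_integrable:
  assumes u: "u \<in> controls T \<mu> F ub t" and t: "t \<in> {0..T}" and \<omega>: "\<omega> \<in> space \<mu>"
  shows "set_integrable lborel {t..T} (\<lambda>s. u s \<omega>)"
  by (rule bounded_path_integrable[of t T _ ub])
    (use measurable_Pair2[OF controls_joint[OF u t] \<omega>] controls_range[OF u _ \<omega>] in auto)

lemma cumulated_progressive:
  assumes u: "u \<in> controls T \<mu> F ub t" and t: "t \<in> {0..T}" and s: "s \<in> {t..T}"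
  shows "(\<lambda>(\<tau>, \<omega>). cumulated t z u \<tau> \<omega>) \<in> borel_measurable (restrict_space borel {t..s} \<Otimes>\<^sub>M F s)"
proof -
  let ?R = "restrict_space borel {t..s} \<Otimes>\<^sub>M F s"
  define v where "v \<omega> x = indicator {t..s} x * u x \<omega>" for \<omega> x
  have vm[measurable]: "(\<lambda>(\<omega>, x). v \<omega> x) \<in> borel_measurable (F s \<Otimes>\<^sub>M lborel)"
    unfolding v_def using progressive_joint(1)[OF controls_progressive[OF u], of s] s t by auto
  have [measurable]: "fst \<in> borel_measurable ?R"
    by (rule measurable_fst_restrict)
  have "(\<lambda>a. z + (\<integral>x. (if x \<le> fst a then v (snd a) x else 0) \<partial>lborel)) \<in> borel_measurable ?R"
    by measurable
  also have "?this \<longleftrightarrow> (\<lambda>(\<tau>, \<omega>). cumulated t z u \<tau> \<omega>) \<in> borel_measurable ?R"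
  proof (rule measurable_cong)
    fix a assume "a \<in> space ?R"
    then obtain \<tau> \<omega> where a: "a = (\<tau>, \<omega>)" "\<tau> \<in> {t..s}" by (auto simp: space_pair_measure space_restrict_space)
    have "(\<integral>x. (if x \<le> \<tau> then v \<omega> x else 0) \<partial>lborel) = (LINT x:{t..\<tau>}|lborel. u x \<omega>)"
      unfolding set_lebesgue_integral_def v_def
      by (intro Bochner_Integration.integral_cong) (use a in \<open>auto simp: indicator_def\<close>)
    then show "z + (\<integral>x. (if x \<le> fst a then v (snd a) x else 0) \<partial>lborel) = (case a of (\<tau>, \<omega>) \<Rightarrow> cumulated t z u \<tau> \<omega>)"
      unfolding a(1) fst_conv snd_conv by (simp add: cumulated_def)
  qed
  finally show ?thesis .
qed

lemma cumulated_measurable: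
  assumes u: "u \<in> controls T \<mu> F ub t" and t: "t \<in> {0..T}"
  shows "cumulated t z u T \<in> borel_measurable \<mu>"
proof -
  define v where "v \<omega> x = indicator {t..T} x * u x \<omega>" for \<omega> x
  have [measurable]: "(\<lambda>(\<omega>, x). v \<omega> x) \<in> borel_measurable (\<mu> \<Otimes>\<^sub>M lborel)"
    unfolding v_def by (rule controls_joint[OF u t])
  have "(\<lambda>\<omega>. z + (\<integral>x. v \<omega> x \<partial>lborel)) \<in> borel_measurable \<mu>" by measurable
  then show ?thesis by (simp add: cumulated_def[abs_def] set_lebesgue_integral_def v_def)
qed

lemma cumulated_range:
  assumes u: "u \<in> controls T \<mu> F ub t" and t: "t \<in> {0..T}" and \<omega>: "\<omega> \<in> space \<mu>"
  shows "z \<le> cumulated t z u T \<omega>" "cumulated t z u T \<omega> \<le> z + ub * (T - t)"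
proof -
  have "0 \<le> (LINT x:{t..T}|lborel. u x \<omega>)"
    unfolding set_lebesgue_integral_def
    by (rule integral_nonneg_AE) (use controls_range[OF u _ \<omega>] in \<open>auto simp: indicator_def\<close>)
  moreover have "(LINT x:{t..T}|lborel. u x \<omega>) \<le> (LINT x:{t..T}|lborel. ub)"
    by (rule set_integral_mono[OF controls_path_integrable[OF u t \<omega>]])
      (use controls_range[OF u _ \<omega>] in \<open>auto intro!: borel_integrable_atLeastAtMost' continuous_intros\<close>)
  moreover have "(LINT x:{t..T}|lborel. ub) = ub * (T - t)"
    using t by (simp add: set_lebesgue_integral_def)
  ultimately show "z \<le> cumulated t z u T \<omega>" "cumulated t z u T \<omega> \<le> z + ub * (T - t)"
    by (auto simp: cumulated_def)
qed

lemma clamped_control_controls: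
  assumes u: "u \<in> controls T \<mu> F ub t" and t: "t \<in> {0..T}" and ub: "0 \<le> ub"
  shows "clamped_control T ub m M t z u \<in> controls T \<mu> F ub t"
  unfolding controls_def mem_Collect_eq progressively_measurable_def
proof (intro conjI ballI)
  fix s assume s: "s \<in> {t..T}"
  let ?R = "restrict_space borel {t..s} \<Otimes>\<^sub>M F s"
  have [measurable]: "(\<lambda>a. cumulated t z u (fst a) (snd a)) \<in> borel_measurable ?R"
    using cumulated_progressive[OF u t s] by (simp add: split_beta')
  have [measurable]: "(\<lambda>a. u (fst a) (snd a)) \<in> borel_measurable ?R"
    using controls_progressive[OF u] s unfolding progressively_measurable_def by (auto simp: split_beta')
  have [measurable]: "fst \<in> borel_measurable ?R"
    by (rule measurable_fst_restrict)
  show "(\<lambda>(\<tau>, \<omega>). clamped_control T ub m M t z u \<tau> \<omega>) \<in> borel_measurable ?R"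
    unfolding clamped_control_def split_beta' by measurable
next
  fix s \<omega> assume "s \<in> {t..T}" "\<omega> \<in> space \<mu>"
  then show "clamped_control T ub m M t z u s \<omega> \<in> {0..ub}"
    using controls_range[OF u, of s \<omega>] ub by (auto simp: clamped_control_def)
qed

lemma constant_control: "0 \<le> a \<Longrightarrow> a \<le> ub \<Longrightarrow> (\<lambda>s \<omega>. a) \<in> controls T \<mu> F ub t"
  by (auto simp: controls_def progressively_measurable_def)

end

lemma cumulated_constant: "t \<le> T \<Longrightarrow> cumulated t z (\<lambda>s \<omega>. a) T \<omega> = z + a * (T - t)"
  by (simp add: cumulated_def set_lebesgue_integral_def)


section \<open>Comparing the two value functions\<close>

text \<open>The price started at a fixed \<open>(t, p)\<close> enters the comparison of the value functions only through
  measurability, continuity of paths and the constant \<open>C\<close>, which bounds the second moment of \<open>P - K\<close>.\<close>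

locale swing_price = filtered_space \<mu> T F for \<mu> :: "'a measure" and T :: real and F +
  fixes P :: "real \<Rightarrow> real \<Rightarrow> real \<Rightarrow> 'a \<Rightarrow> real" and t p r K ub C :: real
  assumes t: "t \<in> {0..T}" and r: "0 \<le> r" and ub: "0 < ub" and C: "0 \<le> C"
    and price_progressive: "progressively_measurable F t T (P t p)"
    and price_continuous: "AE \<omega> in \<mu>. continuous_on {t..T} (\<lambda>s. P t p s \<omega>)"
    and price_moment: "(\<integral>\<^sup>+\<omega>. ennreal (LINT s:{t..T}|lborel. (P t p s \<omega> - K)\<^sup>2) \<partial>\<mu>) \<le> ennreal C"
begin

abbreviation "ctrl \<equiv> controls T \<mu> F ub t"
abbreviation "payoff \<equiv> running_payoff P T r K t p"
abbreviation "square_gain \<omega> \<equiv> LINT s:{t..T}|lborel. (P t p s \<omega> - K)\<^sup>2"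

lemma price_joint: "(\<lambda>(\<omega>, s). indicator {t..T} s * P t p s \<omega>) \<in> borel_measurable (\<mu> \<Otimes>\<^sub>M lborel)"
  using progressive_joint(2)[OF price_progressive, of T] t by auto

lemma square_gain_integrable: "integrable \<mu> square_gain" "(\<integral>\<omega>. square_gain \<omega> \<partial>\<mu>) \<le> C"
proof -
  define x where "x \<omega> s = indicator {t..T} s * P t p s \<omega>" for \<omega> s
  have [measurable]: "(\<lambda>(\<omega>, s). x \<omega> s) \<in> borel_measurable (\<mu> \<Otimes>\<^sub>M lborel)"
    unfolding x_def by (rule price_joint)
  have eq: "square_gain \<omega> = (\<integral>s. (x \<omega> s - indicator {t..T} s * K)\<^sup>2 \<partial>lborel)" for \<omega>
    unfolding set_lebesgue_integral_def x_def
    by (intro Bochner_Integration.integral_cong) (auto simp: indicator_def)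
  have m: "square_gain \<in> borel_measurable \<mu>" unfolding eq by measurable
  have 0: "0 \<le> square_gain \<omega>" for \<omega> unfolding eq by (rule integral_nonneg_AE) auto
  show i: "integrable \<mu> square_gain"
    by (rule integrableI_nonneg[OF m]) (use 0 le_less_trans[OF price_moment] in auto)
  show "(\<integral>\<omega>. square_gain \<omega> \<partial>\<mu>) \<le> C"
    using price_moment nn_integral_eq_integral[OF i] 0 C by simp
qed

lemma payoff_measurable:
  assumes u: "u \<in> ctrl"
  shows "payoff u \<in> borel_measurable \<mu>"
proof -
  define x where "x \<omega> s = indicator {t..T} s * P t p s \<omega>" for \<omega> s
  define v where "v \<omega> s = indicator {t..T} s * u s \<omega>" for \<omega> s
  have [measurable]: "(\<lambda>(\<omega>, s). x \<omega> s) \<in> borel_measurable (\<mu> \<Otimes>\<^sub>M lborel)"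
    unfolding x_def by (rule price_joint)
  have [measurable]: "(\<lambda>(\<omega>, s). v \<omega> s) \<in> borel_measurable (\<mu> \<Otimes>\<^sub>M lborel)"
    unfolding v_def by (rule controls_joint[OF u t])
  have eq: "payoff u \<omega> = (\<integral>s. exp (- r * (s - t)) * (x \<omega> s - K) * v \<omega> s \<partial>lborel)" for \<omega>
    unfolding running_payoff_def set_lebesgue_integral_def x_def v_def
    by (intro Bochner_Integration.integral_cong) (auto simp: indicator_def)
  show ?thesis unfolding eq by measurable
qed

lemma control_distance_measurable:
  assumes u: "u \<in> ctrl" and w: "w \<in> ctrl"
  shows "(\<lambda>\<omega>. LINT s:{t..T}|lborel. \<bar>u s \<omega> - w s \<omega>\<bar>) \<in> borel_measurable \<mu>"
proof -
  define a where "a \<omega> s = indicator {t..T} s * u s \<omega>" for \<omega> s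
  define b where "b \<omega> s = indicator {t..T} s * w s \<omega>" for \<omega> s
  have [measurable]: "(\<lambda>(\<omega>, s). a \<omega> s) \<in> borel_measurable (\<mu> \<Otimes>\<^sub>M lborel)"
    unfolding a_def by (rule controls_joint[OF u t])
  have [measurable]: "(\<lambda>(\<omega>, s). b \<omega> s) \<in> borel_measurable (\<mu> \<Otimes>\<^sub>M lborel)"
    unfolding b_def by (rule controls_joint[OF w t])
  have eq: "(LINT s:{t..T}|lborel. \<bar>u s \<omega> - w s \<omega>\<bar>) = (\<integral>s. \<bar>a \<omega> s - b \<omega> s\<bar> \<partial>lborel)" for \<omega>
    unfolding set_lebesgue_integral_def a_def b_def
    by (intro Bochner_Integration.integral_cong) (auto simp: indicator_def)
  show ?thesis unfolding eq by measurable
qed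

text \<open>Young's inequality with weight \<open>l\<close> separates the unbounded price from the difference of the
  controls; the square of the latter is at most \<open>ub\<close> times its absolute value, because both controls
  take values in \<open>[0, ub]\<close>.\<close>

lemma payoff_path_difference:
  assumes u: "u \<in> ctrl" and w: "w \<in> ctrl" and l: "0 < l"
  shows "AE \<omega> in \<mu>. \<bar>payoff u \<omega> - payoff w \<omega>\<bar>
    \<le> square_gain \<omega> / (2 * l) + l * ub / 2 * (LINT s:{t..T}|lborel. \<bar>u s \<omega> - w s \<omega>\<bar>)"
  using price_continuous AE_space
proof eventually_elim
  case (elim \<omega>)
  note \<omega> = elim(2)
  let ?e = "\<lambda>s. exp (- r * (s - t)) * (P t p s \<omega> - K)"
  have ui: "set_integrable lborel {t..T} (\<lambda>s. u s \<omega>)" and wi: "set_integrable lborel {t..T} (\<lambda>s. w s \<omega>)"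
    using controls_path_integrable[OF u t \<omega>] controls_path_integrable[OF w t \<omega>] by auto
  have ec: "continuous_on {t..T} ?e" by (intro continuous_intros elim(1))
  have prod: "set_integrable lborel {t..T} (\<lambda>s. ?e s * g s)" if "set_integrable lborel {t..T} g" for g :: "real \<Rightarrow> real"
  proof -
    have "bounded (?e ` {t..T})" by (intro compact_imp_bounded compact_continuous_image ec) auto
    then obtain B where B0: "\<forall>y \<in> ?e ` {t..T}. norm y \<le> B" unfolding bounded_iff by blast
    have B: "\<bar>?e s\<bar> \<le> B" if "s \<in> {t..T}" for s
      using bspec[OF B0 imageI[OF that]] by (simp only: real_norm_def)
    have em: "(\<lambda>s. indicator {t..T} s * ?e s) \<in> borel_measurable lborel"
      using borel_integrable_atLeastAtMost'[OF ec] unfolding set_integrable_def by auto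
    have gi: "integrable lborel (\<lambda>s. indicator {t..T} s * g s)" using that by (simp add: set_integrable_def)
    show ?thesis unfolding set_integrable_def real_scaleR_def
    proof (rule Bochner_Integration.integrable_bound[OF integrable_mult_left[OF gi, of B]])
      have "(\<lambda>s. (indicator {t..T} s * ?e s) * (indicator {t..T} s * g s)) \<in> borel_measurable lborel"
        using em gi by auto
      then show "(\<lambda>s. indicator {t..T} s * (?e s * g s)) \<in> borel_measurable lborel"
        by (rule measurable_cong[THEN iffD1, rotated]) (simp add: indicator_def)
      show "AE s in lborel. norm (indicator {t..T} s * (?e s * g s)) \<le> norm (indicator {t..T} s * g s * B)"
      proof (rule AE_I2)
        fix s
        show "norm (indicator {t..T} s * (?e s * g s)) \<le> norm (indicator {t..T} s * g s * B)"
        proof (cases "s \<in> {t..T}")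
          case True
          have "\<bar>?e s\<bar> * \<bar>g s\<bar> \<le> \<bar>B\<bar> * \<bar>g s\<bar>" using B[OF True] by (intro mult_right_mono) auto
          then show ?thesis using True by (simp add: abs_mult mult.commute)
        qed simp
      qed
    qed
  qed
  have di: "set_integrable lborel {t..T} (\<lambda>s. \<bar>u s \<omega> - w s \<omega>\<bar>)"
    by (rule set_integrable_abs[OF set_integral_diff(1)[OF ui wi]])
  have gi: "set_integrable lborel {t..T} (\<lambda>s. (P t p s \<omega> - K)\<^sup>2)"
    by (intro borel_integrable_atLeastAtMost' continuous_intros elim(1))
  have "\<bar>payoff u \<omega> - payoff w \<omega>\<bar> = \<bar>LINT s:{t..T}|lborel. ?e s * u s \<omega> - ?e s * w s \<omega>\<bar>"
    unfolding running_payoff_def set_integral_diff(2)[OF prod[OF ui] prod[OF wi]] ..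
  also have "\<dots> \<le> (LINT s:{t..T}|lborel. \<bar>?e s * u s \<omega> - ?e s * w s \<omega>\<bar>)"
    using integral_abs_bound[of lborel "\<lambda>s. indicator {t..T} s * (?e s * u s \<omega> - ?e s * w s \<omega>)"]
    unfolding set_lebesgue_integral_def real_scaleR_def abs_mult[of "indicator {t..T} _"] abs_indicator .
  also have "\<dots> \<le> (LINT s:{t..T}|lborel. (P t p s \<omega> - K)\<^sup>2 / (2 * l) + l * ub / 2 * \<bar>u s \<omega> - w s \<omega>\<bar>)"
  proof (rule set_integral_mono)
    show "set_integrable lborel {t..T} (\<lambda>s. \<bar>?e s * u s \<omega> - ?e s * w s \<omega>\<bar>)"
      by (rule set_integrable_abs[OF set_integral_diff(1)[OF prod[OF ui] prod[OF wi]]])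
    show "set_integrable lborel {t..T} (\<lambda>s. (P t p s \<omega> - K)\<^sup>2 / (2 * l) + l * ub / 2 * \<bar>u s \<omega> - w s \<omega>\<bar>)"
      by (intro set_integral_add(1) set_integrable_divide set_integrable_mult_right gi di)
    fix s assume s: "s \<in> {t..T}"
    let ?x = "\<bar>P t p s \<omega> - K\<bar>" and ?y = "\<bar>u s \<omega> - w s \<omega>\<bar>"
    have y: "?y \<le> ub" using controls_range[OF u s \<omega>] controls_range[OF w s \<omega>] by auto
    have "\<bar>?e s * u s \<omega> - ?e s * w s \<omega>\<bar> = \<bar>?e s\<bar> * ?y"
      unfolding right_diff_distrib[symmetric] abs_mult ..
    also have "\<dots> = exp (- r * (s - t)) * (?x * ?y)" by (simp add: abs_mult)
    also have "\<dots> \<le> 1 * (?x * ?y)" using r s by (intro mult_right_mono) auto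
    also have "\<dots> \<le> ?x\<^sup>2 / (2 * l) + l / 2 * ?y\<^sup>2"
    proof -
      have "0 \<le> (?x - l * ?y)\<^sup>2 / (2 * l)" using l by simp
      also have "\<dots> = ?x\<^sup>2 / (2 * l) + l / 2 * ?y\<^sup>2 - ?x * ?y"
        using l by (simp add: power2_diff power2_eq_square field_simps)
      finally show ?thesis by simp
    qed
    also have "l / 2 * ?y\<^sup>2 \<le> l / 2 * (ub * ?y)"
      using l y unfolding power2_eq_square by (intro mult_left_mono mult_right_mono) auto
    finally show "\<bar>?e s * u s \<omega> - ?e s * w s \<omega>\<bar> \<le> (P t p s \<omega> - K)\<^sup>2 / (2 * l) + l * ub / 2 * ?y" by simp
  qed
  also have "\<dots> = square_gain \<omega> / (2 * l) + l * ub / 2 * (LINT s:{t..T}|lborel. \<bar>u s \<omega> - w s \<omega>\<bar>)"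
    using gi di by (subst set_integral_add(2)) (auto intro!: set_integrable_divide set_integrable_mult_right)
  finally show ?case .
qed

lemma control_distance_range:
  assumes u: "u \<in> ctrl" and w: "w \<in> ctrl" and \<omega>: "\<omega> \<in> space \<mu>"
  shows "0 \<le> (LINT s:{t..T}|lborel. \<bar>u s \<omega> - w s \<omega>\<bar>)" "(LINT s:{t..T}|lborel. \<bar>u s \<omega> - w s \<omega>\<bar>) \<le> ub * (T - t)"
proof -
  show "0 \<le> (LINT s:{t..T}|lborel. \<bar>u s \<omega> - w s \<omega>\<bar>)"
    unfolding set_lebesgue_integral_def by (rule integral_nonneg_AE) auto
  have "(LINT s:{t..T}|lborel. \<bar>u s \<omega> - w s \<omega>\<bar>) \<le> (LINT s:{t..T}|lborel. ub)"
  proof (rule set_integral_mono)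
    show "set_integrable lborel {t..T} (\<lambda>s. \<bar>u s \<omega> - w s \<omega>\<bar>)"
      by (rule set_integrable_abs[OF set_integral_diff(1)]; rule controls_path_integrable[OF _ t \<omega>]; fact)
    show "set_integrable lborel {t..T} (\<lambda>s. ub)" by (intro borel_integrable_atLeastAtMost' continuous_intros)
    show "\<bar>u s \<omega> - w s \<omega>\<bar> \<le> ub" if "s \<in> {t..T}" for s
      using controls_range[OF u that \<omega>] controls_range[OF w that \<omega>] by auto
  qed
  also have "\<dots> = ub * (T - t)" using t by (simp add: set_lebesgue_integral_def)
  finally show "(LINT s:{t..T}|lborel. \<bar>u s \<omega> - w s \<omega>\<bar>) \<le> ub * (T - t)" .
qed

lemma control_distance_integrable:
  assumes u: "u \<in> ctrl" and w: "w \<in> ctrl"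
  shows "integrable \<mu> (\<lambda>\<omega>. LINT s:{t..T}|lborel. \<bar>u s \<omega> - w s \<omega>\<bar>)"
proof (rule integrable_const_bound[of _ "ub * (T - t)"])
  show "AE \<omega> in \<mu>. norm (LINT s:{t..T}|lborel. \<bar>u s \<omega> - w s \<omega>\<bar>) \<le> ub * (T - t)"
    using control_distance_range[OF u w] by (intro AE_I2) (simp add: abs_of_nonneg)
qed (rule control_distance_measurable[OF u w])

lemma payoff_integrable:
  assumes u: "u \<in> ctrl"
  shows "integrable \<mu> (payoff u)"
proof -
  have z: "(\<lambda>s \<omega>. 0) \<in> ctrl" using ub by (intro constant_control) auto
  have p0: "payoff (\<lambda>s \<omega>. 0) \<omega> = 0" for \<omega> by (simp add: running_payoff_def set_lebesgue_integral_def)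
  let ?b = "\<lambda>\<omega>. square_gain \<omega> / 2 + ub / 2 * (LINT s:{t..T}|lborel. \<bar>u s \<omega> - 0\<bar>)"
  have "integrable \<mu> ?b"
    by (intro Bochner_Integration.integrable_add integrable_mult_right integrable_divide square_gain_integrable
        control_distance_integrable[OF u z])
  then show ?thesis
  proof (rule Bochner_Integration.integrable_bound[OF _ payoff_measurable[OF u]])
    show "AE \<omega> in \<mu>. norm (payoff u \<omega>) \<le> norm (?b \<omega>)"
      using payoff_path_difference[OF u z zero_less_one]
      by eventually_elim (simp add: p0)
  qed
qed

lemma payoff_comparison:
  assumes u: "u \<in> ctrl" and w: "w \<in> ctrl" and l: "0 < l"
  shows "expectation (payoff u) \<le> expectation (payoff w)
     + (C / (2 * l) + l * ub / 2 * expectation (\<lambda>\<omega>. LINT s:{t..T}|lborel. \<bar>u s \<omega> - w s \<omega>\<bar>))"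
proof -
  let ?d = "\<lambda>\<omega>. LINT s:{t..T}|lborel. \<bar>u s \<omega> - w s \<omega>\<bar>"
  note di = control_distance_integrable[OF u w]
  have "expectation (payoff u) \<le> expectation (\<lambda>\<omega>. payoff w \<omega> + (square_gain \<omega> / (2 * l) + l * ub / 2 * ?d \<omega>))"
  proof (rule integral_mono_AE[OF payoff_integrable[OF u]])
    show "integrable \<mu> (\<lambda>\<omega>. payoff w \<omega> + (square_gain \<omega> / (2 * l) + l * ub / 2 * ?d \<omega>))"
      by (intro Bochner_Integration.integrable_add payoff_integrable[OF w] integrable_mult_right integrable_divide square_gain_integrable di)
    show "AE \<omega> in \<mu>. payoff u \<omega> \<le> payoff w \<omega> + (square_gain \<omega> / (2 * l) + l * ub / 2 * ?d \<omega>)"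
      using payoff_path_difference[OF u w l] by eventually_elim linarith
  qed
  also have "\<dots> = expectation (payoff w) + (expectation square_gain / (2 * l) + l * ub / 2 * expectation ?d)"
    using payoff_integrable[OF w] square_gain_integrable(1) di by simp
  also have "\<dots> \<le> expectation (payoff w) + (C / (2 * l) + l * ub / 2 * expectation ?d)"
    using square_gain_integrable(2) l by (simp add: divide_right_mono)
  finally show ?thesis .
qed

text \<open>With vanishing distance, \<open>payoff_comparison\<close> bounds the difference by \<open>C / (2 l)\<close> for every \<open>l > 0\<close>.\<close>

lemma payoff_cong_AE:
  assumes u: "u \<in> ctrl" and w: "w \<in> ctrl" and 0: "AE \<omega> in \<mu>. (LINT s:{t..T}|lborel. \<bar>u s \<omega> - w s \<omega>\<bar>) = 0"
  shows "expectation (payoff u) = expectation (payoff w)"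
proof -
  have le: "expectation (payoff u) \<le> expectation (payoff w)"
    if u: "u \<in> ctrl" and w: "w \<in> ctrl" and 0: "AE \<omega> in \<mu>. (LINT s:{t..T}|lborel. \<bar>u s \<omega> - w s \<omega>\<bar>) = 0" for u w
  proof (rule field_le_epsilon)
    fix e :: real assume e: "0 < e"
    let ?l = "(C + 1) / e"
    have l: "0 < ?l" using C e by simp
    have "expectation (payoff u) \<le> expectation (payoff w) + C / (2 * ?l)"
      using payoff_comparison[OF u w l] integral_eq_zero_AE[OF 0] by simp
    also have "C / (2 * ?l) \<le> e"
    proof -
      have "C \<le> 2 * (C + 1)" using C by simp
      also have "\<dots> = e * (2 * ?l)" using e by simp
      finally have "C \<le> e * (2 * ?l)" .
      then show ?thesis using l by (simp only: pos_divide_le_eq mult_pos_pos zero_less_numeral)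
    qed
    finally show "expectation (payoff u) \<le> expectation (payoff w) + e" by simp
  qed
  have 1: "AE \<omega> in \<mu>. (LINT s:{t..T}|lborel. \<bar>w s \<omega> - u s \<omega>\<bar>) = 0"
    using 0 by (simp add: abs_minus_commute)
  show ?thesis using le[OF u w 0] le[OF w u 1] by simp
qed

lemma payoff_bounded_above: "bdd_above ((\<lambda>u. expectation (payoff u)) ` ctrl)"
proof (rule bdd_aboveI)
  fix x assume "x \<in> (\<lambda>u. expectation (payoff u)) ` ctrl"
  then obtain u where u: "u \<in> ctrl" and x: "x = expectation (payoff u)" by blast
  have z: "(\<lambda>s \<omega>. 0) \<in> ctrl" using ub by (intro constant_control) auto
  have "expectation (\<lambda>\<omega>. LINT s:{t..T}|lborel. \<bar>u s \<omega> - 0\<bar>) \<le> ub * (T - t)"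
    by (rule integral_le_const[OF control_distance_integrable[OF u z]])
      (use control_distance_range(2)[OF u z] in auto)
  then have "1 * ub / 2 * expectation (\<lambda>\<omega>. LINT s:{t..T}|lborel. \<bar>u s \<omega> - 0\<bar>) \<le> 1 * ub / 2 * (ub * (T - t))"
    using ub by (intro mult_left_mono) auto
  then show "x \<le> expectation (payoff (\<lambda>s \<omega>. 0)) + (C / (2 * 1) + 1 * ub / 2 * (ub * (T - t)))"
    using payoff_comparison[OF u z zero_less_one] unfolding x by linarith
qed

lemma adm_controls_subset: "adm_controls T \<mu> F ub m M t z \<subseteq> ctrl"
  by (auto simp: adm_controls_def)

lemma clamped_control_admissible:
  assumes u: "u \<in> ctrl" and mM: "m < M" and z: "z \<le> M" "m \<le> z + ub * (T - t)"
  obtains w where "w \<in> ctrl" "\<And>\<omega>. \<omega> \<in> space \<mu> \<Longrightarrow> cumulated t z w T \<omega> \<in> {m..M}"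
    "\<And>\<omega>. \<omega> \<in> space \<mu> \<Longrightarrow> (LINT s:{t..T}|lborel. \<bar>u s \<omega> - w s \<omega>\<bar>) =
       max 0 (cumulated t z u T \<omega> - M) + max 0 (m - cumulated t z u T \<omega>)"
proof (rule that)
  show "clamped_control T ub m M t z u \<in> ctrl"
    using ub by (intro clamped_control_controls[OF u t]) auto
  fix \<omega> assume \<omega>: "\<omega> \<in> space \<mu>"
  have tT: "t \<le> T" using t by simp
  note path = clamped_control_path[where u = u and \<omega> = \<omega>, OF controls_path_integrable[OF u t \<omega>] controls_range[OF u _ \<omega>] tT mM z]
  show "cumulated t z (clamped_control T ub m M t z u) T \<omega> \<in> {m..M}" by (rule path(1))
  show "(LINT s:{t..T}|lborel. \<bar>u s \<omega> - clamped_control T ub m M t z u s \<omega>\<bar>) =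
       max 0 (cumulated t z u T \<omega> - M) + max 0 (m - cumulated t z u T \<omega>)" by (rule path(2))
qed

text \<open>The penalty of \<open>u\<close> is at most \<open>- c\<close> times the distance \<open>d\<close> from \<open>u\<close> to its projection \<open>w\<close> onto \<open>[m, M]\<close>.
  After discounting this is at most \<open>- c exp (- r T) d\<close>, and \<open>l\<close> is chosen so that this compensates the
  term \<open>l ub d / 2\<close> of \<open>payoff_comparison\<close> exactly.\<close>

lemma penalized_value_upper:
  assumes mM: "m < M" and z: "z \<le> M" "m \<le> z + ub * (T - t)" and c: "0 < c"
  shows "penalized_value \<mu> F P T r K ub m M c t p z
    \<le> swing_value \<mu> F P T r K ub m M t p z + ub * C / (4 * c * exp (- r * T))"
  unfolding penalized_value_def
proof (rule cSUP_least)
  show "ctrl \<noteq> {}" using constant_control[of 0 ub t] ub by auto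
  fix u assume u: "u \<in> ctrl"
  obtain w where w: "w \<in> ctrl" "\<And>\<omega>. \<omega> \<in> space \<mu> \<Longrightarrow> cumulated t z w T \<omega> \<in> {m..M}"
    and dist: "\<And>\<omega>. \<omega> \<in> space \<mu> \<Longrightarrow> (LINT s:{t..T}|lborel. \<bar>u s \<omega> - w s \<omega>\<bar>) =
       max 0 (cumulated t z u T \<omega> - M) + max 0 (m - cumulated t z u T \<omega>)"
    by (rule clamped_control_admissible[OF u mM z]) (rule that)
  let ?d = "\<lambda>\<omega>. LINT s:{t..T}|lborel. \<bar>u s \<omega> - w s \<omega>\<bar>" and ?E = "exp (- r * T)"
  let ?pen = "\<lambda>\<omega>. exp (- r * (T - t)) * penalty m M c (cumulated t z u T \<omega>)"
  define l where "l = 2 * c * ?E / ub"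
  have l: "0 < l" using c ub by (simp add: l_def)
  have wadm: "w \<in> adm_controls T \<mu> F ub m M t z" using w by (auto simp: adm_controls_def)
  have [measurable]: "cumulated t z u T \<in> borel_measurable \<mu>" by (rule cumulated_measurable[OF u t])
  have pi: "integrable \<mu> ?pen"
  proof (rule integrable_const_bound)
    show "?pen \<in> borel_measurable \<mu>" unfolding penalty_def by measurable
    let ?R = "c * ((\<bar>z\<bar> + ub * (T - t) + \<bar>M\<bar> + 1 / sqrt c) + (\<bar>m\<bar> + 1 / sqrt c + \<bar>z\<bar> + ub * (T - t)))"
    show "AE \<omega> in \<mu>. norm (?pen \<omega>) \<le> 1 * ?R"
    proof (rule AE_I2)
      fix \<omega> assume \<omega>: "\<omega> \<in> space \<mu>"
      have "0 \<le> ub * (T - t)" "0 < 1 / sqrt c" using t ub c by auto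
      then have "\<bar>max 0 (cumulated t z u T \<omega> - (M - 1 / sqrt c)) + max 0 (m + 1 / sqrt c - cumulated t z u T \<omega>)\<bar>
        \<le> (\<bar>z\<bar> + ub * (T - t) + \<bar>M\<bar> + 1 / sqrt c) + (\<bar>m\<bar> + 1 / sqrt c + \<bar>z\<bar> + ub * (T - t))"
        using cumulated_range[OF u t \<omega>, of z] by linarith
      then have "\<bar>penalty m M c (cumulated t z u T \<omega>)\<bar> \<le> ?R"
        using c unfolding penalty_def abs_mult by (simp add: mult_left_mono)
      moreover have "exp (- r * (T - t)) \<le> 1" using r t by auto
      ultimately show "norm (?pen \<omega>) \<le> 1 * ?R"
        unfolding real_norm_def abs_mult abs_exp_cancel by (intro mult_mono) auto
    qed
  qed
  have pen: "?pen \<omega> \<le> - (c * ?E) * ?d \<omega>" if \<omega>: "\<omega> \<in> space \<mu>" for \<omega>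
  proof -
    let ?Z = "cumulated t z u T \<omega>"
    have "0 < 1 / sqrt c" using c by simp
    then have "?d \<omega> \<le> max 0 (?Z - (M - 1 / sqrt c)) + max 0 ((m + 1 / sqrt c) - ?Z)"
      unfolding dist[OF \<omega>] by (intro add_mono) linarith+
    then have "penalty m M c ?Z \<le> - c * ?d \<omega>"
      unfolding penalty_def using c by (simp add: mult_left_mono)
    then have "?pen \<omega> \<le> exp (- r * (T - t)) * (- c * ?d \<omega>)" by (intro mult_left_mono) auto
    also have "\<dots> \<le> ?E * (- c * ?d \<omega>)"
    proof (rule mult_right_mono_neg)
      show "?E \<le> exp (- r * (T - t))" using r t by (simp add: mult_left_mono)
      show "- c * ?d \<omega> \<le> 0" using c control_distance_range(1)[OF u w(1) \<omega>] by simp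
    qed
    finally show ?thesis by (simp add: mult_ac)
  qed
  have split: "expectation (\<lambda>\<omega>. payoff u \<omega> + ?pen \<omega>) = expectation (payoff u) + expectation ?pen"
    using payoff_integrable[OF u] pi by simp
  have "expectation ?pen \<le> expectation (\<lambda>\<omega>. - (c * ?E) * ?d \<omega>)"
    by (rule integral_mono[OF pi]) (use control_distance_integrable[OF u w(1)] pen in auto)
  then have "expectation ?pen \<le> - (c * ?E * expectation ?d)" by simp
  moreover have "expectation (payoff u) \<le> expectation (payoff w) + (ub * C / (4 * c * ?E) + c * ?E * expectation ?d)"
  proof -
    have "l * ub / 2 = c * ?E" "C / (2 * l) = ub * C / (4 * c * ?E)" using ub c by (auto simp: l_def mult_ac)
    then show ?thesis using payoff_comparison[OF u w(1) l] by simp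
  qed
  moreover have "expectation (payoff w) \<le> swing_value \<mu> F P T r K ub m M t p z"
    unfolding swing_value_def
    by (rule cSUP_upper[OF wadm bdd_above_mono[OF payoff_bounded_above image_mono[OF adm_controls_subset]]])
  ultimately show "expectation (\<lambda>\<omega>. payoff u \<omega> + ?pen \<omega>)
      \<le> swing_value \<mu> F P T r K ub m M t p z + ub * C / (4 * c * ?E)"
    unfolding split by linarith
qed

text \<open>The penalty is nonpositive, so the unpenalized bound applies. The maximum with \<open>0\<close> covers the
  convention that the integral of a nonintegrable function is \<open>0\<close>.\<close>

lemma penalized_value_bounded_above:
  assumes c: "0 < c"
  shows "bdd_above ((\<lambda>u. expectation (\<lambda>\<omega>. payoff u \<omega> + exp (- r * (T - t)) * penalty m M c (cumulated t z u T \<omega>))) ` ctrl)"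
    (is "bdd_above (?J ` _)")
proof -
  from payoff_bounded_above obtain B where B: "\<And>u. u \<in> ctrl \<Longrightarrow> expectation (payoff u) \<le> B"
    by (auto simp: bdd_above_def)
  show ?thesis
  proof (rule bdd_aboveI2)
    fix u assume u: "u \<in> ctrl"
    have "?J u \<le> max 0 (expectation (payoff u))"
    proof (cases "integrable \<mu> (\<lambda>\<omega>. payoff u \<omega> + exp (- r * (T - t)) * penalty m M c (cumulated t z u T \<omega>))")
      case True
      have "penalty m M c x \<le> 0" for x using c unfolding penalty_def by (simp add: mult_nonneg_nonneg)
      then have "?J u \<le> expectation (payoff u)"
        by (intro integral_mono[OF True payoff_integrable[OF u]]) (simp add: mult_nonneg_nonpos)
      then show ?thesis by simp
    qed (simp add: not_integrable_integral_eq)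
    then show "?J u \<le> max 0 B" using B[OF u] by simp
  qed
qed

text \<open>An admissible control is projected onto the smaller interval \<open>[m + e, M - e]\<close>, on which the penalty
  is zero. Its terminal quantity lies in \<open>[m, M]\<close>, so the projection moves it by at most \<open>e\<close>, and \<open>l = 1 / sqrt e\<close>
  balances the two error terms of \<open>payoff_comparison\<close>.\<close>

lemma penalized_value_lower:
  assumes c: "0 < c" and e: "e = 1 / sqrt c" and mM: "m + e < M - e"
    and z: "z \<le> M - e" "m + e \<le> z + ub * (T - t)"
  shows "swing_value \<mu> F P T r K ub m M t p z
    \<le> penalized_value \<mu> F P T r K ub m M c t p z + sqrt e * (C + ub) / 2"
  unfolding swing_value_def
proof (rule cSUP_least)
  have e0: "0 < e" using c e by simp
  show "adm_controls T \<mu> F ub m M t z \<noteq> {}"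
  proof -
    have "(\<lambda>s \<omega>. 0) \<in> ctrl" using ub by (intro constant_control) auto
    moreover have "m < M" "z \<le> M" "m \<le> z + ub * (T - t)" using mM z e0 by auto
    ultimately obtain w where "w \<in> ctrl" "\<And>\<omega>. \<omega> \<in> space \<mu> \<Longrightarrow> cumulated t z w T \<omega> \<in> {m..M}"
      by (rule clamped_control_admissible) (rule that)
    then have "w \<in> adm_controls T \<mu> F ub m M t z" by (auto simp: adm_controls_def)
    then show ?thesis by blast
  qed
  fix u assume uadm: "u \<in> adm_controls T \<mu> F ub m M t z"
  then have u: "u \<in> ctrl" and ua: "AE \<omega> in \<mu>. cumulated t z u T \<omega> \<in> {m..M}" by (auto simp: adm_controls_def)
  obtain w where w: "w \<in> ctrl" "\<And>\<omega>. \<omega> \<in> space \<mu> \<Longrightarrow> cumulated t z w T \<omega> \<in> {m + e..M - e}"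
    and dist: "\<And>\<omega>. \<omega> \<in> space \<mu> \<Longrightarrow> (LINT s:{t..T}|lborel. \<bar>u s \<omega> - w s \<omega>\<bar>) =
       max 0 (cumulated t z u T \<omega> - (M - e)) + max 0 (m + e - cumulated t z u T \<omega>)"
    by (rule clamped_control_admissible[OF u mM z]) (rule that)
  let ?d = "\<lambda>\<omega>. LINT s:{t..T}|lborel. \<bar>u s \<omega> - w s \<omega>\<bar>"
  have "expectation ?d \<le> e"
  proof (rule integral_le_const[OF control_distance_integrable[OF u w(1)]])
    show "AE \<omega> in \<mu>. ?d \<omega> \<le> e"
      using ua AE_space
    proof eventually_elim
      case (elim \<omega>)
      then show ?case unfolding dist[OF elim(2)] using mM e0 by (auto simp: max_def)
    qed
  qed
  define l where "l = 1 / sqrt e"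
  have l: "0 < l" using e0 by (simp add: l_def)
  have "l * ub / 2 * expectation ?d \<le> l * ub / 2 * e"
    using l ub \<open>expectation ?d \<le> e\<close> by (intro mult_left_mono) auto
  moreover have "l * ub / 2 * e = sqrt e * ub / 2"
  proof -
    have "l * e = sqrt e" unfolding l_def using e0 by (simp add: real_div_sqrt)
    then have "ub / 2 * (l * e) = ub / 2 * sqrt e" by simp
    then show ?thesis by (simp add: mult_ac)
  qed
  moreover have "C / (2 * l) = sqrt e * C / 2" by (simp add: l_def)
  moreover have "expectation (payoff w) \<le> penalized_value \<mu> F P T r K ub m M c t p z"
  proof -
    have "expectation (payoff w) = expectation (\<lambda>\<omega>. payoff w \<omega> + exp (- r * (T - t)) * penalty m M c (cumulated t z w T \<omega>))"
    proof (rule Bochner_Integration.integral_cong[OF refl])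
      fix \<omega> assume "\<omega> \<in> space \<mu>"
      from w(2)[OF this] have "penalty m M c (cumulated t z w T \<omega>) = 0"
        unfolding penalty_def e[symmetric] by (auto simp: max_def)
      then show "payoff w \<omega> = payoff w \<omega> + exp (- r * (T - t)) * penalty m M c (cumulated t z w T \<omega>)" by simp
    qed
    also have "\<dots> \<le> penalized_value \<mu> F P T r K ub m M c t p z"
      unfolding penalized_value_def by (rule cSUP_upper[OF w(1) penalized_value_bounded_above[OF c]])
    finally show ?thesis .
  qed
  moreover have "sqrt e * (C + ub) / 2 = sqrt e * C / 2 + sqrt e * ub / 2"
    by (simp add: algebra_simps add_divide_distrib)
  ultimately show "expectation (payoff u) \<le> penalized_value \<mu> F P T r K ub m M c t p z + sqrt e * (C + ub) / 2"
    using payoff_comparison[OF u w(1) l] by linarith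
qed

text \<open>A control with values in \<open>[0, ub]\<close> whose terminal quantity is that of an extreme constant control
  \<open>a\<close> is almost everywhere equal to \<open>a\<close>: the difference \<open>u - a\<close> has a constant sign and integral \<open>0\<close>.\<close>

lemma swing_value_forced:
  assumes a: "a = 0 \<or> a = ub" and adm: "(\<lambda>s \<omega>. a) \<in> adm_controls T \<mu> F ub m M t z"
    and forced: "\<And>u. u \<in> adm_controls T \<mu> F ub m M t z \<Longrightarrow> AE \<omega> in \<mu>. cumulated t z u T \<omega> = cumulated t z (\<lambda>s \<omega>. a) T \<omega>"
  shows "swing_value \<mu> F P T r K ub m M t p z = expectation (payoff (\<lambda>s \<omega>. a))"
proof -
  have "expectation (payoff u) = expectation (payoff (\<lambda>s \<omega>. a))" if u: "u \<in> adm_controls T \<mu> F ub m M t z" for u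
  proof (rule payoff_cong_AE)
    show uc: "u \<in> ctrl" and ac: "(\<lambda>s \<omega>. a) \<in> ctrl" using u adm adm_controls_subset by auto
    show "AE \<omega> in \<mu>. (LINT s:{t..T}|lborel. \<bar>u s \<omega> - a\<bar>) = 0"
      using forced[OF u] AE_space
    proof eventually_elim
      case (elim \<omega>)
      note ui = controls_path_integrable[OF uc t elim(2)] and ai = controls_path_integrable[OF ac t elim(2)]
      have "(LINT s:{t..T}|lborel. \<bar>u s \<omega> - a\<bar>) = \<bar>LINT s:{t..T}|lborel. u s \<omega> - a\<bar>"
        using a
      proof
        assume a: "a = 0"
        have "(LINT s:{t..T}|lborel. \<bar>u s \<omega> - a\<bar>) = (LINT s:{t..T}|lborel. u s \<omega> - a)"
          by (rule set_lebesgue_integral_cong) (use controls_range[OF uc _ elim(2)] a in auto)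
        moreover have "0 \<le> (LINT s:{t..T}|lborel. \<bar>u s \<omega> - a\<bar>)"
          unfolding set_lebesgue_integral_def by (rule integral_nonneg_AE) auto
        ultimately show ?thesis by simp
      next
        assume a: "a = ub"
        have "(LINT s:{t..T}|lborel. \<bar>u s \<omega> - a\<bar>) = (LINT s:{t..T}|lborel. - (u s \<omega> - a))"
          by (rule set_lebesgue_integral_cong) (use controls_range[OF uc _ elim(2)] a in auto)
        also have "\<dots> = - (LINT s:{t..T}|lborel. u s \<omega> - a)"
          unfolding set_lebesgue_integral_def scaleR_minus_right by (rule Bochner_Integration.integral_minus)
        finally have "(LINT s:{t..T}|lborel. \<bar>u s \<omega> - a\<bar>) = - (LINT s:{t..T}|lborel. u s \<omega> - a)" .
        moreover have "0 \<le> (LINT s:{t..T}|lborel. \<bar>u s \<omega> - a\<bar>)"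
          unfolding set_lebesgue_integral_def by (rule integral_nonneg_AE) auto
        ultimately show ?thesis by simp
      qed
      also have "(LINT s:{t..T}|lborel. u s \<omega> - a) = (LINT s:{t..T}|lborel. u s \<omega>) - (LINT s:{t..T}|lborel. a)"
        by (rule set_integral_diff(2)[OF ui ai])
      finally show ?case using elim(1) by (simp add: cumulated_def)
    qed
  qed
  then have "(SUP u\<in>adm_controls T \<mu> F ub m M t z. expectation (payoff u)) =
      (SUP u\<in>adm_controls T \<mu> F ub m M t z. expectation (payoff (\<lambda>s \<omega>. a)))"
    by (rule SUP_cong[OF refl])
  also have "\<dots> = expectation (payoff (\<lambda>s \<omega>. a))"
    by (rule cSUP_const) (use adm in blast)
  finally show ?thesis unfolding swing_value_def .
qed

end


section \<open>Uniform convergence and the boundary values\<close>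

text \<open>The constant serves all starting times and all starting prices in \<open>[- R, R]\<close> simultaneously; this
  is what makes the convergence of the value functions locally uniform.\<close>

lemma strong_solution_price_bound:
  assumes sp: "filtered_prob_space T \<mu> F" "brownian_motion_wrt T \<mu> F W" and T: "0 < T"
    and f: "continuous_on ({0..T} \<times> UNIV) (\<lambda>(s, x). f s x)" "\<exists>L. \<forall>s\<in>{0..T}. L-lipschitz_on UNIV (f s)"
    and \<sigma>: "continuous_on ({0..T} \<times> UNIV) (\<lambda>(s, x). \<sigma> s x)" "\<exists>L. \<forall>s\<in>{0..T}. L-lipschitz_on UNIV (\<sigma> s)"
    and sol: "\<And>t p. t \<in> {0..T} \<Longrightarrow> strong_solution T \<mu> F W f \<sigma> t p (P t p)"
  obtains C where "0 \<le> C" "\<And>t p. t \<in> {0..T} \<Longrightarrow> \<bar>p\<bar> \<le> R \<Longrightarrow>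
    (\<integral>\<^sup>+\<omega>. ennreal (LINT s:{t..T}|lborel. (P t p s \<omega> - K)\<^sup>2) \<partial>\<mu>) \<le> ennreal C"
proof -
  interpret brownian_space \<mu> T F W
    using sp by (auto simp: brownian_space_def filtered_space_def filtered_space_axioms_def brownian_space_axioms_def filtered_prob_space_def)
  obtain G1 where G1: "1 \<le> G1" "\<And>s x. s \<in> {0..T} \<Longrightarrow> (f s x)\<^sup>2 \<le> G1 * (1 + x\<^sup>2)"
    by (rule lipschitz_linear_growth[OF f]) (rule that)
  obtain G2 where G2: "1 \<le> G2" "\<And>s x. s \<in> {0..T} \<Longrightarrow> (\<sigma> s x)\<^sup>2 \<le> G2 * (1 + x\<^sup>2)"
    by (rule lipschitz_linear_growth[OF \<sigma>]) (rule that)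
  define G where "G = max G1 G2"
  define B where "B = 3 * T * G + 3 * G"
  define C where "C = (2 + 2 * K\<^sup>2) * (2 * (1 + 3 * R\<^sup>2) * T * exp (2 * B * T))"
  have G: "1 \<le> G" using G1(1) by (auto simp: G_def)
  have fG: "(f s x)\<^sup>2 \<le> G * (1 + x\<^sup>2)" and \<sigma>G: "(\<sigma> s x)\<^sup>2 \<le> G * (1 + x\<^sup>2)" if "s \<in> {0..T}" for s x
  proof -
    have "G1 * (1 + x\<^sup>2) \<le> G * (1 + x\<^sup>2)" "G2 * (1 + x\<^sup>2) \<le> G * (1 + x\<^sup>2)"
      by (intro mult_right_mono; simp add: G_def)+
    then show "(f s x)\<^sup>2 \<le> G * (1 + x\<^sup>2)" "(\<sigma> s x)\<^sup>2 \<le> G * (1 + x\<^sup>2)"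
      using G1(2)[OF that, of x] G2(2)[OF that, of x] by linarith+
  qed
  show thesis
  proof (rule that)
    show "0 \<le> C" using T by (simp add: C_def)
    fix t p assume t: "t \<in> {0..T}" and p: "\<bar>p\<bar> \<le> R"
    note sol = sol[OF t, of p]
    have cont: "AE \<omega> in \<mu>. continuous_on {t..T} (\<lambda>s. P t p s \<omega>)"
      using sol by (simp add: strong_solution_def)
    have pathwise: "AE \<omega> in \<mu>. ennreal (LINT s:{t..T}|lborel. (P t p s \<omega> - K)\<^sup>2)
       \<le> ennreal (2 + 2 * K\<^sup>2) * ennreal (LINT s:{t..T}|lborel. 1 + (P t p s \<omega>)\<^sup>2)"
      using cont
    proof eventually_elim
      case (elim \<omega>)
      have "(LINT s:{t..T}|lborel. (P t p s \<omega> - K)\<^sup>2) \<le> (LINT s:{t..T}|lborel. (2 + 2 * K\<^sup>2) * (1 + (P t p s \<omega>)\<^sup>2))"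
      proof (rule set_integral_mono)
        show "set_integrable lborel {t..T} (\<lambda>s. (P t p s \<omega> - K)\<^sup>2)"
          "set_integrable lborel {t..T} (\<lambda>s. (2 + 2 * K\<^sup>2) * (1 + (P t p s \<omega>)\<^sup>2))"
          by (intro borel_integrable_atLeastAtMost' continuous_intros elim)+
        fix s
        have "(x - K)\<^sup>2 \<le> (2 + 2 * K\<^sup>2) * (1 + x\<^sup>2)" for x
        proof -
          have "0 \<le> (x + K)\<^sup>2" "0 \<le> K\<^sup>2 * x\<^sup>2" by auto
          then show ?thesis by (simp add: power2_eq_square algebra_simps)
        qed
        then show "(P t p s \<omega> - K)\<^sup>2 \<le> (2 + 2 * K\<^sup>2) * (1 + (P t p s \<omega>)\<^sup>2)" .
      qed
      also have "\<dots> = (2 + 2 * K\<^sup>2) * (LINT s:{t..T}|lborel. 1 + (P t p s \<omega>)\<^sup>2)" by (rule set_integral_mult_right)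
      finally show ?case
        by (subst ennreal_mult'[symmetric]) (auto intro: ennreal_leI)
    qed
    have moment: "(\<integral>\<^sup>+\<omega>. ennreal (LINT s:{t..T}|lborel. 1 + (P t p s \<omega>)\<^sup>2) \<partial>\<mu>) \<le> ennreal (2 * (1 + 3 * p\<^sup>2) * T * exp (2 * B * T))"
      unfolding B_def by (rule strong_solution_second_moment[OF sol _ _ G fG \<sigma>G]) (use t in auto)
    have meas: "(\<lambda>\<omega>. LINT s:{t..T}|lborel. 1 + (P t p s \<omega>)\<^sup>2) \<in> borel_measurable \<mu>"
    proof -
      define x where "x \<omega> s = indicator {t..T} s * P t p s \<omega>" for \<omega> s
      have [measurable]: "(\<lambda>(\<omega>, s). x \<omega> s) \<in> borel_measurable (\<mu> \<Otimes>\<^sub>M lborel)"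
        unfolding x_def using progressive_joint(2)[of t T "P t p" T] sol t by (auto simp: strong_solution_def)
      have eq: "(LINT s:{t..T}|lborel. 1 + (P t p s \<omega>)\<^sup>2) = (\<integral>s. indicator {t..T} s + (x \<omega> s)\<^sup>2 \<partial>lborel)" for \<omega>
        unfolding set_lebesgue_integral_def x_def
        by (intro Bochner_Integration.integral_cong) (auto simp: indicator_def)
      show ?thesis unfolding eq by measurable
    qed
    have "(\<integral>\<^sup>+\<omega>. ennreal (LINT s:{t..T}|lborel. (P t p s \<omega> - K)\<^sup>2) \<partial>\<mu>)
       \<le> (\<integral>\<^sup>+\<omega>. ennreal (2 + 2 * K\<^sup>2) * ennreal (LINT s:{t..T}|lborel. 1 + (P t p s \<omega>)\<^sup>2) \<partial>\<mu>)"
      by (rule nn_integral_mono_AE[OF pathwise])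
    also have "\<dots> = ennreal (2 + 2 * K\<^sup>2) * (\<integral>\<^sup>+\<omega>. ennreal (LINT s:{t..T}|lborel. 1 + (P t p s \<omega>)\<^sup>2) \<partial>\<mu>)"
      using meas by (intro nn_integral_cmult) auto
    also have "\<dots> \<le> ennreal (2 + 2 * K\<^sup>2) * ennreal (2 * (1 + 3 * p\<^sup>2) * T * exp (2 * B * T))"
      by (intro mult_left_mono moment) auto
    also have "\<dots> = ennreal ((2 + 2 * K\<^sup>2) * (2 * (1 + 3 * p\<^sup>2) * T * exp (2 * B * T)))"
      by (rule ennreal_mult'[symmetric]) simp
    also have "\<dots> \<le> ennreal C"
    proof (rule ennreal_leI)
      have "p\<^sup>2 \<le> R\<^sup>2" using p by (simp add: abs_le_square_iff[symmetric])
      then show "(2 + 2 * K\<^sup>2) * (2 * (1 + 3 * p\<^sup>2) * T * exp (2 * B * T)) \<le> C"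
        unfolding C_def using T by (intro mult_left_mono mult_right_mono) auto
    qed
    finally show "(\<integral>\<^sup>+\<omega>. ennreal (LINT s:{t..T}|lborel. (P t p s \<omega> - K)\<^sup>2) \<partial>\<mu>) \<le> ennreal C" .
  qed
qed

lemma compact_strict_domain_margin:
  assumes C: "compact C" "C \<subseteq> swing_domain_strict T ub m M"
  obtains \<delta> R where "0 < \<delta>" "\<And>t p z. (t, p, z) \<in> C \<Longrightarrow>
    t \<in> {0..T} \<and> \<bar>p\<bar> \<le> R \<and> z \<le> M - \<delta> \<and> m + \<delta> \<le> z + ub * (T - t)"
proof (cases "C = {}")
  case True
  then show ?thesis using that[of 1 0] by simp
next
  case False
  let ?g = "\<lambda>(t, p, z). min (M - z) (z + ub * (T - t) - m)" and ?h = "\<lambda>(t :: real, p :: real, z :: real). \<bar>p\<bar>"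
  have g: "continuous_on C ?g" unfolding split_beta' by (intro continuous_intros)
  have h: "continuous_on C ?h" unfolding split_beta' by (intro continuous_intros)
  obtain a where a: "a \<in> C" "\<And>b. b \<in> C \<Longrightarrow> ?g a \<le> ?g b"
    using continuous_attains_inf[OF C(1) False g] by blast
  obtain a' where a'0: "\<forall>b\<in>C. ?h b \<le> ?h a'"
    by (rule bexE[OF continuous_attains_sup[OF C(1) False h]]) (rule that)
  note a' = bspec[OF a'0]
  show ?thesis
  proof (rule that[of "?g a" "?h a'"])
    show "0 < ?g a" using a(1) C(2) by (auto simp: swing_domain_strict_def)
    fix t p z assume b: "(t, p, z) \<in> C"
    then show "t \<in> {0..T} \<and> \<bar>p\<bar> \<le> ?h a' \<and> z \<le> M - ?g a \<and> m + ?g a \<le> z + ub * (T - t)"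
      using a(2)[OF b] a'[OF b] C(2) by (auto simp: swing_domain_strict_def)
  qed
qed

theorem proposition4p1:
  fixes \<mu> :: "'a measure" and F :: "real \<Rightarrow> 'a measure" and W :: "real \<Rightarrow> 'a \<Rightarrow> real"
    and f \<sigma> :: "real \<Rightarrow> real \<Rightarrow> real" and P :: "real \<Rightarrow> real \<Rightarrow> real \<Rightarrow> 'a \<Rightarrow> real"
    and T r K ub m M :: real
  assumes "T > 0" and "r \<ge> 0" and "K > 0" and "ub > 0" and "m \<ge> 0" and "M \<ge> 0" and "m < M"
    and "filtered_prob_space T \<mu> F"
    and "brownian_motion_wrt T \<mu> F W"
    and "continuous_on ({0..T} \<times> UNIV) (\<lambda>(s, x). f s x)"
    and "continuous_on ({0..T} \<times> UNIV) (\<lambda>(s, x). \<sigma> s x)"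
    and "\<exists>L. \<forall>s\<in>{0..T}. L-lipschitz_on UNIV (f s)"
    and "\<exists>L. \<forall>s\<in>{0..T}. L-lipschitz_on UNIV (\<sigma> s)"
    and "\<And>t p. t \<in> {0..T} \<Longrightarrow> strong_solution T \<mu> F W f \<sigma> t p (P t p)"
  shows "(\<forall>C. compact C \<and> C \<subseteq> swing_domain_strict T ub m M \<longrightarrow>
            uniform_limit C
              (\<lambda>c (t, p, z). penalized_value \<mu> F P T r K ub m M c t p z)
              (\<lambda>(t, p, z). swing_value \<mu> F P T r K ub m M t p z) at_top)
       \<and> (\<forall>(t, p, z) \<in> boundary_alpha T ub m M.
            swing_value \<mu> F P T r K ub m M t p z = 0)
       \<and> (\<forall>(t, p, z) \<in> boundary_beta T ub m M.
            swing_value \<mu> F P T r K ub m M t p z =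
              ub * prob_space.expectation \<mu>
                (\<lambda>\<omega>. LINT s:{t..T}|lborel. exp (- r * (s - t)) * (P t p s \<omega> - K)))"
proof -
  note T = assms(1) and r = assms(2) and ub = assms(4) and mM = assms(7)
  note sol = assms(14)
  have price: "swing_price \<mu> T F P t p r K ub C"
    if t: "t \<in> {0..T}" and C: "0 \<le> C" "(\<integral>\<^sup>+\<omega>. ennreal (LINT s:{t..T}|lborel. (P t p s \<omega> - K)\<^sup>2) \<partial>\<mu>) \<le> ennreal C"
    for t p C
    using assms(8) r ub t C sol[OF t, of p]
    by (auto simp: swing_price_def swing_price_axioms_def filtered_space_def filtered_space_axioms_def
        filtered_prob_space_def strong_solution_def)
  have bound: "\<exists>C\<ge>0. \<forall>t p. t \<in> {0..T} \<longrightarrow> \<bar>p\<bar> \<le> R \<longrightarrow> swing_price \<mu> T F P t p r K ub C" for R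
    by (rule strong_solution_price_bound[OF assms(8,9,1,10,12,11,13) sol, of R K]) (use price in blast)+
  have uniform: "uniform_limit C
              (\<lambda>c (t, p, z). penalized_value \<mu> F P T r K ub m M c t p z)
              (\<lambda>(t, p, z). swing_value \<mu> F P T r K ub m M t p z) at_top"
    if C: "compact C" "C \<subseteq> swing_domain_strict T ub m M" for C
  proof -
    obtain \<delta> R where \<delta>: "0 < \<delta>" and dom: "\<And>t p z. (t, p, z) \<in> C \<Longrightarrow>
      t \<in> {0..T} \<and> \<bar>p\<bar> \<le> R \<and> z \<le> M - \<delta> \<and> m + \<delta> \<le> z + ub * (T - t)"
      by (rule compact_strict_domain_margin[OF C]) (rule that)
    obtain B where B: "0 \<le> B" "\<And>t p. t \<in> {0..T} \<Longrightarrow> \<bar>p\<bar> \<le> R \<Longrightarrow> swing_price \<mu> T F P t p r K ub B"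
      using bound[of R] by blast
    have e0: "((\<lambda>c. 1 / sqrt c) \<longlongrightarrow> 0) at_top"
      using tendsto_inverse_0_at_top[OF sqrt_at_top] by (simp add: inverse_eq_divide)
    have low: "((\<lambda>c. sqrt (1 / sqrt c) * (B + ub) / 2) \<longlongrightarrow> 0) at_top"
      using tendsto_mult_right[OF tendsto_real_sqrt[OF e0], of "(B + ub) / 2"] by simp
    have up: "((\<lambda>c. ub * B / (4 * c * exp (- r * T))) \<longlongrightarrow> 0) at_top"
      using tendsto_mult_left[OF tendsto_inverse_0_at_top[OF filterlim_ident], of "ub * B / (4 * exp (- r * T))"]
      by (simp add: field_simps)
    show ?thesis
    proof (rule uniform_limitI)
      fix \<epsilon> :: real assume \<epsilon>: "0 < \<epsilon>"
      have "\<forall>\<^sub>F c in at_top. 0 < c \<and> 1 / sqrt c < min \<delta> ((M - m) / 2) \<and>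
        sqrt (1 / sqrt c) * (B + ub) / 2 < \<epsilon> \<and> ub * B / (4 * c * exp (- r * T)) < \<epsilon>"
        using \<delta> mM \<epsilon> by (intro eventually_conj eventually_gt_at_top order_tendstoD(2)[OF e0]
            order_tendstoD(2)[OF low] order_tendstoD(2)[OF up]) auto
      then show "\<forall>\<^sub>F c in at_top. \<forall>x\<in>C. dist (case x of (t, p, z) \<Rightarrow> penalized_value \<mu> F P T r K ub m M c t p z)
          (case x of (t, p, z) \<Rightarrow> swing_value \<mu> F P T r K ub m M t p z) < \<epsilon>"
      proof (rule eventually_mono, intro ballI)
        fix c x
        assume c: "0 < c \<and> 1 / sqrt c < min \<delta> ((M - m) / 2) \<and>
        sqrt (1 / sqrt c) * (B + ub) / 2 < \<epsilon> \<and> ub * B / (4 * c * exp (- r * T)) < \<epsilon>" and x: "x \<in> C"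
        obtain t p z where xe: "x = (t, p, z)" by (cases x)
        note d = dom[OF x[unfolded xe]]
        interpret swing_price \<mu> T F P t p r K ub B using B(2) d by blast
        have "penalized_value \<mu> F P T r K ub m M c t p z
            \<le> swing_value \<mu> F P T r K ub m M t p z + ub * B / (4 * c * exp (- r * T))"
          by (rule penalized_value_upper) (use c d \<delta> mM in auto)
        moreover have "swing_value \<mu> F P T r K ub m M t p z
            \<le> penalized_value \<mu> F P T r K ub m M c t p z + sqrt (1 / sqrt c) * (B + ub) / 2"
          by (rule penalized_value_lower[OF _ refl]) (use c d in \<open>auto simp: min_def split: if_splits\<close>)
        ultimately show "dist (case x of (t, p, z) \<Rightarrow> penalized_value \<mu> F P T r K ub m M c t p z)
          (case x of (t, p, z) \<Rightarrow> swing_value \<mu> F P T r K ub m M t p z) < \<epsilon>"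
          using c unfolding xe by (simp add: dist_real_def abs_less_iff)
      qed
    qed
  qed
  have alpha: "swing_value \<mu> F P T r K ub m M t p z = 0" if a: "(t, p, z) \<in> boundary_alpha T ub m M" for t p z
  proof -
    have t: "t \<in> {0..T}" and z: "z = M" using a by (auto simp: boundary_alpha_def swing_domain_def)
    obtain B where "swing_price \<mu> T F P t p r K ub B" using bound[of "\<bar>p\<bar>"] t by blast
    then interpret swing_price \<mu> T F P t p r K ub B .
    have "swing_value \<mu> F P T r K ub m M t p z = expectation (payoff (\<lambda>s \<omega>. 0))"
    proof (rule swing_value_forced)
      show "(\<lambda>s \<omega>. 0) \<in> adm_controls T \<mu> F ub m M t z"
        using constant_control[of 0 ub t] ub mM z t by (simp add: adm_controls_def cumulated_constant)
      fix u assume u: "u \<in> adm_controls T \<mu> F ub m M t z"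
      then have uc: "u \<in> ctrl" and ae: "AE \<omega> in \<mu>. cumulated t z u T \<omega> \<in> {m..M}" by (auto simp: adm_controls_def)
      show "AE \<omega> in \<mu>. cumulated t z u T \<omega> = cumulated t z (\<lambda>s \<omega>. 0) T \<omega>"
        using ae AE_space
      proof eventually_elim
        case (elim \<omega>)
        then show ?case using cumulated_range(1)[OF uc t, of \<omega> z] z t by (simp add: cumulated_constant)
      qed
    qed simp
    then show ?thesis unfolding running_payoff_def by (simp add: set_lebesgue_integral_def)
  qed
  have beta: "swing_value \<mu> F P T r K ub m M t p z =
              ub * prob_space.expectation \<mu>
                (\<lambda>\<omega>. LINT s:{t..T}|lborel. exp (- r * (s - t)) * (P t p s \<omega> - K))"
    if b: "(t, p, z) \<in> boundary_beta T ub m M" for t p z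
  proof -
    have t: "t \<in> {0..T}" and z: "z + ub * (T - t) = m" using b by (auto simp: boundary_beta_def swing_domain_def)
    obtain B where "swing_price \<mu> T F P t p r K ub B" using bound[of "\<bar>p\<bar>"] t by blast
    then interpret swing_price \<mu> T F P t p r K ub B .
    have "swing_value \<mu> F P T r K ub m M t p z = expectation (payoff (\<lambda>s \<omega>. ub))"
    proof (rule swing_value_forced)
      show "(\<lambda>s \<omega>. ub) \<in> adm_controls T \<mu> F ub m M t z"
        using constant_control[of ub ub t] ub mM z t by (simp add: adm_controls_def cumulated_constant)
      fix u assume u: "u \<in> adm_controls T \<mu> F ub m M t z"
      then have uc: "u \<in> ctrl" and ae: "AE \<omega> in \<mu>. cumulated t z u T \<omega> \<in> {m..M}" by (auto simp: adm_controls_def)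
      show "AE \<omega> in \<mu>. cumulated t z u T \<omega> = cumulated t z (\<lambda>s \<omega>. ub) T \<omega>"
        using ae AE_space
      proof eventually_elim
        case (elim \<omega>)
        then show ?case using cumulated_range(2)[OF uc t, of \<omega> z] z t by (simp add: cumulated_constant)
      qed
    qed simp
    also have "expectation (payoff (\<lambda>s \<omega>. ub)) = ub * expectation (\<lambda>\<omega>. LINT s:{t..T}|lborel. exp (- r * (s - t)) * (P t p s \<omega> - K))"
      unfolding running_payoff_def by (simp add: mult.commute)
    finally show ?thesis .
  qed
  show ?thesis
  proof (intro conjI allI impI)
    show "\<forall>(t, p, z)\<in>boundary_alpha T ub m M. swing_value \<mu> F P T r K ub m M t p z = 0"
      by (clarify, rule alpha)
    show "\<forall>(t, p, z)\<in>boundary_beta T ub m M. swing_value \<mu> F P T r K ub m M t p z =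
        ub * prob_space.expectation \<mu> (\<lambda>\<omega>. LINT s:{t..T}|lborel. exp (- r * (s - t)) * (P t p s \<omega> - K))"
      by (clarify, rule beta)
  qed (use uniform in blast)
qed

end
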